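(* Let $\Omega\subset\mathbb{R}^n$ be a bounded domain, let $\Sigma\neq\emptyset$ be an open, connected Lipschitz subset of $\partial\Omega$, put $\Sigma^c:=\partial\Omega\setminus\overline{\Sigma}$, and let $G\subset\Omega$ be a domain that has a positive distance to $\Sigma^c$. For $z\in L_2(\Omega)$ let $Bz\in (H^2_{0,\Sigma^c}(\Omega))'$ be defined by $$(Bz)(v):=-\int_\Omega z\,\Delta v\,dx\qquad (v\in H^2_{0,\Sigma^c}(\Omega)).$$ Then there exist an $\alpha\in(0,1)$ and a constant $K$ such that for all $z\in L_2(\Omega)$, $$\|z\|_{L_2(G)}\le K\,\|Bz\|_{(H^2_{0,\Sigma^c}(\Omega))'}^{\alpha}\,\big(\|z\|_{L_2(\Omega)}+\|Bz\|_{(H^2_{0,\Sigma^c}(\Omega))'}\big)^{1-\alpha}.$$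
   Context: A domain is a non-empty open connected set. "Open" for $\Sigma$ means relatively open in $\partial\Omega$. $H^2_{0,\Sigma^c}(\Omega):=\{v\in C^\infty(\Omega)\cap H^2(\Omega)\colon \operatorname{supp} v\cap\Sigma^c=\emptyset\}$, equipped with the $H^2(\Omega)$-norm, where $\operatorname{supp} v$ is the closure in $\mathbb{R}^n$ of $\{x\in\Omega: v(x)\ne0\}$. The dual norm is $\|f\|_{(H^2_{0,\Sigma^c}(\Omega))'}=\sup_{0\neq v\in H^2_{0,\Sigma^c}(\Omega)}|f(v)|/\|v\|_{H^2(\Omega)}$. All spaces are real. *)

theory Defs
  imports "HOL-Analysis.Analysis"
begin

definition domain :: "'a::euclidean_space set \<Rightarrow> bool" where
  "domain \<Omega> \<longleftrightarrow> \<Omega> \<noteq> {} \<and> open \<Omega> \<and> connected \<Omega>"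

(* Near every point p of S, in suitable rigid coordinates centred at p with last axis e, \<Omega> is the
   strict epigraph of a Lipschitz function psi on the disc of radius r in the hyperplane orthogonal
   to e; x - p - ((x - p) \<bullet> e) e is the projection of x - p to that hyperplane.
   Neither r nor L has to be uniform in p. *)
definition lipschitz_portion :: "'a::euclidean_space set \<Rightarrow> 'a set \<Rightarrow> bool" where
  "lipschitz_portion \<Omega> S \<longleftrightarrow> S \<subseteq> frontier \<Omega> \<and>
     (\<forall>p\<in>S. \<exists>e r L \<psi>. norm e = 1 \<and> r > 0 \<and> L-lipschitz_on {y. y \<bullet> e = 0 \<and> norm y < r} \<psi> \<and> \<psi> 0 = 0 \<and>
        (\<forall>x\<in>ball p r. x \<in> \<Omega> \<longleftrightarrow> (x - p) \<bullet> e > \<psi> (x - p - ((x - p) \<bullet> e) *\<^sub>R e)))"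

(* Iterated partial derivatives along a list of coordinate directions (elements of Basis). *)
primrec partials :: "'a::euclidean_space list \<Rightarrow> ('a \<Rightarrow> real) \<Rightarrow> 'a \<Rightarrow> real" where
  "partials [] f = f"
| "partials (b # bs) f = (\<lambda>x. frechet_derivative (partials bs f) (at x) b)"

(* C^\<infinity> on an open set: every iterated partial derivative exists and is again differentiable. *)
definition smooth_on :: "'a::euclidean_space set \<Rightarrow> ('a \<Rightarrow> real) \<Rightarrow> bool" where
  "smooth_on \<Omega> f \<longleftrightarrow> (\<forall>bs. set bs \<subseteq> Basis \<longrightarrow> partials bs f differentiable_on \<Omega>)"

definition laplacian :: "('a::euclidean_space \<Rightarrow> real) \<Rightarrow> 'a \<Rightarrow> real" where
  "laplacian v x = (\<Sum>b\<in>Basis. partials [b, b] v x)"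

(* The closure is taken in the whole space; values of v outside \<Omega> are irrelevant. *)
definition supp_in :: "'a::euclidean_space set \<Rightarrow> ('a \<Rightarrow> real) \<Rightarrow> 'a set" where
  "supp_in \<Omega> v = closure {x\<in>\<Omega>. v x \<noteq> 0}"

(* Functions rather than classes modulo null sets; the norm does not distinguish the two. *)
definition L2 :: "'a::euclidean_space set \<Rightarrow> ('a \<Rightarrow> real) set" where
  "L2 \<Omega> = {z. z \<in> borel_measurable (lebesgue_on \<Omega>) \<and> integrable (lebesgue_on \<Omega>) (\<lambda>x. (z x)\<^sup>2)}"

definition L2_norm :: "'a::euclidean_space set \<Rightarrow> ('a \<Rightarrow> real) \<Rightarrow> real" where
  "L2_norm \<Omega> z = sqrt (LINT x|lebesgue_on \<Omega>. (z x)\<^sup>2)"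

definition test_functions :: "'a::euclidean_space set \<Rightarrow> ('a \<Rightarrow> real) set" where
  "test_functions \<Omega> = {\<phi>. smooth_on UNIV \<phi> \<and> compact (supp_in UNIV \<phi>) \<and> supp_in UNIV \<phi> \<subseteq> \<Omega>}"

definition is_weak_deriv ::
  "'a::euclidean_space set \<Rightarrow> 'a list \<Rightarrow> ('a \<Rightarrow> real) \<Rightarrow> ('a \<Rightarrow> real) \<Rightarrow> bool" where
  "is_weak_deriv \<Omega> bs u g \<longleftrightarrow>
     (\<forall>\<phi>\<in>test_functions \<Omega>.
        (LINT x|lebesgue_on \<Omega>. u x * partials bs \<phi> x) =
        (-1) ^ length bs * (LINT x|lebesgue_on \<Omega>. g x * \<phi> x))"

(* Direction lists of length at most 2; the empty list stands for the function itself. *)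
definition dirs2 :: "'a::euclidean_space list set" where
  "dirs2 = {bs. set bs \<subseteq> Basis \<and> length bs \<le> 2}"

definition H2 :: "'a::euclidean_space set \<Rightarrow> ('a \<Rightarrow> real) set" where
  "H2 \<Omega> = {u \<in> L2 \<Omega>. \<forall>bs\<in>dirs2. \<exists>g\<in>L2 \<Omega>. is_weak_deriv \<Omega> bs u g}"

(* The weak derivative is unique up to null sets, so any choice gives the same L2 norm. *)
definition weak_deriv :: "'a::euclidean_space set \<Rightarrow> 'a list \<Rightarrow> ('a \<Rightarrow> real) \<Rightarrow> 'a \<Rightarrow> real" where
  "weak_deriv \<Omega> bs u = (SOME g. g \<in> L2 \<Omega> \<and> is_weak_deriv \<Omega> bs u g)"

(* The sum runs over ordered pairs of directions, i.e. the second-order part is the Frobenius norm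
   of the Hessian. *)
definition H2_norm :: "'a::euclidean_space set \<Rightarrow> ('a \<Rightarrow> real) \<Rightarrow> real" where
  "H2_norm \<Omega> u = sqrt (\<Sum>bs\<in>dirs2. (L2_norm \<Omega> (weak_deriv \<Omega> bs u))\<^sup>2)"

(* The space written H^2_{0,T}(\<Omega>) with T = \<Sigma>^c. *)
definition H2_0 :: "'a::euclidean_space set \<Rightarrow> 'a set \<Rightarrow> ('a \<Rightarrow> real) set" where
  "H2_0 \<Omega> T = {v. smooth_on \<Omega> v \<and> v \<in> H2 \<Omega> \<and> supp_in \<Omega> v \<inter> T = {}}"

(* A supremum of reals, meaningful for bounded functionals f; v \<noteq> 0 is meant as a function on \<Omega>. *)
definition dual_norm :: "'a::euclidean_space set \<Rightarrow> 'a set \<Rightarrow> (('a \<Rightarrow> real) \<Rightarrow> real) \<Rightarrow> real" where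
  "dual_norm \<Omega> T f = (SUP v\<in>{v \<in> H2_0 \<Omega> T. \<exists>x\<in>\<Omega>. v x \<noteq> 0}. \<bar>f v\<bar> / H2_norm \<Omega> v)"

definition B_op :: "'a::euclidean_space set \<Rightarrow> ('a \<Rightarrow> real) \<Rightarrow> ('a \<Rightarrow> real) \<Rightarrow> real" where
  "B_op \<Omega> z v = - (LINT x|lebesgue_on \<Omega>. z x * laplacian v x)"

end

theory Submission
  imports Defs
begin

text \<open>
  Extend \<open>z\<close> by zero. Testing against functions supported away from \<open>\<Sigma>c\<close> shows that the extension
  is harmonic there up to an error of the size of the dual norm of \<open>B z\<close>, and it vanishes on a ball
  outside \<open>\<Omega>\<close> near a point of \<open>\<Sigma>\<close>, so that smallness has to be propagated from that ball to \<open>G\<close>.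

  Let \<open>N s\<close> average a function with a radial kernel of width \<open>s\<close>. Then \<open>f - N s f\<close> is the Laplacian of
  a compactly supported smooth function whose \<open>H2\<close> norm is bounded by the \<open>L2\<close> norm of \<open>f\<close>: integrate
  over the width of the average. Hence the pairing of the extension with \<open>f\<close> hardly changes if \<open>f\<close> is
  averaged \<open>k\<close> times with width \<open>R / k\<close>. A difference of \<open>f\<close> with step \<open>h\<close> followed by such an average
  has norm of order \<open>k * norm h / R\<close>, so differences of order \<open>k\<close> and more are exponentially small in \<open>k\<close>,
  and Newton's expansion of a long translation gives a bound on a translated ball with an exponential
  loss in \<open>k\<close> for the data and an exponential gain for the a priori bound. Chaining along paths and
  optimizing \<open>k\<close> yields the Hoelder estimate. Everything takes place on the test functions, so neither
  a fundamental solution nor the analyticity of harmonic functions is needed.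
\<close>

section \<open>Square integrable functions and smooth functions with compact support\<close>

text \<open>All that is known of \<open>z\<close> is its pairing with Laplacians of test functions
  that may be nonzero on \<Sigma>, so estimates are made on the test function and become norm bounds
  by \<open>L2_norm_ball_duality\<close>. The shape of \<Sigma> enters only through the exterior
  ball. The decisive point is that the function with Laplacian \<open>f - smoothing s f\<close> has
  an \<open>H2\<close> norm bounded uniformly in \<open>s \<le> 1\<close>. Hence k averages of width
  R / k cost only k times the dual norm, while on k-th differences with step at most \<sigma> / k
  they gain a factor (const * \<sigma> / R)^k. Newton's expansion with m = 4 k steps loses 3^m =
  81^k, and a ratio \<sigma> / R fixed small enough beats this loss. One such step lets a ball of
  radius 2 \<sigma> control the ball of radius 4 \<sigma> with the same centre, so the radius does
  not shrink along a path and the constants do not depend on \<open>z\<close>. The kernel is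
  dictated by the identity behind the potential: the kernel times y has to be the gradient of a
  compactly supported function.\<close>

lemma quadratic_form_discriminant:
  fixes a b c :: real
  assumes quad: "\<And>s t. 0 \<le> s\<^sup>2 * a + 2 * s * t * b + t\<^sup>2 * c" and "0 \<le> a"
  shows "b\<^sup>2 \<le> a * c"
proof (cases "a = 0")
  case True
  have "b = 0"
  proof (rule ccontr)
    assume "b \<noteq> 0"
    \<comment> \<open>At this point the form takes the value -1.\<close>
    then show False using quad[of "- (c + 1) / (2 * b)" 1] True by (simp add: field_simps)
  qed
  then show ?thesis using True by simp
next
  case False
  \<comment> \<open>The form evaluated at s = -b, t = a.\<close>
  have "0 \<le> a * (a * c - b\<^sup>2)"
    using quad[of "- b" a] by (simp add: power2_eq_square algebra_simps)
  then show ?thesis using False \<open>0 \<le> a\<close> by (simp add: zero_le_mult_iff)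
qed

text \<open>Stated for an arbitrary measure because it serves both the Lebesgue spaces and the index
  measure over which translates are averaged.\<close>

lemma Cauchy_Schwarz_integral:
  fixes f g :: "'a \<Rightarrow> real"
  assumes [measurable]: "f \<in> borel_measurable M" "g \<in> borel_measurable M"
    and f2: "integrable M (\<lambda>x. (f x)\<^sup>2)" and g2: "integrable M (\<lambda>x. (g x)\<^sup>2)"
  shows "integrable M (\<lambda>x. f x * g x)"
    and "(LINT x|M. f x * g x)\<^sup>2 \<le> (LINT x|M. (f x)\<^sup>2) * (LINT x|M. (g x)\<^sup>2)"
proof -
  show fg: "integrable M (\<lambda>x. f x * g x)"
  proof (rule Bochner_Integration.integrable_bound[OF Bochner_Integration.integrable_add[OF f2 g2]])
    have "norm (f x * g x) \<le> norm ((f x)\<^sup>2 + (g x)\<^sup>2)" for x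
      using sum_squares_bound[of "\<bar>f x\<bar>" "\<bar>g x\<bar>"] zero_le_power2[of "f x"] zero_le_power2[of "g x"]
        mult_nonneg_nonneg[OF abs_ge_zero[of "f x"] abs_ge_zero[of "g x"]]
      unfolding real_norm_def abs_mult power2_abs by linarith
    then show "AE x in M. norm (f x * g x) \<le> norm ((f x)\<^sup>2 + (g x)\<^sup>2)" by simp
  qed simp
  let ?A = "LINT x|M. (f x)\<^sup>2" and ?B = "LINT x|M. f x * g x" and ?C = "LINT x|M. (g x)\<^sup>2"
  have quad: "0 \<le> s\<^sup>2 * ?A + 2 * s * t * ?B + t\<^sup>2 * ?C" for s t :: real
  proof -
    have eq: "(s * f x + t * g x)\<^sup>2 = s\<^sup>2 * (f x)\<^sup>2 + 2 * s * t * (f x * g x) + t\<^sup>2 * (g x)\<^sup>2" for x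
      by (simp add: power2_eq_square algebra_simps)
    have "0 \<le> (LINT x|M. (s * f x + t * g x)\<^sup>2)" by simp
    also have "\<dots> = s\<^sup>2 * ?A + 2 * s * t * ?B + t\<^sup>2 * ?C"
      unfolding eq using f2 g2 fg by simp
    finally show ?thesis .
  qed
  show "?B\<^sup>2 \<le> ?A * ?C"
    by (rule quadratic_form_discriminant[OF quad]) simp
qed

lemma L2_D: "f \<in> L2 S \<Longrightarrow> f \<in> borel_measurable (lebesgue_on S)"
  "f \<in> L2 S \<Longrightarrow> integrable (lebesgue_on S) (\<lambda>x. (f x)\<^sup>2)"
  by (auto simp: L2_def)

lemma L2_norm_nonneg [simp]: "0 \<le> L2_norm S f"
  by (simp add: L2_norm_def)

lemma L2_norm_power2: "(L2_norm S f)\<^sup>2 = (LINT x|lebesgue_on S. (f x)\<^sup>2)"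
  by (simp add: L2_norm_def)

lemma L2_mult_integrable:
  assumes "f \<in> L2 S" "g \<in> L2 S" shows "integrable (lebesgue_on S) (\<lambda>x. f x * g x)"
  using Cauchy_Schwarz_integral(1)[of f "lebesgue_on S" g] assms by (simp add: L2_def)

lemma L2_Cauchy_Schwarz:
  assumes "f \<in> L2 S" "g \<in> L2 S"
  shows "\<bar>LINT x|lebesgue_on S. f x * g x\<bar> \<le> L2_norm S f * L2_norm S g"
proof -
  have "(LINT x|lebesgue_on S. f x * g x)\<^sup>2 \<le> (L2_norm S f * L2_norm S g)\<^sup>2"
    using Cauchy_Schwarz_integral(2)[of f "lebesgue_on S" g] assms
    by (simp add: L2_def power_mult_distrib L2_norm_power2)
  then show ?thesis unfolding abs_le_square_iff[symmetric] by (simp add: abs_mult)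
qed

lemma L2_add:
  assumes "f \<in> L2 S" "g \<in> L2 S" shows "(\<lambda>x. f x + g x) \<in> L2 S"
proof -
  note [measurable] = L2_D(1)[OF assms(1)] L2_D(1)[OF assms(2)]
  have "integrable (lebesgue_on S) (\<lambda>x. (f x)\<^sup>2 + 2 * (f x * g x) + (g x)\<^sup>2)"
    using assms L2_mult_integrable[OF assms] by (auto simp: L2_def)
  then show ?thesis unfolding L2_def by (simp add: power2_sum algebra_simps)
qed

lemma L2_cmult: "f \<in> L2 S \<Longrightarrow> (\<lambda>x. c * f x) \<in> L2 S"
  by (auto simp: L2_def power_mult_distrib)

lemma L2_diff: "f \<in> L2 S \<Longrightarrow> g \<in> L2 S \<Longrightarrow> (\<lambda>x. f x - g x) \<in> L2 S"
  using L2_add[of f S "\<lambda>x. -1 * g x"] L2_cmult[of g S "-1"] by simp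

lemma L2_norm_cmult: "L2_norm S (\<lambda>x. c * f x) = \<bar>c\<bar> * L2_norm S f"
  by (simp add: L2_norm_def power_mult_distrib real_sqrt_mult)

lemma L2_norm_triangle:
  assumes "f \<in> L2 S" "g \<in> L2 S"
  shows "L2_norm S (\<lambda>x. f x + g x) \<le> L2_norm S f + L2_norm S g"
proof -
  have "(L2_norm S (\<lambda>x. f x + g x))\<^sup>2 = (LINT x|lebesgue_on S. (f x)\<^sup>2 + 2 * (f x * g x) + (g x)\<^sup>2)"
    unfolding L2_norm_power2 by (simp add: power2_sum algebra_simps)
  also have "\<dots> = (L2_norm S f)\<^sup>2 + 2 * (LINT x|lebesgue_on S. f x * g x) + (L2_norm S g)\<^sup>2"
    using assms L2_mult_integrable[OF assms] by (simp add: L2_norm_power2 L2_def)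
  also have "\<dots> \<le> (L2_norm S f + L2_norm S g)\<^sup>2"
    unfolding power2_sum using L2_Cauchy_Schwarz[OF assms] by linarith
  finally show ?thesis by (rule power2_le_imp_le) (intro add_nonneg_nonneg L2_norm_nonneg)
qed

lemma L2_norm_diff:
  assumes "f \<in> L2 S" "g \<in> L2 S"
  shows "L2_norm S (\<lambda>x. f x - g x) \<le> L2_norm S f + L2_norm S g"
  using L2_norm_triangle[OF assms(1) L2_cmult[OF assms(2), of "-1"]] L2_norm_cmult[of S "-1" g] by simp

lemma L2_restrict:
  assumes "S \<in> sets lebesgue"
  shows "(\<lambda>x. if x \<in> S then f x else 0) \<in> L2 UNIV \<longleftrightarrow> f \<in> L2 S"
proof -
  have eq: "(\<lambda>x. (if x \<in> S then f x else 0)\<^sup>2) = (\<lambda>x. if x \<in> S then (f x)\<^sup>2 else 0)" by auto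
  show ?thesis
    unfolding L2_def lebesgue_on_UNIV_eq eq mem_Collect_eq
    using borel_measurable_if[OF assms, of f] Lebesgue_Measure.integrable_restrict_UNIV[OF assms, of "\<lambda>x. (f x)\<^sup>2"] by simp
qed

lemma L2_norm_restrict:
  assumes "S \<in> sets lebesgue"
  shows "L2_norm UNIV (\<lambda>x. if x \<in> S then f x else 0) = L2_norm S f"
proof -
  have eq: "(\<lambda>x. (if x \<in> S then f x else 0)\<^sup>2) = (\<lambda>x. if x \<in> S then (f x)\<^sup>2 else 0)" by auto
  show ?thesis
    unfolding L2_norm_def lebesgue_on_UNIV_eq eq
    using Lebesgue_Measure.integral_restrict_UNIV[OF assms, of "\<lambda>x. (f x)\<^sup>2"] by simp
qed

lemma L2_norm_mono:
  assumes f: "f \<in> L2 T" and S: "S \<in> sets lebesgue" "T \<in> sets lebesgue" "S \<subseteq> T"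
  shows "f \<in> L2 S" "L2_norm S f \<le> L2_norm T f"
proof -
  let ?f = "\<lambda>x. if x \<in> S then f x else 0" and ?g = "\<lambda>x. if x \<in> T then f x else 0"
  have g: "?g \<in> L2 UNIV" using f S L2_restrict by blast
  have [measurable]: "?g \<in> borel_measurable lebesgue" using L2_D(1)[OF g] by (simp add: lebesgue_on_UNIV_eq)
  have eq: "?f = (\<lambda>x. if x \<in> S then ?g x else 0)" using S(3) by (auto simp: fun_eq_iff)
  have [measurable]: "?f \<in> borel_measurable lebesgue" unfolding eq
    by (rule measurable_If_set) (use S in auto)
  have gi: "integrable lebesgue (\<lambda>x. (?g x)\<^sup>2)" using L2_D(2)[OF g] by (simp add: lebesgue_on_UNIV_eq)
  have fi: "integrable lebesgue (\<lambda>x. (?f x)\<^sup>2)"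
    by (rule Bochner_Integration.integrable_bound[OF gi]) (use S in \<open>auto intro!: AE_I2\<close>)
  then have "?f \<in> L2 UNIV" by (simp add: L2_def lebesgue_on_UNIV_eq)
  then show "f \<in> L2 S" using S L2_restrict by blast
  have "(LINT x|lebesgue. (?f x)\<^sup>2) \<le> (LINT x|lebesgue. (?g x)\<^sup>2)"
    by (rule integral_mono[OF fi gi]) (use S in auto)
  then have "L2_norm UNIV ?f \<le> L2_norm UNIV ?g" by (simp add: L2_norm_def lebesgue_on_UNIV_eq)
  then show "L2_norm S f \<le> L2_norm T f" using L2_norm_restrict[OF S(1), of f] L2_norm_restrict[OF S(2), of f] by simp
qed

section \<open>Iterated partial derivatives and smooth functions supported in a ball\<close>

declare partials.simps(2) [simp del]

lemma partials_append: "partials bs (partials cs f) = partials (bs @ cs) f"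
  by (induction bs) (auto simp: partials.simps(2))

lemma smooth_on_partials: "smooth_on S f \<Longrightarrow> set cs \<subseteq> Basis \<Longrightarrow> smooth_on S (partials cs f)"
  by (simp add: smooth_on_def partials_append)

lemma smooth_on_subset: "smooth_on T f \<Longrightarrow> S \<subseteq> T \<Longrightarrow> smooth_on S f"
  by (auto simp: smooth_on_def intro: differentiable_on_subset)

lemma smooth_on_has_derivative:
  fixes f :: "'a::euclidean_space \<Rightarrow> real"
  assumes "smooth_on S f" "open S" "x \<in> S"
  shows "(f has_derivative (\<lambda>h. \<Sum>b\<in>Basis. (h \<bullet> b) * partials [b] f x)) (at x)"
proof -
  have "partials [] f differentiable_on S" using assms(1) unfolding smooth_on_def by (metis empty_subsetI list.set(1))
  then have d: "f differentiable at x" using assms by (simp add: differentiable_on_eq_differentiable_at)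
  then have D: "(f has_derivative frechet_derivative f (at x)) (at x)" by (simp add: frechet_derivative_works)
  have "frechet_derivative f (at x) h = (\<Sum>b\<in>Basis. (h \<bullet> b) * partials [b] f x)" for h
  proof -
    have l: "linear (frechet_derivative f (at x))" using D has_derivative_linear by blast
    have "frechet_derivative f (at x) h = frechet_derivative f (at x) (\<Sum>b\<in>Basis. (h \<bullet> b) *\<^sub>R b)"
      by (simp add: euclidean_representation)
    also have "\<dots> = (\<Sum>b\<in>Basis. (h \<bullet> b) * partials [b] f x)"
      by (simp add: partials.simps(2) linear_sum[OF l] linear_cmul[OF l])
    finally show ?thesis .
  qed
  then show ?thesis using D by presburger
qed

lemma smooth_on_continuous:
  assumes "smooth_on S f" "set bs \<subseteq> Basis"
  shows "continuous_on S (partials bs f)"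
  using assms by (auto simp: smooth_on_def intro: differentiable_imp_continuous_on)

lemma partials_eqI:
  assumes "(f has_derivative f') (at x)" shows "partials [b] f x = f' b"
  using frechet_derivative_at[OF assms] by (simp add: partials.simps(2))

text \<open>A coinductive criterion: if a family of differentiable functions is closed under partial
  derivatives, every iterated partial derivative stays in the family and is again differentiable.
  Sums, multiples, translates, averages and the cutoffs are all shown to be smooth in this
  way.\<close>

lemma smooth_family:
  fixes F :: "('a::euclidean_space \<Rightarrow> real) set"
  assumes "\<And>g. g \<in> F \<Longrightarrow> \<exists>g'. (\<forall>x. (g has_derivative g' x) (at x)) \<and> (\<forall>b\<in>Basis. (\<lambda>x. g' x b) \<in> F)"
    and "g \<in> F"
  shows "smooth_on UNIV g"
proof -
  have *: "set bs \<subseteq> Basis \<Longrightarrow> partials bs g \<in> F" for bs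
  proof (induction bs)
    case (Cons b bs)
    then obtain g' where g': "\<And>x. (partials bs g has_derivative g' x) (at x)" "(\<lambda>x. g' x b) \<in> F"
      using assms(1)[of "partials bs g"] by auto
    have "partials (b # bs) g = (\<lambda>x. g' x b)"
      using frechet_derivative_at[OF g'(1)] by (auto simp: fun_eq_iff partials.simps(2))
    then show ?case using g'(2) by simp
  qed (simp add: assms)
  show ?thesis unfolding smooth_on_def
  proof (intro allI impI)
    fix bs :: "'a list" assume "set bs \<subseteq> Basis"
    then show "partials bs g differentiable_on UNIV"
      using assms(1)[OF *[of bs]] by (auto simp: differentiable_on_def differentiable_def intro: has_derivative_at_withinI)
  qed
qed

text \<open>Centre and radius are explicit because every average or difference enlarges the support
  by a known amount, and the accumulated radius has to stay inside the region where testing is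
  allowed.\<close>

definition bump_space :: "'a::euclidean_space \<Rightarrow> real \<Rightarrow> ('a \<Rightarrow> real) set" where
  "bump_space c r = {f. smooth_on UNIV f \<and> (\<forall>x. f x \<noteq> 0 \<longrightarrow> dist c x \<le> r)}"

lemma bump_space_mono: "f \<in> bump_space c r \<Longrightarrow> dist c' c + r \<le> r' \<Longrightarrow> f \<in> bump_space c' r'"
  unfolding bump_space_def using dist_triangle[of c' _ c] by (smt (verit) mem_Collect_eq)

lemma bump_space_has_derivative:
  "f \<in> bump_space c r \<Longrightarrow> (f has_derivative (\<lambda>h. \<Sum>b\<in>Basis. (h \<bullet> b) * partials [b] f x)) (at x)"
  using smooth_on_has_derivative[of UNIV f x] by (simp add: bump_space_def)

lemma bump_space_continuous: "f \<in> bump_space c r \<Longrightarrow> continuous_on A f"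
  using smooth_on_continuous[of UNIV f "[]"] by (auto simp: bump_space_def intro: continuous_on_subset)

lemma bump_space_partials:
  assumes "f \<in> bump_space c r" "set bs \<subseteq> Basis"
  shows "partials bs f \<in> bump_space c r"
  using assms(2)
proof (induction bs)
  case (Cons b bs)
  then have F: "partials bs f \<in> bump_space c r" by simp
  have "partials (b # bs) f x = 0" if "dist c x > r" for x
  proof -
    have "(partials bs f has_derivative (\<lambda>_. 0)) (at x)"
      by (rule has_derivative_transform_within_open[of "\<lambda>_. 0" "\<lambda>_. 0" x UNIV "- cball c r"])
         (use F that in \<open>auto simp: bump_space_def\<close>)
    from frechet_derivative_at[OF this] show ?thesis by (simp add: partials.simps(2) fun_eq_iff)
  qed
  moreover have "smooth_on UNIV (partials (b # bs) f)"
    using assms(1) Cons.prems by (intro smooth_on_partials) (auto simp: bump_space_def)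
  ultimately show ?case unfolding bump_space_def mem_Collect_eq using linorder_not_le by blast
qed (use assms in simp)

lemma bump_space_partials1: "f \<in> bump_space c r \<Longrightarrow> b \<in> Basis \<Longrightarrow> partials [b] f \<in> bump_space c r"
  by (rule bump_space_partials) auto

lemma compact_support_bounded:
  fixes f :: "'a::euclidean_space \<Rightarrow> real"
  assumes "continuous_on UNIV f" "\<And>x. f x \<noteq> 0 \<Longrightarrow> dist c x \<le> r"
  obtains K where "0 \<le> K" "\<And>x. \<bar>f x\<bar> \<le> K * indicator (cball c r) x"
proof -
  have "compact (f ` cball c r)"
    by (rule compact_continuous_image[OF continuous_on_subset[OF assms(1)]]) auto
  then obtain K where K: "\<And>x. x \<in> cball c r \<Longrightarrow> \<bar>f x\<bar> \<le> K"
    by (metis compact_imp_bounded bounded_iff imageI real_norm_def)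
  \<comment> \<open>For an empty ball \<open>K\<close> is arbitrary and may be negative.\<close>
  have "\<bar>f x\<bar> \<le> max K 0 * indicator (cball c r) x" for x
    using K[of x] assms(2)[of x] by (cases "x \<in> cball c r") (auto simp: max_def)
  then show thesis by (intro that[of "max K 0"]) auto
qed

lemma compact_support_integrable:
  fixes f :: "'a::euclidean_space \<Rightarrow> real"
  assumes "continuous_on UNIV f" "\<And>x. f x \<noteq> 0 \<Longrightarrow> dist c x \<le> r"
  shows "integrable lborel f"
proof -
  obtain K where K: "0 \<le> K" "\<And>x. \<bar>f x\<bar> \<le> K * indicator (cball c r) x"
    using compact_support_bounded[OF assms] by metis
  show ?thesis
  proof (rule Bochner_Integration.integrable_bound)
    show "integrable lborel (\<lambda>x. K * indicat_real (cball c r) x)"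
      using emeasure_lborel_cball_finite[of c r] by (intro integrable_mult_right integrable_real_indicator) auto
    show "f \<in> borel_measurable lborel" using assms(1) borel_measurable_continuous_onI by simp
    show "AE x in lborel. norm (f x) \<le> norm (K * indicat_real (cball c r) x)"
      using K by (auto simp: abs_mult)
  qed
qed

lemma bump_space_bounded:
  assumes "f \<in> bump_space c r"
  obtains K where "0 \<le> K" "\<And>x. \<bar>f x\<bar> \<le> K"
proof -
  obtain K where K: "0 \<le> K" "\<And>x. \<bar>f x\<bar> \<le> K * indicator (cball c r) x"
    using compact_support_bounded[OF bump_space_continuous[OF assms]] assms unfolding bump_space_def by blast
  have "\<bar>f x\<bar> \<le> K" for x using K(1) K(2)[of x] by (cases "x \<in> cball c r") auto
  then show thesis using that K(1) by blast
qed

lemma bump_space_gradient_bounded: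
  assumes "f \<in> bump_space c r"
  obtains K where "0 \<le> K" "\<And>x b. b \<in> Basis \<Longrightarrow> \<bar>partials [b] f x\<bar> \<le> K"
proof -
  have "\<forall>b\<in>Basis. \<exists>K\<ge>0. \<forall>x. \<bar>partials [b] f x\<bar> \<le> K"
    using bump_space_bounded[OF bump_space_partials1[OF assms]] by metis
  then obtain K where K: "\<And>b. b \<in> Basis \<Longrightarrow> 0 \<le> K b \<and> (\<forall>x. \<bar>partials [b] f x\<bar> \<le> K b)" by metis
  have "\<bar>partials [b] f x\<bar> \<le> sum K Basis" if "b \<in> Basis" for x b
  proof -
    have "\<bar>partials [b] f x\<bar> \<le> K b" using K[OF that] by blast
    also have "\<dots> \<le> sum K Basis" by (rule member_le_sum) (use that K in auto)
    finally show ?thesis .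
  qed
  then show thesis using that[of "sum K Basis"] K by (simp add: sum_nonneg)
qed

lemma bump_space_lipschitz:
  fixes f :: "'a::euclidean_space \<Rightarrow> real"
  assumes "f \<in> bump_space c r"
  obtains L where "0 \<le> L" "\<And>x y. \<bar>f x - f y\<bar> \<le> L * norm (x - y)"
proof -
  obtain K where K: "0 \<le> K" "\<And>x b. b \<in> Basis \<Longrightarrow> \<bar>partials [b] f x\<bar> \<le> K"
    using bump_space_gradient_bounded[OF assms] by metis
  let ?D = "\<lambda>x h. \<Sum>b\<in>Basis. (h \<bullet> b) * partials [b] f x"
  have on: "onorm (?D x) \<le> DIM('a) * K" for x
  proof (rule onorm_le)
    fix h :: 'a
    have "norm (?D x h) \<le> (\<Sum>b\<in>Basis. norm ((h \<bullet> b) * partials [b] f x))" by (rule norm_sum)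
    also have "\<dots> \<le> (\<Sum>b\<in>(Basis::'a set). norm h * K)"
      by (rule sum_mono) (simp only: real_norm_def abs_mult, intro mult_mono K Basis_le_norm, auto)
    finally show "norm (?D x h) \<le> DIM('a) * K * norm h" by (simp add: algebra_simps)
  qed
  have "norm (f x - f y) \<le> (DIM('a) * K) * norm (x - y)" for x y
    by (rule differentiable_bound[of UNIV f ?D])
       (auto intro!: has_derivative_at_withinI bump_space_has_derivative[OF assms] on)
  then show thesis using that[of "DIM('a) * K"] K by simp
qed

lemma bump_space_measurable: "f \<in> bump_space c r \<Longrightarrow> f \<in> borel_measurable borel"
  using bump_space_continuous borel_measurable_continuous_onI by blast

lemma bump_space_lebesgue_measurable:
  assumes "f \<in> bump_space c r"
  shows "f \<in> borel_measurable lebesgue"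
  using bump_space_measurable[OF assms] by (intro measurable_completion) simp

lemma bump_space_bump2_integrable: 
  assumes "f \<in> bump_space c r" "g \<in> bump_space c' r'"
  shows "integrable lborel (\<lambda>x. f x * g x)"
proof (rule compact_support_integrable[of _ c r])
  show "continuous_on UNIV (\<lambda>x. f x * g x)" by (intro continuous_on_mult bump_space_continuous[OF assms(1)] bump_space_continuous[OF assms(2)])
qed (use assms in \<open>auto simp: bump_space_def\<close>)

lemma bump_space_L2:
  assumes "f \<in> bump_space c r" shows "f \<in> L2 UNIV"
  using bump_space_bump2_integrable[OF assms assms] bump_space_lebesgue_measurable[OF assms] bump_space_measurable[OF assms]
  by (auto simp: L2_def lebesgue_on_UNIV_eq power2_eq_square integrable_completion)

lemma bump_space_L2_norm:
  assumes "f \<in> bump_space c r" shows "(L2_norm UNIV f)\<^sup>2 = (LINT x|lborel. (f x)\<^sup>2)"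
  using bump_space_measurable[OF assms]
  by (simp add: L2_norm_power2 lebesgue_on_UNIV_eq integral_completion)

section \<open>Differentiation under the integral and averages of translates\<close>

text \<open>The remainder quotients tend to 0 pointwise and are dominated by the Lipschitz bound
  \<open>K p\<close> plus the size of \<open>D p\<close> on the basis; dominated convergence is
  applied along an arbitrary sequence tending to \<open>x0\<close>.\<close>

lemma has_derivative_integral_dominated:
  fixes f :: "'a::euclidean_space \<Rightarrow> 'p \<Rightarrow> real"
  assumes "0 < d"
    and f: "\<And>x. x \<in> ball x0 d \<Longrightarrow> integrable M (f x)"
    and D: "\<And>p. ((\<lambda>x. f x p) has_derivative D p) (at x0)"
    and lip: "\<And>x p. x \<in> ball x0 d \<Longrightarrow> \<bar>f x p - f x0 p\<bar> \<le> K p * norm (x - x0)"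
    and K: "integrable M K"
    and Di: "\<And>h. integrable M (\<lambda>p. D p h)"
  shows "((\<lambda>x. LINT p|M. f x p) has_derivative (\<lambda>h. LINT p|M. D p h)) (at x0)"
proof -
  have linD: "linear (D p)" for p using D has_derivative_linear by blast
  have "linear (\<lambda>h. LINT p|M. D p h)"
    by (rule linearI) (simp_all add: linear_add[OF linD] linear_scale[OF linD] Di)
  then have bl: "bounded_linear (\<lambda>h. LINT p|M. D p h)" by (simp add: linear_conv_bounded_linear)
  have Dbound: "\<bar>D p h\<bar> \<le> (\<Sum>b\<in>Basis. \<bar>D p b\<bar>) * norm h" for p h
  proof -
    have "D p h = D p (\<Sum>b\<in>Basis. (h \<bullet> b) *\<^sub>R b)" by (simp add: euclidean_representation)
    also have "\<dots> = (\<Sum>b\<in>Basis. (h \<bullet> b) * D p b)" by (simp add: linear_sum[OF linD] linear_scale[OF linD])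
    also have "\<bar>\<dots>\<bar> \<le> (\<Sum>b\<in>Basis. \<bar>(h \<bullet> b) * D p b\<bar>)" by (rule sum_abs)
    also have "\<dots> \<le> (\<Sum>b\<in>Basis. norm h * \<bar>D p b\<bar>)"
      unfolding abs_mult by (intro sum_mono mult_right_mono Basis_le_norm) auto
    finally show ?thesis by (simp add: sum_distrib_left mult.commute)
  qed
  let ?R = "\<lambda>y. norm ((LINT p|M. f y p) - (LINT p|M. f x0 p) - (LINT p|M. D p (y - x0))) / norm (y - x0)"
  have "(?R \<longlongrightarrow> 0) (at x0 within UNIV)"
    unfolding tendsto_at_iff_sequentially
  proof (intro allI impI)
    fix X :: "nat \<Rightarrow> 'a" assume X0: "\<forall>i. X i \<in> UNIV - {x0}" and X: "X \<longlonglongrightarrow> x0"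
    have "eventually (\<lambda>n. dist (X n) x0 < d) sequentially" using X \<open>0 < d\<close> by (simp add: tendsto_iff)
    then obtain N where N: "\<And>n. n \<ge> N \<Longrightarrow> dist (X n) x0 < d" by (auto simp: eventually_sequentially)
    \<comment> \<open>Dropping finitely many terms puts the whole sequence into the ball where
      \<open>f\<close> and \<open>lip\<close> are available; the shift is undone at the end.\<close>
    define Y where "Y n = X (n + N)" for n
    have Y: "Y n \<in> ball x0 d" "Y n \<noteq> x0" for n using N X0 by (auto simp: Y_def dist_commute)
    have Ylim: "Y \<longlonglongrightarrow> x0" unfolding Y_def by (rule LIMSEQ_ignore_initial_segment[OF X])
    have x0: "x0 \<in> ball x0 d" using \<open>0 < d\<close> by simp
    define q where "q n p = (f (Y n) p - f x0 p - D p (Y n - x0)) / norm (Y n - x0)" for n p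
    have qi: "integrable M (q n)" for n
      unfolding q_def using f[OF Y(1)] f[OF x0] Di by simp
    have "(\<lambda>n. LINT p|M. q n p) \<longlonglongrightarrow> (LINT p|M. 0)"
    proof (rule integral_dominated_convergence)
      show "integrable M (\<lambda>p. K p + (\<Sum>b\<in>Basis. \<bar>D p b\<bar>))" using K Di by simp
      show "AE p in M. (\<lambda>n. q n p) \<longlonglongrightarrow> 0"
      proof (rule AE_I2)
        fix p
        have "((\<lambda>y. norm (f y p - f x0 p - D p (y - x0)) / norm (y - x0)) \<longlongrightarrow> 0) (at x0 within UNIV)"
          using D[of p] by (simp add: has_derivative_iff_norm)
        then have "(\<lambda>n. norm (q n p)) \<longlonglongrightarrow> 0"
          unfolding tendsto_at_iff_sequentially using Y Ylim by (auto simp: q_def comp_def)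
        then show "(\<lambda>n. q n p) \<longlonglongrightarrow> 0" by (rule tendsto_norm_zero_cancel)
      qed
      show "AE p in M. norm (q n p) \<le> K p + (\<Sum>b\<in>Basis. \<bar>D p b\<bar>)" for n
      proof (rule AE_I2)
        fix p
        have "\<bar>f (Y n) p - f x0 p - D p (Y n - x0)\<bar> \<le> (K p + (\<Sum>b\<in>Basis. \<bar>D p b\<bar>)) * norm (Y n - x0)"
          using lip[OF Y(1), of n p] Dbound[of p "Y n - x0"] by (simp add: distrib_right)
        then show "norm (q n p) \<le> K p + (\<Sum>b\<in>Basis. \<bar>D p b\<bar>)"
          using Y(2)[of n] by (simp add: q_def divide_le_eq)
      qed
    qed (use qi in auto)
    then have "(\<lambda>n. norm (LINT p|M. q n p)) \<longlonglongrightarrow> 0" by (intro tendsto_norm_zero) simp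
    moreover have "norm (LINT p|M. q n p) = ?R (Y n)" for n
      unfolding q_def using f[OF Y(1), of n] f[OF x0] Di by simp
    ultimately have "(\<lambda>n. ?R (X (n + N))) \<longlonglongrightarrow> 0" by (simp add: Y_def)
    then show "(?R \<circ> X) \<longlonglongrightarrow> 0" unfolding comp_def by (rule LIMSEQ_offset)
  qed
  then show ?thesis using bl by (simp add: has_derivative_iff_norm)
qed

lemma lborel_integral_translation:
  fixes f :: "'a::euclidean_space \<Rightarrow> real"
  assumes "f \<in> borel_measurable borel"
  shows "(LINT x|lborel. f (x + a)) = (LINT x|lborel. f x)"
proof -
  have "(LINT x|lborel. f x) = (LINT x|distr lborel borel ((+) a). f x)" by (simp add: lborel_distr_plus)
  also have "\<dots> = (LINT x|lborel. f (a + x))" by (rule integral_distr) (use assms in auto)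
  finally show ?thesis by (simp add: add.commute)
qed

text \<open>Translation invariance of the integral, differentiated along the translation.\<close>

lemma integral_directional_derivative_zero:
  fixes f :: "'a::euclidean_space \<Rightarrow> real"
  assumes D: "\<And>x. (f has_derivative D x) (at x)" and cont: "continuous_on UNIV (\<lambda>x. D x b)"
    and supp: "\<And>x. f x \<noteq> 0 \<Longrightarrow> dist c x \<le> r"
  shows "(LINT x|lborel. D x b) = 0"
proof -
  have fc: "continuous_on UNIV f"
    using D by (intro differentiable_imp_continuous_on) (auto simp: differentiable_on_def differentiable_def intro: has_derivative_at_withinI)
  have Dsupp: "dist c x \<le> r" if "D x b \<noteq> 0" for x
  proof (rule ccontr)
    assume far: "\<not> dist c x \<le> r"
    have "(f has_derivative (\<lambda>_. 0)) (at x)"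
      by (rule has_derivative_transform_within_open[of "\<lambda>_. 0" "\<lambda>_. 0" x UNIV "- cball c r"]) (use supp far in auto)
    with D[of x] have "D x = (\<lambda>_. 0)" by (rule has_derivative_unique)
    with that show False by simp
  qed
  obtain K where K: "0 \<le> K" "\<And>x. \<bar>D x b\<bar> \<le> K * indicator (cball c r) x"
    using compact_support_bounded[OF cont Dsupp] by metis
  have K': "\<bar>D x b\<bar> \<le> K" for x using K(1) K(2)[of x] by (cases "x \<in> cball c r") auto
  have line: "((\<lambda>t. f (x + t *\<^sub>R b)) has_derivative (\<lambda>h. h * D (x + t *\<^sub>R b) b)) (at t)" for x and t :: real
  proof -
    have "((\<lambda>t. f (x + t *\<^sub>R b)) has_derivative (\<lambda>h. D (x + t *\<^sub>R b) (h *\<^sub>R b))) (at t)"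
      by (rule has_derivative_compose[OF _ D]) (auto intro!: derivative_eq_intros)
    then show ?thesis using linear_scale[OF has_derivative_linear[OF D]] by simp
  qed
  have mvt: "\<bar>f (x + t *\<^sub>R b) - f x\<bar> \<le> K * \<bar>t\<bar>" for x t
  proof -
    have "norm (f (x + t *\<^sub>R b) - f (x + 0 *\<^sub>R b)) \<le> K * norm (t - 0)"
    proof (rule differentiable_bound[where S=UNIV and f'="\<lambda>t h. h * D (x + t *\<^sub>R b) b"])
      fix s :: real
      show "((\<lambda>t. f (x + t *\<^sub>R b)) has_derivative (\<lambda>h. h * D (x + s *\<^sub>R b) b)) (at s within UNIV)"
        using line by simp
      show "onorm (\<lambda>h. h * D (x + s *\<^sub>R b) b) \<le> K"
        using mult_left_mono[OF K' abs_ge_zero] by (intro onorm_le) (simp add: abs_mult mult.commute[of K])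
    qed auto
    then show ?thesis by simp
  qed
  \<comment> \<open>The radius grows by \<open>norm b\<close>, so that one indicator dominates the
    difference quotients for all \<open>t\<close> with absolute value below 1.\<close>
  let ?k = "\<lambda>x. K * indicat_real (cball c (r + norm b)) x"
  have "((\<lambda>t. LINT x|lborel. f (x + t *\<^sub>R b)) has_derivative (\<lambda>h. LINT x|lborel. h * D (x + 0 *\<^sub>R b) b)) (at (0::real))"
  proof (rule has_derivative_integral_dominated[where d=1 and K="?k"])
    fix t :: real assume t: "t \<in> ball 0 1"
    have supp_t: "dist c x \<le> r + norm b" if "f (x + t *\<^sub>R b) \<noteq> 0" for x
    proof -
      have "dist c x \<le> dist c (x + t *\<^sub>R b) + dist (x + t *\<^sub>R b) x" by (rule dist_triangle)
      also have "\<dots> \<le> r + \<bar>t\<bar> * norm b" using supp[OF that] by (simp add: dist_norm)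
      also have "\<dots> \<le> r + norm b" using t by (simp add: mult_left_le_one_le)
      finally show ?thesis .
    qed
    show "integrable lborel (\<lambda>x. f (x + t *\<^sub>R b))"
      by (rule compact_support_integrable[OF _ supp_t])
         (intro continuous_on_compose2[OF fc] continuous_intros, auto)
    show "\<bar>f (x + t *\<^sub>R b) - f (x + 0 *\<^sub>R b)\<bar> \<le> ?k x * norm (t - 0)" for x
    proof (cases "x \<in> cball c (r + norm b)")
      case True then show ?thesis using mvt[of x t] by simp
    next
      case False
      then have "f (x + t *\<^sub>R b) = 0" using supp_t by auto
      moreover have "f x = 0" using False supp[of x] norm_ge_zero[of b] by (auto simp del: norm_ge_zero)
      ultimately show ?thesis using False by simp
    qed
  next
    show "((\<lambda>t. f (x + t *\<^sub>R b)) has_derivative (\<lambda>h. h * D (x + 0 *\<^sub>R b) b)) (at 0)" for x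
      by (rule line)
    show "integrable lborel ?k"
      using emeasure_lborel_cball_finite[of c "r + norm b"] by (intro integrable_mult_right integrable_real_indicator) auto
    show "integrable lborel (\<lambda>x. h * D (x + 0 *\<^sub>R b) b)" for h
      using compact_support_integrable[OF cont Dsupp] by simp
  qed (use line in auto)
  moreover have "(\<lambda>t. LINT x|lborel. f (x + t *\<^sub>R b)) = (\<lambda>t. LINT x|lborel. f x)"
    using lborel_integral_translation borel_measurable_continuous_onI[OF fc] by blast
  ultimately have "((\<lambda>t::real. LINT x|lborel. f x) has_derivative (\<lambda>h. LINT x|lborel. h * D x b)) (at 0)" by simp
  moreover have "((\<lambda>t::real. LINT x|lborel. f x) has_derivative (\<lambda>h. 0)) (at 0)" by simp
  ultimately have "(\<lambda>h. LINT x|lborel. h * D x b) = (\<lambda>h. 0)" by (rule has_derivative_unique)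
  from fun_cong[OF this, of 1] show ?thesis by simp
qed

lemma sum_Basis_delta:
  fixes h :: "'a::euclidean_space \<Rightarrow> real"
  assumes "b \<in> Basis" shows "(\<Sum>b'\<in>Basis. (b \<bullet> b') * h b') = h b"
proof -
  have "(\<Sum>b'\<in>Basis. (b \<bullet> b') * h b') = (\<Sum>b'\<in>Basis. if b' = b then h b' else 0)"
    by (rule sum.cong) (use assms in \<open>auto simp: inner_Basis\<close>)
  then show ?thesis using assms by simp
qed

lemma bump_space_integral_by_parts:
  assumes f: "f \<in> bump_space c r" and g: "g \<in> bump_space c' r'" and b: "b \<in> Basis"
  shows "(LINT x|lborel. f x * partials [b] g x) = - (LINT x|lborel. partials [b] f x * g x)"
proof -
  let ?D = "\<lambda>x h. f x * (\<Sum>b\<in>Basis. (h \<bullet> b) * partials [b] g x) + (\<Sum>b\<in>Basis. (h \<bullet> b) * partials [b] f x) * g x"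
  have D: "((\<lambda>x. f x * g x) has_derivative ?D x) (at x)" for x
    by (rule has_derivative_mult[OF bump_space_has_derivative[OF f] bump_space_has_derivative[OF g]])
  have Db: "?D x b = f x * partials [b] g x + partials [b] f x * g x" for x
    using sum_Basis_delta[OF b] by simp
  note fb = bump_space_partials1[OF f b] and gb = bump_space_partials1[OF g b]
  have "(LINT x|lborel. ?D x b) = 0"
    by (rule integral_directional_derivative_zero[OF D, of b c r])
       (unfold Db, intro continuous_intros bump_space_continuous[OF f] bump_space_continuous[OF g]
         bump_space_continuous[OF fb] bump_space_continuous[OF gb], use f in \<open>auto simp: bump_space_def\<close>)
  then have "(LINT x|lborel. f x * partials [b] g x + partials [b] f x * g x) = 0" by (simp only: Db)
  then show ?thesis
    using bump_space_bump2_integrable[OF f gb] bump_space_bump2_integrable[OF fb g] by simp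
qed

text \<open>The index space is arbitrary and the weight may change sign. This covers the kernel
  itself, the difference of the kernel and its translate, and the potential, whose index also
  contains the width.\<close>

locale averaging = sigma_finite_measure M for M :: "'p measure" +
  fixes \<kappa> :: "'p \<Rightarrow> real" and T :: "'p \<Rightarrow> 'a::euclidean_space" and R :: real
  assumes weight_integrable: "integrable M \<kappa>"
    and shift_measurable: "T \<in> borel_measurable M"
    and shift_bounded: "\<And>p. \<kappa> p \<noteq> 0 \<Longrightarrow> norm (T p) \<le> R"
begin

definition average :: "('a \<Rightarrow> real) \<Rightarrow> 'a \<Rightarrow> real" where
  "average f x = (LINT p|M. \<kappa> p * f (x - T p))"

lemma average_integrable:
  assumes "f \<in> bump_space c r" shows "integrable M (\<lambda>p. \<kappa> p * f (x - T p))"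
proof -
  note [measurable] = shift_measurable bump_space_measurable[OF assms] borel_measurable_integrable[OF weight_integrable]
  obtain K where K: "0 \<le> K" and K': "\<And>x. \<bar>f x\<bar> \<le> K" using bump_space_bounded[OF assms] by metis
  show ?thesis
  proof (rule Bochner_Integration.integrable_bound)
    show "integrable M (\<lambda>p. K * \<kappa> p)" using weight_integrable by simp
    show "AE p in M. norm (\<kappa> p * f (x - T p)) \<le> norm (K * \<kappa> p)"
      using mult_left_mono[OF K' abs_ge_zero] K by (intro AE_I2) (simp add: abs_mult mult.commute[of K])
  qed measurable
qed

lemma average_has_derivative:
  assumes f: "f \<in> bump_space c r"
  shows "(average f has_derivative (\<lambda>h. \<Sum>b\<in>Basis. (h \<bullet> b) * average (partials [b] f) x)) (at x)"
proof -
  obtain L where L: "0 \<le> L" "\<And>x y. \<bar>f x - f y\<bar> \<le> L * norm (x - y)" using bump_space_lipschitz[OF f] by metis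
  let ?D = "\<lambda>p h. \<kappa> p * (\<Sum>b\<in>Basis. (h \<bullet> b) * partials [b] f (x - T p))"
  have eq: "?D p h = (\<Sum>b\<in>Basis. (h \<bullet> b) * (\<kappa> p * partials [b] f (x - T p)))" for p h
    by (simp add: sum_distrib_left algebra_simps)
  have "((\<lambda>x. LINT p|M. \<kappa> p * f (x - T p)) has_derivative (\<lambda>h. LINT p|M. ?D p h)) (at x)"
  proof (rule has_derivative_integral_dominated[where d=1 and K="\<lambda>p. \<bar>\<kappa> p\<bar> * L"])
    show "((\<lambda>x. \<kappa> p * f (x - T p)) has_derivative ?D p) (at x)" for p
      by (intro has_derivative_mult_right has_derivative_compose[OF _ bump_space_has_derivative[OF f], of "\<lambda>x. x - T p" "\<lambda>h. h"])
         (auto intro!: derivative_eq_intros)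
    show "\<bar>\<kappa> p * f (y - T p) - \<kappa> p * f (x - T p)\<bar> \<le> \<bar>\<kappa> p\<bar> * L * norm (y - x)" for y p
      using mult_left_mono[OF L(2)[of "y - T p" "x - T p"], of "\<bar>\<kappa> p\<bar>"]
      by (simp add: abs_mult right_diff_distrib[symmetric] mult.assoc)
    show "integrable M (\<lambda>p. ?D p h)" for h
      unfolding eq by (intro Bochner_Integration.integrable_sum integrable_mult_right
          average_integrable[OF bump_space_partials1[OF f]])
  qed (use weight_integrable in \<open>auto intro: average_integrable[OF f]\<close>)
  moreover have "(LINT p|M. ?D p h) = (\<Sum>b\<in>Basis. (h \<bullet> b) * average (partials [b] f) x)" for h
    unfolding eq average_def by (subst Bochner_Integration.integral_sum)
      (auto intro!: integrable_mult_right average_integrable[OF bump_space_partials1[OF f]])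
  ultimately show ?thesis unfolding average_def by simp
qed


lemma average_partials:
  assumes f: "f \<in> bump_space c r" and "set bs \<subseteq> Basis"
  shows "partials bs (average f) = average (partials bs f)"
  using assms(2)
proof (induction bs)
  case (Cons b bs)
  then have b: "b \<in> Basis" and F: "partials bs f \<in> bump_space c r"
    using bump_space_partials[OF f] by auto
  have "partials (b # bs) (average f) x = partials [b] (average (partials bs f)) x" for x
    using Cons by (simp add: partials.simps(2))
  also have "\<dots> x = average (partials (b # bs) f) x" for x
    unfolding partials_eqI[OF average_has_derivative[OF F]] sum_Basis_delta[OF b]
    using partials_append[of "[b]" bs f] by simp
  finally show ?case by blast
qed simp

lemma average_bump_space:
  assumes f: "f \<in> bump_space c r"
  shows "average f \<in> bump_space c (r + R)"
proof -
  have "smooth_on UNIV (average f)"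
  proof (rule smooth_family[of "average ` bump_space c r"])
    fix g assume "g \<in> average ` bump_space c r"
    then obtain h where h: "h \<in> bump_space c r" "g = average h" by blast
    show "\<exists>g'. (\<forall>x. (g has_derivative g' x) (at x)) \<and> (\<forall>b\<in>Basis. (\<lambda>x. g' x b) \<in> average ` bump_space c r)"
      by (rule exI[of _ "\<lambda>x h'. \<Sum>b\<in>Basis. (h' \<bullet> b) * average (partials [b] h) x"])
         (use average_has_derivative[OF h(1)] bump_space_partials1[OF h(1)] h(2) in \<open>auto simp: sum_Basis_delta\<close>)
  qed (use f in auto)
  moreover have "dist c x \<le> r + R" if "average f x \<noteq> 0" for x
  proof (rule ccontr)
    assume far: "\<not> dist c x \<le> r + R"
    have "\<kappa> p * f (x - T p) = 0" for p
    proof (rule ccontr)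
      assume nz: "\<kappa> p * f (x - T p) \<noteq> 0"
      have "dist c x \<le> dist c (x - T p) + dist (x - T p) x" by (rule dist_triangle)
      also have "\<dots> \<le> r + R"
        using nz f shift_bounded[of p] by (intro add_mono) (auto simp: bump_space_def dist_norm)
      finally show False using far by simp
    qed
    then have "average f x = (LINT p|M. 0)" unfolding average_def by presburger
    then show False using that by simp
  qed
  ultimately show ?thesis by (simp add: bump_space_def)
qed

lemma average_diff:
  assumes "f \<in> bump_space c r" "g \<in> bump_space c' r'"
  shows "average (\<lambda>x. f x - g x) x = average f x - average g x"
  unfolding average_def right_diff_distrib
  by (rule Bochner_Integration.integral_diff[OF average_integrable[OF assms(1)] average_integrable[OF assms(2)]])

text \<open>Cauchy-Schwarz after splitting the integrand into
  \<open>sqrt \<bar>\<kappa> p\<bar>\<close> and the same root times the sign of the weight and the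
  value of \<open>f\<close>.\<close>

lemma average_square_le:
  assumes f: "f \<in> bump_space c r"
  shows "integrable M (\<lambda>p. \<bar>\<kappa> p\<bar> * (f (x - T p))\<^sup>2)"
    and "(average f x)\<^sup>2 \<le> (LINT p|M. \<bar>\<kappa> p\<bar>) * (LINT p|M. \<bar>\<kappa> p\<bar> * (f (x - T p))\<^sup>2)"
proof -
  note [measurable] = shift_measurable bump_space_measurable[OF f] borel_measurable_integrable[OF weight_integrable]
  obtain K where K: "0 \<le> K" and K': "\<And>x. \<bar>f x\<bar> \<le> K" using bump_space_bounded[OF f] by metis
  have K2: "(f x)\<^sup>2 \<le> K\<^sup>2" for x using K'[of x] power_mono[of "\<bar>f x\<bar>" K 2] by simp
  show int: "integrable M (\<lambda>p. \<bar>\<kappa> p\<bar> * (f (x - T p))\<^sup>2)"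
  proof (rule Bochner_Integration.integrable_bound)
    show "integrable M (\<lambda>p. K\<^sup>2 * \<kappa> p)" using weight_integrable by simp
    show "AE p in M. norm (\<bar>\<kappa> p\<bar> * (f (x - T p))\<^sup>2) \<le> norm (K\<^sup>2 * \<kappa> p)"
      using mult_left_mono[OF K2 abs_ge_zero] by (intro AE_I2) (simp add: abs_mult mult.commute[of "K\<^sup>2"])
  qed measurable
  let ?u = "\<lambda>p. sqrt \<bar>\<kappa> p\<bar>" and ?v = "\<lambda>p. sgn (\<kappa> p) * sqrt \<bar>\<kappa> p\<bar> * f (x - T p)"
  have u2: "(?u p)\<^sup>2 = \<bar>\<kappa> p\<bar>" for p by simp
  have v2: "(?v p)\<^sup>2 = \<bar>\<kappa> p\<bar> * (f (x - T p))\<^sup>2" for p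
    by (cases "\<kappa> p = 0") (auto simp: power_mult_distrib sgn_if)
  have uv: "?u p * ?v p = \<kappa> p * f (x - T p)" for p
  proof -
    have "?u p * ?v p = sgn (\<kappa> p) * (sqrt \<bar>\<kappa> p\<bar> * sqrt \<bar>\<kappa> p\<bar>) * f (x - T p)" by (simp add: algebra_simps)
    then show ?thesis by (simp add: sgn_mult_abs)
  qed
  have "(LINT p|M. ?u p * ?v p)\<^sup>2 \<le> (LINT p|M. (?u p)\<^sup>2) * (LINT p|M. (?v p)\<^sup>2)"
  proof (rule Cauchy_Schwarz_integral)
    show "integrable M (\<lambda>p. (?u p)\<^sup>2)" unfolding u2 using weight_integrable by (rule integrable_abs)
    show "integrable M (\<lambda>p. (?v p)\<^sup>2)" unfolding v2 by (rule int)
  qed measurable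
  then show "(average f x)\<^sup>2 \<le> (LINT p|M. \<bar>\<kappa> p\<bar>) * (LINT p|M. \<bar>\<kappa> p\<bar> * (f (x - T p))\<^sup>2)"
    unfolding u2 v2 uv average_def .
qed

text \<open>Young's inequality: the pointwise bound is integrated, the order of integration is
  exchanged, and each translate has the same norm. Nonnegative extended integrals make the exchange
  possible without a joint integrability argument.\<close>

lemma average_L2_norm:
  assumes f: "f \<in> bump_space c r"
  shows "L2_norm UNIV (average f) \<le> (LINT p|M. \<bar>\<kappa> p\<bar>) * L2_norm UNIV f"
proof -
  note [measurable] = shift_measurable bump_space_measurable[OF f] borel_measurable_integrable[OF weight_integrable]
  let ?k = "LINT p|M. \<bar>\<kappa> p\<bar>" and ?A = "LINT x|lborel. (f x)\<^sup>2"
  interpret pair: pair_sigma_finite lborel M ..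
  have avg: "average f \<in> bump_space c (r + R)" by (rule average_bump_space[OF f])
  have fi: "integrable lborel (\<lambda>x. (f x)\<^sup>2)" using bump_space_bump2_integrable[OF f f] by (simp add: power2_eq_square)
  have ai: "integrable lborel (\<lambda>x. (average f x)\<^sup>2)" using bump_space_bump2_integrable[OF avg avg] by (simp add: power2_eq_square)
  have k: "0 \<le> ?k" by simp
  have "ennreal (LINT x|lborel. (average f x)\<^sup>2) = (\<integral>\<^sup>+x. ennreal ((average f x)\<^sup>2) \<partial>lborel)"
    using ai by (intro nn_integral_eq_integral[symmetric]) auto
  also have "\<dots> \<le> (\<integral>\<^sup>+x. ennreal ?k * (\<integral>\<^sup>+p. ennreal (\<bar>\<kappa> p\<bar> * (f (x - T p))\<^sup>2) \<partial>M) \<partial>lborel)"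
  proof (rule nn_integral_mono)
    fix x
    have "ennreal ((average f x)\<^sup>2) \<le> ennreal (?k * (LINT p|M. \<bar>\<kappa> p\<bar> * (f (x - T p))\<^sup>2))"
      by (rule ennreal_leI[OF average_square_le(2)[OF f]])
    also have "\<dots> = ennreal ?k * (\<integral>\<^sup>+p. ennreal (\<bar>\<kappa> p\<bar> * (f (x - T p))\<^sup>2) \<partial>M)"
      by (subst nn_integral_eq_integral[OF average_square_le(1)[OF f]]) (auto simp: ennreal_mult)
    finally show "ennreal ((average f x)\<^sup>2) \<le> ennreal ?k * (\<integral>\<^sup>+p. ennreal (\<bar>\<kappa> p\<bar> * (f (x - T p))\<^sup>2) \<partial>M)" .
  qed
  also have "\<dots> = ennreal ?k * (\<integral>\<^sup>+x. (\<integral>\<^sup>+p. ennreal (\<bar>\<kappa> p\<bar> * (f (x - T p))\<^sup>2) \<partial>M) \<partial>lborel)"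
    by (rule nn_integral_cmult) measurable
  also have "(\<integral>\<^sup>+x. (\<integral>\<^sup>+p. ennreal (\<bar>\<kappa> p\<bar> * (f (x - T p))\<^sup>2) \<partial>M) \<partial>lborel) =
      (\<integral>\<^sup>+p. (\<integral>\<^sup>+x. ennreal (\<bar>\<kappa> p\<bar> * (f (x - T p))\<^sup>2) \<partial>lborel) \<partial>M)"
    by (rule pair.Fubini'[symmetric]) measurable
  also have "\<dots> = (\<integral>\<^sup>+p. ennreal (\<bar>\<kappa> p\<bar> * ?A) \<partial>M)"
  proof (rule nn_integral_cong)
    fix p
    have "integrable lborel (\<lambda>x. (f (x + (- T p)))\<^sup>2)"
    proof -
      have "integrable (distr lborel borel ((+) (- T p))) (\<lambda>x. (f x)\<^sup>2)" using fi by (simp add: lborel_distr_plus)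
      then have "integrable lborel (\<lambda>x. (f (- T p + x))\<^sup>2)" by (subst (asm) integrable_distr_eq) auto
      then show ?thesis by (simp add: add.commute)
    qed
    then have "(\<integral>\<^sup>+x. ennreal (\<bar>\<kappa> p\<bar> * (f (x - T p))\<^sup>2) \<partial>lborel) = ennreal (LINT x|lborel. \<bar>\<kappa> p\<bar> * (f (x + (- T p)))\<^sup>2)"
      by (subst nn_integral_eq_integral[symmetric]) auto
    also have "\<dots> = ennreal (\<bar>\<kappa> p\<bar> * ?A)"
      using lborel_integral_translation[of "\<lambda>x. (f x)\<^sup>2" "- T p"] by simp
    finally show "(\<integral>\<^sup>+x. ennreal (\<bar>\<kappa> p\<bar> * (f (x - T p))\<^sup>2) \<partial>lborel) = ennreal (\<bar>\<kappa> p\<bar> * ?A)" .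
  qed
  also have "\<dots> = ennreal (?k * ?A)"
    by (subst nn_integral_eq_integral) (use weight_integrable in auto)
  also have "ennreal ?k * ennreal (?k * ?A) = ennreal (?k * (?k * ?A))"
    using k by (simp add: ennreal_mult)
  finally have "(LINT x|lborel. (average f x)\<^sup>2) \<le> ?k * (?k * ?A)"
    by (subst (asm) ennreal_le_iff) auto
  then have "(L2_norm UNIV (average f))\<^sup>2 \<le> (?k * L2_norm UNIV f)\<^sup>2"
    unfolding power_mult_distrib bump_space_L2_norm[OF f] bump_space_L2_norm[OF avg]
    by (simp add: power2_eq_square algebra_simps)
  then show ?thesis by (rule power2_le_imp_le) (simp add: k)
qed

end

section \<open>The averaging kernel and its potential\<close>

lemma L2_norm_bump_Cauchy_Schwarz:
  assumes "f \<in> bump_space c r" "g \<in> bump_space c' r'"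
  shows "\<bar>LINT x|lborel. f x * g x\<bar> \<le> L2_norm UNIV f * L2_norm UNIV g"
  using L2_Cauchy_Schwarz[OF bump_space_L2[OF assms(1)] bump_space_L2[OF assms(2)]]
    bump_space_measurable[OF assms(1)] bump_space_measurable[OF assms(2)]
  by (simp add: lebesgue_on_UNIV_eq integral_completion)

text \<open>The unnormalized Epanechnikov kernel. The derivative of its square is a multiple of
  \<open>tent y\<close> times y, which supplies the potential; its Lipschitz continuity supplies the
  gain for differences. It is only ever averaged against smooth functions.\<close>

definition tent :: "'a::euclidean_space \<Rightarrow> real" where
  "tent y = max 0 (1 - (norm y)\<^sup>2)"

lemma tent_bounds: "0 \<le> tent y" "tent y \<le> 1"
  by (auto simp: tent_def)

lemma tent_support:
  assumes "tent y \<noteq> 0" shows "norm y \<le> 1"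
proof (rule ccontr)
  assume "\<not> norm y \<le> 1"
  then have "1 \<le> (norm y)\<^sup>2" by (simp add: one_le_power)
  then show False using assms by (simp add: tent_def)
qed

lemma continuous_on_tent: "continuous_on A tent"
  unfolding tent_def by (intro continuous_intros)

lemma tent_integrable: "integrable lborel tent"
  by (rule compact_support_integrable[of tent 0 1]) (use continuous_on_tent tent_support in auto)

text \<open>Written as 1 minus the square of \<open>min 1 (norm z)\<close>, the difference factors,
  and the sum of the two truncated norms is at most 2.\<close>

lemma tent_lipschitz: "\<bar>tent x - tent y\<bar> \<le> 2 * norm (x - y)"
proof -
  have eq: "tent z = 1 - (min 1 (norm z))\<^sup>2" for z :: 'a
  proof (cases "norm z \<le> 1")
    case True
    then show ?thesis using power_mono[of "norm z" 1 2] by (simp add: tent_def)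
  next
    case False
    then have "1 \<le> (norm z)\<^sup>2" by (intro one_le_power) simp
    then have "max 0 (1 - (norm z)\<^sup>2) = 0" by linarith
    then show ?thesis using False by (simp add: tent_def)
  qed
  have "tent x - tent y = (min 1 (norm y) - min 1 (norm x)) * (min 1 (norm y) + min 1 (norm x))"
    unfolding eq by (simp add: power2_eq_square algebra_simps)
  also have "\<bar>\<dots>\<bar> \<le> norm (x - y) * 2"
    unfolding abs_mult using norm_triangle_ineq3[of x y] by (intro mult_mono) auto
  finally show ?thesis by simp
qed

text \<open>The square of the positive part is differentiable also at 0, where its difference
  quotient is bounded by the increment. Composing with \<open>1 - y \<bullet> y\<close> rather than
  with a norm avoids the singularity at the origin.\<close>

lemma tent_square_has_derivative:
  "((\<lambda>y. (tent y)\<^sup>2) has_derivative (\<lambda>h. - 4 * tent y * (y \<bullet> h))) (at y)"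
proof -
  have q: "((\<lambda>u. (max 0 u)\<^sup>2) has_real_derivative 2 * max 0 u) (at u)" for u :: real
  proof -
    consider "u > 0" | "u < 0" | "u = 0" by linarith
    then show ?thesis
    proof cases
      case 1
      have "((\<lambda>u. u\<^sup>2) has_real_derivative 2 * u) (at u)" by (auto intro!: derivative_eq_intros)
      then have "((\<lambda>u. (max 0 u)\<^sup>2) has_real_derivative 2 * u) (at u)"
        by (rule has_field_derivative_transform_within_open[of _ _ _ "{0<..}"]) (use 1 in auto)
      then show ?thesis using 1 by simp
    next
      case 2
      have "((\<lambda>u. 0) has_real_derivative 0) (at u)" by simp
      then have "((\<lambda>u. (max 0 u)\<^sup>2) has_real_derivative 0) (at u)"
        by (rule has_field_derivative_transform_within_open[of _ _ _ "{..<0}"]) (use 2 in auto)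
      then show ?thesis using 2 by simp
    next
      case 3
      have "((\<lambda>h::real. (max 0 h)\<^sup>2 / h) \<longlongrightarrow> 0) (at 0)"
      proof (rule Lim_null_comparison)
        have "\<bar>(max 0 h)\<^sup>2 / h\<bar> \<le> \<bar>h\<bar>" for h :: real
          by (cases "h = 0") (auto simp: max_def power2_eq_square)
        then show "\<forall>\<^sub>F h in at 0. norm ((max 0 h)\<^sup>2 / h) \<le> \<bar>h :: real\<bar>" by simp
        show "((\<lambda>h::real. \<bar>h\<bar>) \<longlongrightarrow> 0) (at 0)" by (rule tendsto_eq_intros | simp)+
      qed
      then show ?thesis using 3 by (simp add: has_field_derivative_iff)
    qed
  qed
  have "((\<lambda>y. 1 - y \<bullet> y) has_derivative (\<lambda>h. - 2 * (y \<bullet> h))) (at y)"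
    by (auto intro!: derivative_eq_intros simp: inner_commute)
  then have "((\<lambda>y. (max 0 (1 - y \<bullet> y))\<^sup>2) has_derivative (\<lambda>h. 2 * max 0 (1 - y \<bullet> y) * (- 2 * (y \<bullet> h)))) (at y)"
    by (rule has_derivative_compose[OF _ q[unfolded has_field_derivative_def]])
  then show ?thesis by (simp add: tent_def power2_norm_eq_inner algebra_simps)
qed

definition tent_mass :: "'a::euclidean_space itself \<Rightarrow> real" where
  "tent_mass _ = (LINT y|lborel. tent (y::'a))"

lemma tent_mass_pos: "0 < tent_mass TYPE('a::euclidean_space)"
proof -
  have "3/4 * measure lborel (cball (0::'a) (1/2)) = (LINT y|lborel. 3/4 * indicat_real (cball (0::'a) (1/2)) y)"
    by simp
  also have "\<dots> \<le> (LINT y|lborel. tent (y::'a))"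
  proof (rule integral_mono)
    show "integrable lborel (\<lambda>y. 3/4 * indicat_real (cball (0::'a) (1/2)) y)"
      using emeasure_lborel_cball_finite[of "0::'a" "1/2"] by (intro integrable_mult_right integrable_real_indicator) auto
    \<comment> \<open>On the ball of radius 1/2 the tent is at least 1 - 1/4.\<close>
    show "3/4 * indicat_real (cball (0::'a) (1/2)) y \<le> tent y" for y
      using power_mono[of "norm y" "1/2" 2] by (auto simp: tent_def indicator_def power2_eq_square)
  qed (rule tent_integrable)
  finally have "3/4 * measure lborel (cball (0::'a) (1/2)) \<le> tent_mass TYPE('a)" by (simp add: tent_mass_def)
  moreover have "0 < measure lborel (cball (0::'a) (1/2))" by (simp add: content_cball_pos)
  ultimately show ?thesis by linarith
qed

definition kernel_avg :: "'a::euclidean_space \<Rightarrow> real" where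
  "kernel_avg y = tent y / tent_mass TYPE('a)"

text \<open>Its gradient is \<open>- kernel_avg y *\<^sub>R y\<close>; this turns the derivative of the averages of \<open>f\<close> with
  respect to their width into the Laplacian of a weighted average.\<close>

definition kernel_pot :: "'a::euclidean_space \<Rightarrow> real" where
  "kernel_pot y = (tent y)\<^sup>2 / (4 * tent_mass TYPE('a))"

lemma kernel_avg_nonneg: "0 \<le> kernel_avg y"
  using tent_mass_pos[where 'a='a] tent_bounds[of y] by (simp add: kernel_avg_def)

lemma kernel_avg_integrable: "integrable lborel kernel_avg"
  unfolding kernel_avg_def by (intro integrable_divide_zero tent_integrable)

lemma kernel_avg_integral: "(LINT y|lborel. kernel_avg (y::'a::euclidean_space)) = 1"
  using tent_mass_pos[where 'a='a] unfolding kernel_avg_def by (simp add: tent_mass_def)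

lemma kernel_support: "kernel_avg y \<noteq> 0 \<Longrightarrow> norm y \<le> 1" "kernel_pot y \<noteq> 0 \<Longrightarrow> norm y \<le> 1"
  using tent_support by (auto simp: kernel_avg_def kernel_pot_def)

lemma continuous_on_kernel: "continuous_on A kernel_avg" "continuous_on A kernel_pot"
proof -
  show "continuous_on A kernel_avg"
    unfolding kernel_avg_def using tent_mass_pos[where 'a='a] by (intro continuous_intros continuous_on_tent) auto
  show "continuous_on A kernel_pot"
    unfolding kernel_pot_def using tent_mass_pos[where 'a='a] by (intro continuous_intros continuous_on_tent) auto
qed

lemma kernel_pot_has_derivative:
  "(kernel_pot has_derivative (\<lambda>h. - kernel_avg y * (y \<bullet> h))) (at y)"
proof -
  have "((\<lambda>y. (tent y)\<^sup>2 / (4 * tent_mass TYPE('a))) has_derivative (\<lambda>h. (- 4 * tent y * (y \<bullet> h)) / (4 * tent_mass TYPE('a)))) (at y)"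
    using bounded_linear.has_derivative[OF bounded_linear_divide tent_square_has_derivative] .
  then show ?thesis
    using tent_mass_pos[where 'a='a] by (simp add: kernel_pot_def[abs_def] kernel_avg_def)
qed

section \<open>The smoothing operator and its potential\<close>

definition smoothing :: "real \<Rightarrow> ('a::euclidean_space \<Rightarrow> real) \<Rightarrow> 'a \<Rightarrow> real" where
  "smoothing s = averaging.average lborel kernel_avg (\<lambda>y. s *\<^sub>R y)"

text \<open>The derivative of the average in its width t is t times the Laplacian of the average of
  \<open>f\<close> against \<open>kernel_pot\<close>. Integrating over t from 0 to s yields
  \<open>smoothing s f - f\<close>, which explains the factor \<open>fst p\<close>, the index (t, y)
  and the minus sign.\<close>

definition potential_weight :: "real \<Rightarrow> real \<times> 'a::euclidean_space \<Rightarrow> real" where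
  "potential_weight s p = - (indicator {0..s} (fst p) * fst p * kernel_pot (snd p))"

definition potential :: "real \<Rightarrow> ('a::euclidean_space \<Rightarrow> real) \<Rightarrow> 'a \<Rightarrow> real" where
  "potential s = averaging.average lborel (potential_weight s) (\<lambda>p. fst p *\<^sub>R snd p)"

lemma averaging_smoothing:
  assumes "0 \<le> s"
  shows "averaging lborel kernel_avg (\<lambda>y::'a::euclidean_space. s *\<^sub>R y) s"
proof unfold_locales
  show "norm (s *\<^sub>R y) \<le> s" if "kernel_avg y \<noteq> 0" for y :: 'a
    using kernel_support(1)[OF that] assms by (simp add: mult_left_le)
qed (auto simp: kernel_avg_integrable)

lemma potential_weight_integrable: "integrable lborel (potential_weight s :: real \<times> 'a::euclidean_space \<Rightarrow> real)"
proof -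
  obtain K where K: "0 \<le> K" "\<And>y::'a. \<bar>kernel_pot y\<bar> \<le> K * indicator (cball 0 1) y"
    using compact_support_bounded[OF continuous_on_kernel(2), of 0 1] kernel_support(2) by auto
  let ?C = "{0..s} \<times> cball (0::'a) 1"
  have C: "compact ?C" by (intro compact_Times) auto
  show ?thesis
  proof (rule Bochner_Integration.integrable_bound)
    show "integrable lborel (\<lambda>p. s * K * indicat_real ?C p)"
      using C emeasure_compact_finite[OF C] borel_compact[OF C] by (intro integrable_mult_right integrable_real_indicator) auto
    have "(\<lambda>p::real \<times> 'a. indicat_real ({0..s} \<times> (UNIV :: 'a set)) p * (fst p * kernel_pot (snd p))) \<in> borel_measurable borel"
      by (intro borel_measurable_times borel_measurable_indicator borel_measurable_continuous_onI continuous_intros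
            continuous_on_compose2[OF continuous_on_kernel(2)] borel_closed closed_Times) auto
    moreover have "indicat_real ({0..s} \<times> (UNIV :: 'a set)) p = indicator {0..s} (fst p)" for p :: "real \<times> 'a"
      by (cases p) (auto simp: indicator_def)
    ultimately show "(potential_weight s :: real \<times> 'a \<Rightarrow> real) \<in> borel_measurable lborel"
      unfolding potential_weight_def[abs_def] by (simp add: mult.assoc)
    have "\<bar>potential_weight s p\<bar> \<le> s * K * indicat_real ?C p" for p
    proof (cases "fst p \<in> {0..s}")
      case True
      then have "\<bar>fst p * kernel_pot (snd p)\<bar> \<le> s * (K * indicator (cball 0 1) (snd p))"
        unfolding abs_mult by (intro mult_mono K) auto
      then show ?thesis using True by (cases p) (simp add: potential_weight_def indicator_times)
    qed (cases p, auto simp: potential_weight_def indicator_times)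
    then show "AE p in lborel. norm (potential_weight s p) \<le> norm (s * K * indicat_real ?C p)"
      by (intro AE_I2) (smt (verit) real_norm_def)
  qed
qed

lemma averaging_potential:
  shows "averaging lborel (potential_weight s) (\<lambda>p. fst p *\<^sub>R (snd p :: 'a::euclidean_space)) s"
proof unfold_locales
  show "norm (fst p *\<^sub>R snd p) \<le> s" if "potential_weight s p \<noteq> 0" for p :: "real \<times> 'a"
  proof -
    have "kernel_pot (snd p) \<noteq> 0" "fst p \<in> {0..s}"
      using that by (auto simp: potential_weight_def indicator_def split: if_splits)
    then show ?thesis using kernel_support(2)[of "snd p"] mult_mono[of "\<bar>fst p\<bar>" s "norm (snd p)" 1] by simp
  qed
  show "(\<lambda>p. fst p *\<^sub>R (snd p :: 'a)) \<in> borel_measurable lborel"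
    by (simp, intro borel_measurable_continuous_onI continuous_intros)
qed (rule potential_weight_integrable)

lemma smoothing_eq: "smoothing s f x = (LINT y|lborel. kernel_avg y * f (x - s *\<^sub>R y))" if "0 \<le> s"
  unfolding smoothing_def using averaging.average_def[OF averaging_smoothing[OF that]] by metis

lemma smoothing_bump_space: "f \<in> bump_space c r \<Longrightarrow> 0 \<le> s \<Longrightarrow> smoothing s f \<in> bump_space c (r + s)"
  unfolding smoothing_def by (rule averaging.average_bump_space[OF averaging_smoothing])

lemma potential_bump_space: "f \<in> bump_space c r \<Longrightarrow> potential s f \<in> bump_space c (r + s)"
  unfolding potential_def by (rule averaging.average_bump_space[OF averaging_potential])

lemma smoothing_partials:
  "f \<in> bump_space c r \<Longrightarrow> 0 \<le> s \<Longrightarrow> set bs \<subseteq> Basis \<Longrightarrow> partials bs (smoothing s f) = smoothing s (partials bs f)"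
  unfolding smoothing_def by (rule averaging.average_partials[OF averaging_smoothing])

lemma potential_partials:
  "f \<in> bump_space c r \<Longrightarrow> set bs \<subseteq> Basis \<Longrightarrow> partials bs (potential s f) = potential s (partials bs f)"
  unfolding potential_def by (rule averaging.average_partials[OF averaging_potential])

text \<open>The kernel is nonnegative with mass 1, so the constant is exactly 1; this permits k
  smoothings in a row without loss.\<close>

lemma smoothing_L2_norm:
  assumes "f \<in> bump_space c r" "0 \<le> s" shows "L2_norm UNIV (smoothing s f) \<le> L2_norm UNIV f"
  using averaging.average_L2_norm[OF averaging_smoothing[OF assms(2)] assms(1)]
  by (simp add: smoothing_def kernel_avg_nonneg kernel_avg_integral)

text \<open>Bounding the weight of width s by the one of width 1 makes the constant independent of
  s.\<close>

lemma potential_L2_norm: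
  assumes f: "f \<in> bump_space c r" and "s \<le> 1"
  shows "L2_norm UNIV (potential s f) \<le> (LINT p|lborel. \<bar>potential_weight 1 (p :: real \<times> 'a::euclidean_space)\<bar>) * L2_norm UNIV (f :: 'a \<Rightarrow> real)"
proof -
  have "(LINT p|lborel. \<bar>potential_weight s (p :: real \<times> 'a)\<bar>) \<le> (LINT p|lborel. \<bar>potential_weight 1 (p :: real \<times> 'a)\<bar>)"
    by (intro integral_mono integrable_abs potential_weight_integrable)
       (use \<open>s \<le> 1\<close> in \<open>auto simp: potential_weight_def indicator_def\<close>)
  then show ?thesis
    using averaging.average_L2_norm[OF averaging_potential f, of s] mult_right_mono[OF _ L2_norm_nonneg[of UNIV f]]
    unfolding potential_def by (meson order_trans)
qed

text \<open>Moving the translation into the kernel, with a = h / s, turns the difference into an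
  average of \<open>f\<close> against a signed weight. That weight is at most 2 |a| / mass in
  absolute value and lives in the ball of radius 2, as |a| is at most 1. Thus the factor |h| / s is
  gained without differentiating \<open>f\<close>.\<close>

lemma smoothing_translation:
  fixes f :: "'a::euclidean_space \<Rightarrow> real"
  assumes f: "f \<in> bump_space c r" and "0 < s" "norm h \<le> s"
  shows "L2_norm UNIV (\<lambda>x. smoothing s f (x - h) - smoothing s f x)
    \<le> (2 * measure lborel (cball (0::'a) 2) / tent_mass TYPE('a)) * (norm h / s) * L2_norm UNIV f"
proof -
  define a where "a = h /\<^sub>R s"
  define \<kappa> where "\<kappa> y = kernel_avg (y - a) - kernel_avg y" for y :: 'a
  have a: "norm a \<le> 1" "s *\<^sub>R a = h" "norm a = norm h / s"
    using \<open>0 < s\<close> \<open>norm h \<le> s\<close> by (auto simp: a_def divide_simps)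
  have supp: "norm y \<le> 2" if "\<kappa> y \<noteq> 0" for y
  proof -
    have "kernel_avg (y - a) \<noteq> 0 \<or> kernel_avg y \<noteq> 0" using that by (auto simp: \<kappa>_def)
    then show ?thesis
      using kernel_support(1)[of "y - a"] kernel_support(1)[of y] norm_triangle_sub[of y a] a(1) by linarith
  qed
  have cont: "continuous_on UNIV \<kappa>"
    unfolding \<kappa>_def by (intro continuous_intros continuous_on_compose2[OF continuous_on_kernel(1)[of UNIV]]) auto
  have int: "integrable lborel \<kappa>"
    by (rule compact_support_integrable[OF cont, of 0 2]) (use supp in auto)
  have avg: "averaging lborel \<kappa> (\<lambda>y. s *\<^sub>R y) (s * 2)"
    by unfold_locales (use int supp \<open>0 < s\<close> in auto)
  let ?m = "tent_mass TYPE('a)" and ?v = "measure lborel (cball (0::'a) 2)"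
  have "(LINT y|lborel. \<bar>\<kappa> y\<bar>) \<le> (LINT y|lborel. (2 * norm a / ?m) * indicator (cball (0::'a) 2) y)"
  proof (rule integral_mono)
    show "integrable lborel (\<lambda>y. (2 * norm a / ?m) * indicat_real (cball (0::'a) 2) y)"
      using emeasure_lborel_cball_finite[of "0::'a" 2] by (intro integrable_mult_right integrable_real_indicator) auto
    fix y
    have "\<bar>\<kappa> y\<bar> = \<bar>tent (y - a) - tent y\<bar> / ?m"
      using tent_mass_pos[where 'a='a] by (simp add: \<kappa>_def kernel_avg_def diff_divide_distrib[symmetric])
    also have "\<dots> \<le> 2 * norm a / ?m"
      using tent_lipschitz[of "y - a" y] tent_mass_pos[where 'a='a] by (intro divide_right_mono) auto
    finally show "\<bar>\<kappa> y\<bar> \<le> (2 * norm a / ?m) * indicator (cball 0 2) y"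
      using supp[of y] by (cases "norm y \<le> 2") auto
  qed (use int in auto)
  then have L1: "(LINT y|lborel. \<bar>\<kappa> y\<bar>) \<le> (2 * ?v / ?m) * (norm h / s)"
    by (simp add: a(3) algebra_simps)
  have eq: "smoothing s f (x - h) - smoothing s f x = averaging.average lborel \<kappa> (\<lambda>y. s *\<^sub>R y) f x" for x
  proof -
    have fc: "continuous_on UNIV (\<lambda>y. f (x - s *\<^sub>R y))"
      by (intro continuous_on_compose2[OF bump_space_continuous[OF f, of UNIV]] continuous_intros) auto
    have i1: "integrable lborel (\<lambda>y. kernel_avg (y - a) * f (x - s *\<^sub>R y))"
      by (rule compact_support_integrable[of _ a 1])
         (use kernel_support(1) in \<open>auto simp: dist_norm norm_minus_commute intro!: continuous_intros fc continuous_on_compose2[OF continuous_on_kernel(1)[of UNIV]]\<close>)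
    have i2: "integrable lborel (\<lambda>y. kernel_avg y * f (x - s *\<^sub>R y))"
      by (rule compact_support_integrable[of _ 0 1])
         (use kernel_support(1) in \<open>auto intro!: continuous_intros fc continuous_on_kernel(1)\<close>)
    have "smoothing s f (x - h) = (LINT y|lborel. kernel_avg y * f (x - h - s *\<^sub>R y))"
      using \<open>0 < s\<close> by (simp add: smoothing_eq)
    also have "\<dots> = (LINT y|lborel. kernel_avg ((y + a) - a) * f (x - s *\<^sub>R (y + a)))"
      using a(2) by (simp add: algebra_simps)
    also have "\<dots> = (LINT y|lborel. kernel_avg (y - a) * f (x - s *\<^sub>R y))"
      by (rule lborel_integral_translation[of "\<lambda>y. kernel_avg (y - a) * f (x - s *\<^sub>R y)"])
         (use borel_measurable_integrable[OF i1] in simp)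
    finally have "smoothing s f (x - h) - smoothing s f x = (LINT y|lborel. kernel_avg (y - a) * f (x - s *\<^sub>R y)) - (LINT y|lborel. kernel_avg y * f (x - s *\<^sub>R y))"
      using \<open>0 < s\<close> by (simp add: smoothing_eq)
    also have "\<dots> = (LINT y|lborel. \<kappa> y * f (x - s *\<^sub>R y))"
      using i1 i2 by (simp add: \<kappa>_def left_diff_distrib)
    finally show ?thesis using averaging.average_def[OF avg, of f x] by simp
  qed
  show ?thesis
    unfolding eq using averaging.average_L2_norm[OF avg f] mult_right_mono[OF L1 L2_norm_nonneg[of UNIV f]]
    by (meson order_trans)
qed

text \<open>Differentiating under the integral produces the kernel times y paired with the gradient
  of \<open>f\<close>. That product is minus the gradient of \<open>kernel_pot\<close>, so an
  integration by parts in y gives the Laplacian, and the inner derivative gives the factor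
  t.\<close>

lemma smoothing_scale_derivative:
  fixes f :: "'a::euclidean_space \<Rightarrow> real"
  assumes f: "f \<in> bump_space c r"
  shows "((\<lambda>t. LINT y|lborel. kernel_avg y * f (x - t *\<^sub>R y)) has_real_derivative
      t * (LINT y|lborel. kernel_pot y * laplacian f (x - t *\<^sub>R y))) (at t)"
proof -
  obtain L where L: "0 \<le> L" "\<And>x y. \<bar>f x - f y\<bar> \<le> L * norm (x - y)" using bump_space_lipschitz[OF f] by metis
  let ?g = "\<lambda>b y. partials [b] f (x - t *\<^sub>R y)" and ?gg = "\<lambda>b y. partials [b, b] f (x - t *\<^sub>R y)"
  have pc: "continuous_on UNIV (\<lambda>y. partials bs f (x - t *\<^sub>R y))" if "set bs \<subseteq> Basis" for bs t
    by (intro continuous_on_compose2[OF bump_space_continuous[OF bump_space_partials[OF f that], of UNIV]] continuous_intros) auto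
  have ki: "integrable lborel (\<lambda>y. kernel_avg y * h y)" if "continuous_on UNIV h" for h
    by (rule compact_support_integrable[of _ 0 1])
       (use kernel_support(1) that in \<open>auto intro!: continuous_intros continuous_on_kernel(1)\<close>)
  have kp: "integrable lborel (\<lambda>y. kernel_pot y * h y)" if "continuous_on UNIV h" for h
    by (rule compact_support_integrable[of _ 0 1])
       (use kernel_support(2) that in \<open>auto intro!: continuous_intros continuous_on_kernel(2)\<close>)
  let ?D = "\<lambda>y h. h * (\<Sum>b\<in>Basis. kernel_avg y * (- (y \<bullet> b) * ?g b y))"
  have kb: "integrable lborel (\<lambda>y. kernel_avg y * (- (y \<bullet> b) * ?g b y))" if "b \<in> Basis" for b
    by (intro ki continuous_intros pc) (use that in auto)
  have "((\<lambda>t. LINT y|lborel. kernel_avg y * f (x - t *\<^sub>R y)) has_derivative (\<lambda>h. LINT y|lborel. ?D y h)) (at t)"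
  proof (rule has_derivative_integral_dominated[where d=1 and K="\<lambda>y. kernel_avg y * L"])
    show "integrable lborel (\<lambda>y. kernel_avg y * f (x - u *\<^sub>R y))" for u
      using ki[OF pc[of "[]"]] by simp
    show "((\<lambda>t. kernel_avg y * f (x - t *\<^sub>R y)) has_derivative ?D y) (at t)" for y
    proof -
      have "((\<lambda>t. f (x - t *\<^sub>R y)) has_derivative (\<lambda>h. \<Sum>b\<in>Basis. ((- h *\<^sub>R y) \<bullet> b) * ?g b y)) (at t)"
        by (rule has_derivative_compose[OF _ bump_space_has_derivative[OF f], of "\<lambda>t. x - t *\<^sub>R y" "\<lambda>h. - h *\<^sub>R y"])
           (auto intro!: derivative_eq_intros)
      from has_derivative_mult_right[OF this, of "kernel_avg y"] show ?thesis
        by (rule has_derivative_eq_rhs) (auto simp: sum_distrib_left algebra_simps intro!: sum.cong)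
    qed
    show "\<bar>kernel_avg y * f (x - u *\<^sub>R y) - kernel_avg y * f (x - t *\<^sub>R y)\<bar> \<le> kernel_avg y * L * norm (u - t)" for u y
    proof (cases "kernel_avg y = 0")
      case False
      have "\<bar>f (x - u *\<^sub>R y) - f (x - t *\<^sub>R y)\<bar> \<le> L * norm ((x - u *\<^sub>R y) - (x - t *\<^sub>R y))" by (rule L)
      also have "(x - u *\<^sub>R y) - (x - t *\<^sub>R y) = (t - u) *\<^sub>R y" by (simp add: algebra_simps)
      also have "L * norm ((t - u) *\<^sub>R y) \<le> L * norm (u - t)"
        using kernel_support(1)[OF False] L(1) by (intro mult_left_mono) (auto simp: mult_left_le abs_minus_commute)
      finally show ?thesis
        using mult_left_mono[OF _ kernel_avg_nonneg[of y]] kernel_avg_nonneg[of y]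
        by (simp add: right_diff_distrib[symmetric] abs_mult mult.assoc)
    qed simp
    show "integrable lborel (\<lambda>y::'a. kernel_avg y * L)" by (intro integrable_mult_left kernel_avg_integrable)
    show "integrable lborel (\<lambda>y. ?D y h)" for h
      using kb by (intro integrable_mult_right Bochner_Integration.integrable_sum) auto
  qed simp
  moreover have "(LINT y|lborel. ?D y h) = t * (LINT y|lborel. kernel_pot y * laplacian f (x - t *\<^sub>R y)) * h" for h
  proof -
    have part: "(LINT y|lborel. kernel_avg y * (- (y \<bullet> b) * ?g b y)) = t * (LINT y|lborel. kernel_pot y * ?gg b y)"
      if b: "b \<in> Basis" for b
    proof -
      have fb: "partials [b] f \<in> bump_space c r" by (rule bump_space_partials1[OF f b])
      \<comment> \<open>Since \<open>kernel_pot\<close> is not in \<open>bump_space\<close>, the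
        integration by parts is done by hand: the derivative of this product in direction
        \<open>b\<close> has integral zero.\<close>
      let ?E = "\<lambda>y h. kernel_pot y * (\<Sum>i\<in>Basis. ((- t *\<^sub>R h) \<bullet> i) * partials [i] (partials [b] f) (x - t *\<^sub>R y))
          + (- kernel_avg y * (y \<bullet> h)) * ?g b y"
      have E: "((\<lambda>y. kernel_pot y * ?g b y) has_derivative ?E y) (at y)" for y
      proof (rule has_derivative_mult[OF kernel_pot_has_derivative])
        show "(?g b has_derivative (\<lambda>h. \<Sum>i\<in>Basis. ((- t *\<^sub>R h) \<bullet> i) * partials [i] (partials [b] f) (x - t *\<^sub>R y))) (at y)"
          by (rule has_derivative_compose[OF _ bump_space_has_derivative[OF fb], of "\<lambda>y. x - t *\<^sub>R y" "\<lambda>h. - t *\<^sub>R h"])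
             (auto intro!: derivative_eq_intros)
      qed
      have Eb: "?E y b = - t * (kernel_pot y * ?gg b y) + kernel_avg y * (- (y \<bullet> b) * ?g b y)" for y
      proof -
        have S: "(\<Sum>i\<in>Basis. ((- t *\<^sub>R b) \<bullet> i) * h i) = - t * h b" for h :: "'a \<Rightarrow> real"
          using sum_Basis_delta[OF b, of "\<lambda>i. - t * h i"] by (simp add: mult.assoc mult.left_commute[of t])
        show ?thesis unfolding S using partials_append[of "[b]" "[b]" f] by (simp add: algebra_simps)
      qed
      have "(LINT y|lborel. ?E y b) = 0"
      proof (rule integral_directional_derivative_zero[OF E, of b 0 1])
        show "continuous_on UNIV (\<lambda>y. ?E y b)"
          unfolding Eb by (intro continuous_intros continuous_on_kernel pc) (use b in auto)
      qed (use kernel_support(2) in auto)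
      then have "- t * (LINT y|lborel. kernel_pot y * ?gg b y) + (LINT y|lborel. kernel_avg y * (- (y \<bullet> b) * ?g b y)) = 0"
        unfolding Eb using kp[OF pc[of "[b, b]" t]] kb[OF b] b
        by (subst (asm) Bochner_Integration.integral_add) auto
      then show ?thesis by simp
    qed
    have "(LINT y|lborel. ?D y h) = h * (\<Sum>b\<in>Basis. LINT y|lborel. kernel_avg y * (- (y \<bullet> b) * ?g b y))"
      using kb by (simp add: Bochner_Integration.integral_sum)
    also have "\<dots> = h * (\<Sum>b\<in>Basis. t * (LINT y|lborel. kernel_pot y * ?gg b y))"
      using part by simp
    also have "(\<Sum>b\<in>Basis. t * (LINT y|lborel. kernel_pot y * ?gg b y)) = t * (LINT y|lborel. kernel_pot y * laplacian f (x - t *\<^sub>R y))"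
      unfolding laplacian_def sum_distrib_left[symmetric]
      using kp[OF pc[of "[_, _]" t]] by (subst Bochner_Integration.integral_sum[symmetric]) (auto simp: sum_distrib_left)
    finally show ?thesis by (simp add: algebra_simps)
  qed
  ultimately show ?thesis by (simp only: has_field_derivative_def)
qed

section \<open>Linear operations and translations of smooth compactly supported functions\<close>

lemma bump_space_add:
  assumes "f \<in> bump_space c r" "g \<in> bump_space c r"
  shows "(\<lambda>x. f x + g x) \<in> bump_space c r"
proof -
  let ?add = "\<lambda>(f, g) x. f x + g x :: real"
  have "smooth_on UNIV (?add (f, g))"
  proof (rule smooth_family[of "?add ` (bump_space c r \<times> bump_space c r)"])
    fix h assume "h \<in> ?add ` (bump_space c r \<times> bump_space c r)"
    then obtain f g where fg: "f \<in> bump_space c r" "g \<in> bump_space c r" and h: "h = (\<lambda>x. f x + g x)" by auto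
    let ?h' = "\<lambda>x k. (\<Sum>b\<in>Basis. (k \<bullet> b) * partials [b] f x) + (\<Sum>b\<in>Basis. (k \<bullet> b) * partials [b] g x)"
    have "(h has_derivative ?h' x) (at x)" for x
      unfolding h by (intro has_derivative_add bump_space_has_derivative[OF fg(1)] bump_space_has_derivative[OF fg(2)])
    moreover have "(\<lambda>x. ?h' x b) \<in> ?add ` (bump_space c r \<times> bump_space c r)" if "b \<in> Basis" for b
      unfolding sum_Basis_delta[OF that]
      by (rule image_eqI[of _ _ "(partials [b] f, partials [b] g)"])
         (use fg bump_space_partials1 that in auto)
    ultimately show "\<exists>h'. (\<forall>x. (h has_derivative h' x) (at x)) \<and> (\<forall>b\<in>Basis. (\<lambda>x. h' x b) \<in> ?add ` (bump_space c r \<times> bump_space c r))"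
      by (intro exI[of _ ?h']) blast
  qed (use assms in auto)
  moreover have "dist c x \<le> r" if "f x + g x \<noteq> 0" for x
    using assms that unfolding bump_space_def by (metis (mono_tags, lifting) add.right_neutral mem_Collect_eq)
  ultimately show ?thesis by (simp add: bump_space_def)
qed

lemma bump_space_zero: "(\<lambda>x. 0) \<in> bump_space c r"
proof -
  have "smooth_on UNIV (\<lambda>x::'a. 0)"
    by (rule smooth_family[of "{\<lambda>x. 0}"]) (auto intro!: exI[of _ "\<lambda>_ _. 0"])
  then show ?thesis by (simp add: bump_space_def)
qed

lemma bump_space_sum:
  "(\<And>i. i \<in> I \<Longrightarrow> f i \<in> bump_space c r) \<Longrightarrow> (\<lambda>x. \<Sum>i\<in>I. f i x) \<in> bump_space c r"
  by (induction I rule: infinite_finite_induct) (simp_all add: bump_space_add bump_space_zero)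

lemma bump_space_cmult:
  assumes "f \<in> bump_space c r" shows "(\<lambda>x. a * f x) \<in> bump_space c r"
proof -
  have "smooth_on UNIV (\<lambda>x. a * f x)"
  proof (rule smooth_family[of "(\<lambda>f x. a * f x) ` bump_space c r"])
    fix h assume "h \<in> (\<lambda>f x. a * f x) ` bump_space c r"
    then obtain f where f: "f \<in> bump_space c r" and h: "h = (\<lambda>x. a * f x)" by auto
    let ?h' = "\<lambda>x k. a * (\<Sum>b\<in>Basis. (k \<bullet> b) * partials [b] f x)"
    have "(h has_derivative ?h' x) (at x)" for x
      unfolding h by (intro has_derivative_mult_right bump_space_has_derivative[OF f])
    then show "\<exists>h'. (\<forall>x. (h has_derivative h' x) (at x)) \<and> (\<forall>b\<in>Basis. (\<lambda>x. h' x b) \<in> (\<lambda>f x. a * f x) ` bump_space c r)"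
      using bump_space_partials1[OF f] by (intro exI[of _ ?h']) (auto simp: sum_Basis_delta)
  qed (use assms in auto)
  then show ?thesis using assms by (auto simp: bump_space_def)
qed

lemma bump_space_diff:
  "f \<in> bump_space c r \<Longrightarrow> g \<in> bump_space c r \<Longrightarrow> (\<lambda>x. f x - g x) \<in> bump_space c r"
  using bump_space_add[of f c r "\<lambda>x. -1 * g x"] bump_space_cmult[of g c r "-1"] by simp

lemma bump_space_translate:
  assumes "f \<in> bump_space c r" shows "(\<lambda>x. f (x - a)) \<in> bump_space (c + a) r"
proof -
  have "smooth_on UNIV (\<lambda>x. f (x - a))"
  proof (rule smooth_family[of "(\<lambda>f x. f (x - a)) ` bump_space c r"])
    fix h assume "h \<in> (\<lambda>f x. f (x - a)) ` bump_space c r"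
    then obtain f where f: "f \<in> bump_space c r" and h: "h = (\<lambda>x. f (x - a))" by auto
    let ?h' = "\<lambda>x k. \<Sum>b\<in>Basis. (k \<bullet> b) * partials [b] f (x - a)"
    have "(h has_derivative ?h' x) (at x)" for x
      unfolding h by (rule has_derivative_compose[OF _ bump_space_has_derivative[OF f], of "\<lambda>x. x - a" "\<lambda>k. k"])
        (auto intro!: derivative_eq_intros)
    then show "\<exists>h'. (\<forall>x. (h has_derivative h' x) (at x)) \<and> (\<forall>b\<in>Basis. (\<lambda>x. h' x b) \<in> (\<lambda>f x. f (x - a)) ` bump_space c r)"
      using bump_space_partials1[OF f] by (intro exI[of _ ?h']) (auto simp: sum_Basis_delta)
  qed (use assms in auto)
  moreover have "dist (c + a) x = dist c (x - a)" for x by (simp add: dist_norm algebra_simps)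
  ultimately show ?thesis using assms by (auto simp: bump_space_def)
qed

lemma laplacian_bump_space: "f \<in> bump_space c r \<Longrightarrow> laplacian f \<in> bump_space c r"
  unfolding laplacian_def[abs_def] by (intro bump_space_sum bump_space_partials) auto

text \<open>Fubini separates the width t from y; the inner integral is, up to sign, the derivative
  of the average in its width, and the fundamental theorem of calculus evaluates the outer
  one.\<close>

lemma laplacian_potential:
  fixes f :: "'a::euclidean_space \<Rightarrow> real"
  assumes f: "f \<in> bump_space c r" and s: "0 \<le> s"
  shows "laplacian (potential s f) x = f x - smoothing s f x"
proof -
  interpret V: averaging "lborel :: (real \<times> 'a) measure" "potential_weight s" "\<lambda>p. fst p *\<^sub>R (snd p :: 'a)" s
    by (rule averaging_potential)
  let ?G = "\<lambda>t. t * (LINT y|lborel. kernel_pot y * laplacian f (x - t *\<^sub>R y))"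
  let ?w = "\<lambda>p. potential_weight s p * laplacian f (x - fst p *\<^sub>R snd p)"
  have lf: "laplacian f \<in> bump_space c r" by (rule laplacian_bump_space[OF f])
  have "laplacian (potential s f) x = (\<Sum>b\<in>Basis. potential s (partials [b, b] f) x)"
    unfolding laplacian_def using potential_partials[OF f] by (intro sum.cong) auto
  also have "\<dots> = (LINT p|lborel. ?w p)"
    unfolding potential_def V.average_def laplacian_def sum_distrib_left
    by (rule Bochner_Integration.integral_sum[symmetric])
       (rule V.average_integrable[OF bump_space_partials[OF f]], auto)
  finally have lap: "laplacian (potential s f) x = (LINT p|lborel. ?w p)" .
  have "(LINT p|lborel. ?w p) = (LINT t|lborel. LINT y|lborel. ?w (t, y))"
    using lborel_pair.integral_fst'[of ?w] V.average_integrable[OF lf, of x] by (simp add: lborel_prod)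
  moreover have inner: "(LINT y|lborel. ?w (t, y)) = - (indicator {0..s} t * ?G t)" for t
  proof -
    have "(LINT y|lborel. ?w (t, y)) = (LINT y|lborel. - (indicator {0..s} t * t) * (kernel_pot y * laplacian f (x - t *\<^sub>R y)))"
      by (rule Bochner_Integration.integral_cong) (auto simp: potential_weight_def)
    then show ?thesis by simp
  qed
  moreover have "(LINT t|lborel. indicator {0..s} t * ?G t) = smoothing s f x - f x"
  proof -
    \<comment> \<open>The lower end contributes \<open>f x\<close>, because at width 0 the average
      is \<open>f x\<close> times the mass 1 of the kernel.\<close>
    have "(?G has_integral ((LINT y|lborel. kernel_avg y * f (x - s *\<^sub>R y)) - (LINT y|lborel. kernel_avg y * f (x - 0 *\<^sub>R y)))) {0..s}"
      by (rule fundamental_theorem_of_calculus[OF s])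
         (use smoothing_scale_derivative[OF f] in \<open>auto simp: has_real_derivative_iff_has_vector_derivative[symmetric] intro: has_field_derivative_at_within\<close>)
    then have hk: "(?G has_integral (smoothing s f x - f x)) {0..s}" using s by (simp add: smoothing_eq kernel_avg_integral)
    have "integrable (lborel \<Otimes>\<^sub>M lborel) ?w" using V.average_integrable[OF lf, of x] by (simp add: lborel_prod)
    from lborel_pair.integrable_fst'[OF this]
    have "integrable lborel (\<lambda>t. LINT y|lborel. ?w (t, y))" .
    then have "integrable lborel (\<lambda>t. - (indicator {0..s} t * ?G t))"
      unfolding inner .
    then have si: "set_integrable lborel {0..s} ?G" by (simp add: set_integrable_def)
    have "(LINT t|lborel. indicator {0..s} t * ?G t) = integral {0..s} ?G"
      using set_borel_integral_eq_integral(2)[OF si] by (simp add: set_lebesgue_integral_def)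
    then show ?thesis using hk by (simp add: integral_unique)
  qed
  ultimately show ?thesis using lap by simp
qed

text \<open>An energy estimate for w, the j-th derivative of the potential: its Laplacian is the
  j-th derivative of \<open>f - smoothing s f\<close>. Testing with w and moving that derivative
  onto w bounds the squared gradient norm of w by the norm of its j-th derivative times 2 |f|, since
  smoothing is a contraction.\<close>

lemma potential_hessian_bound:
  fixes f :: "'a::euclidean_space \<Rightarrow> real"
  assumes f: "f \<in> bump_space c r" and s: "0 \<le> s" and i: "i \<in> Basis" and j: "j \<in> Basis"
  shows "L2_norm UNIV (partials [i, j] (potential s f)) \<le> 2 * L2_norm UNIV f"
proof -
  define w where "w = partials [j] (potential s f)"
  have fj: "partials [j] f \<in> bump_space c r" by (rule bump_space_partials1[OF f j])
  have Nf: "smoothing s f \<in> bump_space c (r + s)" by (rule smoothing_bump_space[OF f s])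
  have Nfj: "partials [j] (smoothing s f) \<in> bump_space c (r + s)" by (rule bump_space_partials1[OF Nf j])
  have w: "w \<in> bump_space c (r + s)"
    unfolding w_def by (rule bump_space_partials1[OF potential_bump_space[OF f] j])
  have wi: "partials [k] w \<in> bump_space c (r + s)" if "k \<in> Basis" for k
    by (rule bump_space_partials1[OF w that])
  have wii: "partials [k, k] w \<in> bump_space c (r + s)" if "k \<in> Basis" for k
    by (rule bump_space_partials[OF w]) (use that in auto)
  have lap: "laplacian w x = partials [j] f x - partials [j] (smoothing s f) x" for x
    unfolding w_def using potential_partials[OF f, of "[j]" s] smoothing_partials[OF f s, of "[j]"] laplacian_potential[OF fj s] j by simp
  have "(\<Sum>k\<in>Basis. (L2_norm UNIV (partials [k] w))\<^sup>2) = (\<Sum>k\<in>Basis. - (LINT x|lborel. w x * partials [k, k] w x))"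
  proof (rule sum.cong)
    fix k :: 'a assume k: "k \<in> Basis"
    have "(L2_norm UNIV (partials [k] w))\<^sup>2 = (LINT x|lborel. partials [k] w x * partials [k] w x)"
      using bump_space_L2_norm[OF wi[OF k]] by (simp add: power2_eq_square)
    also have "\<dots> = - (LINT x|lborel. w x * partials [k] (partials [k] w) x)"
      using bump_space_integral_by_parts[OF w wi[OF k] k] by simp
    finally show "(L2_norm UNIV (partials [k] w))\<^sup>2 = - (LINT x|lborel. w x * partials [k, k] w x)"
      using partials_append[of "[k]" "[k]" w] by simp
  qed simp
  also have "\<dots> = - (LINT x|lborel. w x * laplacian w x)"
    unfolding laplacian_def sum_distrib_left sum_negf
    by (subst Bochner_Integration.integral_sum) (auto intro: bump_space_bump2_integrable[OF w wii])
  also have "\<dots> = - (LINT x|lborel. w x * partials [j] f x) + (LINT x|lborel. w x * partials [j] (smoothing s f) x)"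
    unfolding lap right_diff_distrib
    using bump_space_bump2_integrable[OF w fj] bump_space_bump2_integrable[OF w Nfj] by simp
  also have "\<dots> = (LINT x|lborel. partials [j] w x * f x) - (LINT x|lborel. partials [j] w x * smoothing s f x)"
    using bump_space_integral_by_parts[OF w f j] bump_space_integral_by_parts[OF w Nf j] by simp
  also have "\<dots> \<le> L2_norm UNIV (partials [j] w) * L2_norm UNIV f + L2_norm UNIV (partials [j] w) * L2_norm UNIV (smoothing s f)"
    using L2_norm_bump_Cauchy_Schwarz[OF wi[OF j] f] L2_norm_bump_Cauchy_Schwarz[OF wi[OF j] Nf] by linarith
  also have "\<dots> \<le> L2_norm UNIV (partials [j] w) * (2 * L2_norm UNIV f)"
    using mult_left_mono[OF smoothing_L2_norm[OF f s] L2_norm_nonneg[of UNIV "partials [j] w"]] by (simp add: algebra_simps)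
  finally have sum: "(\<Sum>k\<in>Basis. (L2_norm UNIV (partials [k] w))\<^sup>2) \<le> L2_norm UNIV (partials [j] w) * (2 * L2_norm UNIV f)" .
  have single: "(L2_norm UNIV (partials [k] w))\<^sup>2 \<le> L2_norm UNIV (partials [j] w) * (2 * L2_norm UNIV f)" if "k \<in> Basis" for k
    using member_le_sum[of k Basis "\<lambda>k. (L2_norm UNIV (partials [k] w))\<^sup>2"] that sum by simp
  \<comment> \<open>The choice k = j is divided by its own norm first; the resulting bound then
    serves the choice k = i.\<close>
  have wj: "L2_norm UNIV (partials [j] w) \<le> 2 * L2_norm UNIV f"
  proof (cases "L2_norm UNIV (partials [j] w) = 0")
    case False
    then have "0 < L2_norm UNIV (partials [j] w)" using L2_norm_nonneg[of UNIV "partials [j] w"] by linarith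
    then show ?thesis using single[OF j] by (simp add: power2_eq_square)
  qed simp
  have "(L2_norm UNIV (partials [i] w))\<^sup>2 \<le> 2 * L2_norm UNIV f * (2 * L2_norm UNIV f)"
    using single[OF i] mult_right_mono[OF wj, of "2 * L2_norm UNIV f"] by (meson L2_norm_nonneg mult_nonneg_nonneg order_trans zero_le_numeral)
  then have "L2_norm UNIV (partials [i] w) \<le> 2 * L2_norm UNIV f"
    unfolding power2_eq_square[of "2 * L2_norm UNIV f", symmetric] by (rule power2_le_imp_le) simp
  then show ?thesis unfolding w_def using partials_append[of "[i]" "[j]" "potential s f"] by simp
qed

text \<open>Interpolation between the function and its pure second derivative, by one integration by
  parts.\<close>

lemma potential_gradient_bound:
  fixes f :: "'a::euclidean_space \<Rightarrow> real"
  assumes f: "f \<in> bump_space c r" and s: "0 \<le> s" and i: "i \<in> Basis"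
  shows "(L2_norm UNIV (partials [i] (potential s f)))\<^sup>2 \<le> L2_norm UNIV (potential s f) * (2 * L2_norm UNIV f)"
proof -
  let ?v = "potential s f"
  have v: "?v \<in> bump_space c (r + s)" by (rule potential_bump_space[OF f])
  have vi: "partials [i] ?v \<in> bump_space c (r + s)" by (rule bump_space_partials1[OF v i])
  have vii: "partials [i, i] ?v \<in> bump_space c (r + s)" by (rule bump_space_partials[OF v]) (use i in auto)
  have "(L2_norm UNIV (partials [i] ?v))\<^sup>2 = (LINT x|lborel. partials [i] ?v x * partials [i] ?v x)"
    using bump_space_L2_norm[OF vi] by (simp add: power2_eq_square)
  also have "\<dots> = - (LINT x|lborel. ?v x * partials [i, i] ?v x)"
    using bump_space_integral_by_parts[OF v vi i] partials_append[of "[i]" "[i]" ?v] by simp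
  also have "\<dots> \<le> L2_norm UNIV ?v * L2_norm UNIV (partials [i, i] ?v)"
    using L2_norm_bump_Cauchy_Schwarz[OF v vii] by linarith
  also have "\<dots> \<le> L2_norm UNIV ?v * (2 * L2_norm UNIV f)"
    by (intro mult_left_mono potential_hessian_bound[OF f s i i] L2_norm_nonneg)
  finally show ?thesis .
qed

text \<open>One constant for all orders up to 2: \<open>C - 2\<close> bounds the potential, 2 bounds
  the Hessian, and the gradient is covered because \<open>(C - 2) * 2 \<le> C * C\<close>.\<close>

definition potential_const :: "'a::euclidean_space itself \<Rightarrow> real" where
  "potential_const _ = (LINT p|lborel. \<bar>potential_weight 1 (p :: real \<times> 'a)\<bar>) + 2"

lemma potential_const_ge: "2 \<le> potential_const TYPE('a::euclidean_space)"
  by (simp add: potential_const_def)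

lemma potential_partials_L2_norm:
  fixes f :: "'a::euclidean_space \<Rightarrow> real"
  assumes f: "f \<in> bump_space c r" and s: "0 \<le> s" "s \<le> 1" and bs: "bs \<in> dirs2"
  shows "L2_norm UNIV (partials bs (potential s f)) \<le> potential_const TYPE('a) * L2_norm UNIV f"
proof -
  let ?C = "potential_const TYPE('a)" and ?n = "L2_norm UNIV f"
  have C0: "L2_norm UNIV (potential s f) \<le> (?C - 2) * ?n"
    using potential_L2_norm[OF f s(2)] by (simp add: potential_const_def)
  have n: "0 \<le> ?n" by simp
  from bs consider "bs = []" | i where "bs = [i]" "i \<in> Basis" | i j where "bs = [i, j]" "i \<in> Basis" "j \<in> Basis"
  proof (cases bs)
    case (Cons i cs)
    then show ?thesis using bs that by (cases cs) (auto simp: dirs2_def)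
  qed simp
  then show ?thesis
  proof cases
    case 1
    have "(?C - 2) * ?n = ?C * ?n - 2 * ?n" by (rule left_diff_distrib)
    then have "L2_norm UNIV (potential s f) \<le> ?C * ?n" using C0 n by linarith
    then show ?thesis using 1 by simp
  next
    case 2
    have "(L2_norm UNIV (partials [i] (potential s f)))\<^sup>2 \<le> (?C - 2) * ?n * (2 * ?n)"
      using potential_gradient_bound[OF f s(1) 2(2)] mult_right_mono[OF C0, of "2 * ?n"] n by linarith
    also have "\<dots> \<le> ?C * ?n * (?C * ?n)"
      using potential_const_ge[where 'a='a] n by (intro mult_mono mult_right_mono) auto
    also have "\<dots> = (?C * ?n)\<^sup>2" by (simp add: power2_eq_square)
    finally show ?thesis unfolding 2(1)
      by (rule power2_le_imp_le) (use potential_const_ge[where 'a='a] n in simp)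
  next
    case 3
    have "2 * ?n \<le> ?C * ?n" using potential_const_ge[where 'a='a] n by (intro mult_right_mono) auto
    then show ?thesis using potential_hessian_bound[OF f s(1) 3(2) 3(3)] 3(1) by simp
  qed
qed

section \<open>Density of smooth functions in \<open>L2\<close> of a ball\<close>

text \<open>For k = 0 this is the standard flat function. The negative powers are included so that
  derivatives are linear combinations of members of the family.\<close>

definition flat_exp :: "nat \<Rightarrow> real \<Rightarrow> real" where
  "flat_exp k u = (if 0 < u then inverse u ^ k * exp (- inverse u) else 0)"

lemma flat_exp_tendsto_0: "(flat_exp k \<longlongrightarrow> 0) (at 0)"
proof (rule filterlim_split_at)
  show "(flat_exp k \<longlongrightarrow> 0) (at_left 0)"
    by (rule tendsto_eventually) (auto simp: flat_exp_def eventually_at_filter)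
  have "((\<lambda>u. inverse u ^ k / exp (inverse u)) \<longlongrightarrow> (0::real)) (at_right 0)"
    by (rule filterlim_compose[OF tendsto_power_div_exp_0 filterlim_inverse_at_top_right])
  then show "(flat_exp k \<longlongrightarrow> 0) (at_right 0)"
    by (rule Lim_transform_eventually) (auto simp: flat_exp_def eventually_at_filter exp_minus field_simps)
qed

lemma flat_exp_has_derivative:
  "(flat_exp k has_real_derivative (- of_nat k * flat_exp (Suc k) u + flat_exp (Suc (Suc k)) u)) (at u)"
proof -
  consider "u > 0" | "u < 0" | "u = 0" by linarith
  then show ?thesis
  proof cases
    case 1
    have "((\<lambda>u. inverse u ^ k * exp (- inverse u)) has_real_derivative
        (of_nat k * inverse u ^ (k - 1) * (- (inverse u ^ 2))) * exp (- inverse u) + inverse u ^ k * (exp (- inverse u) * inverse u ^ 2)) (at u)"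
      using 1 by (auto intro!: derivative_eq_intros simp: power2_eq_square)
    then have "(flat_exp k has_real_derivative
        (of_nat k * inverse u ^ (k - 1) * (- (inverse u ^ 2))) * exp (- inverse u) + inverse u ^ k * (exp (- inverse u) * inverse u ^ 2)) (at u)"
      by (rule has_field_derivative_transform_within_open[of _ _ _ "{0<..}"]) (use 1 in \<open>auto simp: flat_exp_def\<close>)
    then show ?thesis
      by (rule DERIV_cong) (use 1 in \<open>cases k; simp add: flat_exp_def power2_eq_square algebra_simps\<close>)
  next
    case 2
    have "((\<lambda>u. 0) has_real_derivative 0) (at u)" by simp
    then have "(flat_exp k has_real_derivative 0) (at u)"
      by (rule has_field_derivative_transform_within_open[of _ _ _ "{..<0}"]) (use 2 in \<open>auto simp: flat_exp_def\<close>)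
    then show ?thesis using 2 by (simp add: flat_exp_def)
  next
    case 3
    \<comment> \<open>For positive h the difference quotient at 0 is the next member
      \<open>flat_exp (Suc k) h\<close>, and all members tend to 0.\<close>
    have "((\<lambda>h. (flat_exp k (0 + h) - flat_exp k 0) / h) \<longlongrightarrow> 0) (at 0)"
      by (rule Lim_transform_eventually[OF flat_exp_tendsto_0[of "Suc k"]])
         (auto simp: flat_exp_def eventually_at_filter field_simps)
    then show ?thesis using 3 by (simp add: has_field_derivative_iff flat_exp_def)
  qed
qed

text \<open>Generated so as to be closed under partial derivatives: the \<open>flat\<close> rule
  admits every k because differentiation raises the index. Then \<open>smooth_family\<close> makes
  all members smooth at once.\<close>

inductive_set flat_algebra :: "('a::euclidean_space \<Rightarrow> real) set" where
  const: "(\<lambda>x. a) \<in> flat_algebra"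
| coord: "(\<lambda>x. x \<bullet> v) \<in> flat_algebra"
| add: "f \<in> flat_algebra \<Longrightarrow> g \<in> flat_algebra \<Longrightarrow> (\<lambda>x. f x + g x) \<in> flat_algebra"
| mult: "f \<in> flat_algebra \<Longrightarrow> g \<in> flat_algebra \<Longrightarrow> (\<lambda>x. f x * g x) \<in> flat_algebra"
| flat: "f \<in> flat_algebra \<Longrightarrow> (\<lambda>x. flat_exp k (f x)) \<in> flat_algebra"

lemma flat_algebra_smooth:
  assumes "f \<in> flat_algebra" shows "smooth_on UNIV f"
proof (rule smooth_family[OF _ assms])
  fix g :: "'a \<Rightarrow> real" assume "g \<in> flat_algebra"
  then show "\<exists>g'. (\<forall>x. (g has_derivative g' x) (at x)) \<and> (\<forall>b\<in>Basis. (\<lambda>x. g' x b) \<in> flat_algebra)"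
  proof (induction rule: flat_algebra.induct)
    case (const a)
    then show ?case using flat_algebra.const by (intro exI[of _ "\<lambda>_ _. 0"]) auto
  next
    case (coord v)
    then show ?case using flat_algebra.const
      by (intro exI[of _ "\<lambda>_ h. h \<bullet> v"]) (auto intro!: derivative_eq_intros)
  next
    case (add f g)
    then obtain f' g' where d: "\<And>x. (f has_derivative f' x) (at x)" "\<And>x. (g has_derivative g' x) (at x)"
      and m: "\<And>b. b \<in> Basis \<Longrightarrow> (\<lambda>x. f' x b) \<in> flat_algebra" "\<And>b. b \<in> Basis \<Longrightarrow> (\<lambda>x. g' x b) \<in> flat_algebra" by metis
    show ?case
      by (rule exI[of _ "\<lambda>x h. f' x h + g' x h"]) (intro conjI allI ballI has_derivative_add d flat_algebra.add m)
  next
    case (mult f g)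
    then obtain f' g' where d: "\<And>x. (f has_derivative f' x) (at x)" "\<And>x. (g has_derivative g' x) (at x)"
      and m: "\<And>b. b \<in> Basis \<Longrightarrow> (\<lambda>x. f' x b) \<in> flat_algebra" "\<And>b. b \<in> Basis \<Longrightarrow> (\<lambda>x. g' x b) \<in> flat_algebra" by metis
    show ?case
      by (rule exI[of _ "\<lambda>x h. f x * g' x h + f' x h * g x"])
         (intro conjI allI ballI has_derivative_mult d flat_algebra.add flat_algebra.mult m mult.hyps)
  next
    case (flat f k)
    then obtain f' where d: "\<And>x. (f has_derivative f' x) (at x)"
      and m: "\<And>b. b \<in> Basis \<Longrightarrow> (\<lambda>x. f' x b) \<in> flat_algebra" by metis
    let ?c = "\<lambda>x. - of_nat k * flat_exp (Suc k) (f x) + flat_exp (Suc (Suc k)) (f x)"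
    have "((\<lambda>x. flat_exp k (f x)) has_derivative (\<lambda>h. ?c x * f' x h)) (at x)" for x
      by (rule has_derivative_compose[OF d flat_exp_has_derivative[unfolded has_field_derivative_def]])
    moreover have "(\<lambda>x. ?c x * f' x b) \<in> flat_algebra" if "b \<in> Basis" for b
      by (intro flat_algebra.intros m[OF that] flat.hyps)
    ultimately show ?case by (intro exI[of _ "\<lambda>x h. ?c x * f' x h"]) blast
  qed
qed

lemma flat_algebra_sum: "(\<And>i. i \<in> I \<Longrightarrow> f i \<in> flat_algebra) \<Longrightarrow> (\<lambda>x. \<Sum>i\<in>I. f i x) \<in> flat_algebra"
  by (induction I rule: infinite_finite_induct) (simp_all add: flat_algebra.add flat_algebra.const)

lemma flat_algebra_prod: "(\<And>i. i \<in> I \<Longrightarrow> f i \<in> flat_algebra) \<Longrightarrow> (\<lambda>x. \<Prod>i\<in>I. f i x) \<in> flat_algebra"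
  by (induction I rule: infinite_finite_induct) (simp_all add: flat_algebra.mult flat_algebra.const)

lemma flat_exp_bounds: "0 \<le> flat_exp 0 u" "flat_exp 0 u \<le> 1"
  by (auto simp: flat_exp_def)

lemma flat_exp_limit:
  assumes "u \<longlonglongrightarrow> l" "0 < l"
  shows "(\<lambda>n. flat_exp 0 (real (Suc n) * u n)) \<longlonglongrightarrow> 1"
proof -
  have "filterlim (\<lambda>n. u n * real (Suc n)) at_top sequentially"
    by (rule filterlim_tendsto_pos_mult_at_top[OF assms filterlim_compose[OF filterlim_real_sequentially filterlim_Suc]])
  then have top: "filterlim (\<lambda>n. real (Suc n) * u n) at_top sequentially" by (simp only: mult.commute)
  then have "((\<lambda>n. exp (- inverse (real (Suc n) * u n))) \<longlongrightarrow> exp (- 0)) sequentially"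
    by (intro tendsto_exp tendsto_minus tendsto_inverse_0_at_top)
  moreover have "eventually (\<lambda>n. exp (- inverse (real (Suc n) * u n)) = flat_exp 0 (real (Suc n) * u n)) sequentially"
    using filterlim_at_top_dense[THEN iffD1, OF top, rule_format, of 0]
    by eventually_elim (simp add: flat_exp_def)
  ultimately show ?thesis using Lim_transform_eventually by fastforce
qed

text \<open>The factor n + 1 drives the value to 1 inside the ball, while the radius increases to r
  from below, so each support stays in a strictly smaller closed ball. The index n + 2 keeps the
  radius positive at n = 0.\<close>

definition ball_cutoff :: "'a::euclidean_space \<Rightarrow> real \<Rightarrow> nat \<Rightarrow> 'a \<Rightarrow> real" where
  "ball_cutoff c r n x = flat_exp 0 (real (Suc n) * ((r * (1 - inverse (real (Suc (Suc n)))))\<^sup>2 - (norm (x - c))\<^sup>2))"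

definition box_cutoff :: "'a::euclidean_space \<Rightarrow> 'a \<Rightarrow> nat \<Rightarrow> 'a \<Rightarrow> real" where
  "box_cutoff a b n x = (\<Prod>i\<in>Basis. flat_exp 0 (real (Suc n) * (x \<bullet> i - a \<bullet> i)) * flat_exp 0 (real (Suc n) * (b \<bullet> i - x \<bullet> i)))"

lemma flat_algebra_affine: "(\<lambda>x. m * (x \<bullet> v - a)) \<in> flat_algebra" "(\<lambda>x. m * (a - x \<bullet> v)) \<in> flat_algebra"
proof -
  have "(\<lambda>x. m * (x \<bullet> v + (- a))) \<in> flat_algebra" "(\<lambda>x. m * (a + (-1) * (x \<bullet> v))) \<in> flat_algebra"
    by (intro flat_algebra.intros)+
  then show "(\<lambda>x. m * (x \<bullet> v - a)) \<in> flat_algebra" "(\<lambda>x. m * (a - x \<bullet> v)) \<in> flat_algebra" by simp_all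
qed

lemma cutoff_flat_algebra: "ball_cutoff c r n \<in> flat_algebra" "box_cutoff a b n \<in> flat_algebra"
proof -
  have eq: "(norm (x - c))\<^sup>2 = (\<Sum>i\<in>Basis. (1 * (x \<bullet> i - c \<bullet> i)) * (1 * (x \<bullet> i - c \<bullet> i)))" for x
    unfolding power2_norm_eq_inner by (subst euclidean_inner) (simp add: inner_diff_left)
  have "(\<lambda>x. flat_exp 0 (real (Suc n) * ((r * (1 - inverse (real (Suc (Suc n)))))\<^sup>2 + (-1) * (norm (x - c))\<^sup>2))) \<in> flat_algebra"
    unfolding eq by (intro flat_algebra.flat flat_algebra.mult flat_algebra.const flat_algebra.add flat_algebra_sum flat_algebra_affine)
  then show "ball_cutoff c r n \<in> flat_algebra" by (simp add: ball_cutoff_def[abs_def])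
  show "box_cutoff a b n \<in> flat_algebra"
    unfolding box_cutoff_def[abs_def] by (intro flat_algebra_prod flat_algebra.mult flat_algebra.flat flat_algebra_affine)
qed

lemma cutoff_bounds: "0 \<le> ball_cutoff c r n x" "ball_cutoff c r n x \<le> 1" "0 \<le> box_cutoff a b n x" "box_cutoff a b n x \<le> 1"
  unfolding ball_cutoff_def box_cutoff_def
  by (auto intro!: flat_exp_bounds prod_nonneg prod_le_1 mult_nonneg_nonneg mult_le_one)

lemma ball_cutoff_support:
  assumes "0 < r" "ball_cutoff c r n x \<noteq> 0"
  shows "dist c x \<le> r * (1 - inverse (real (Suc (Suc n))))" "r * (1 - inverse (real (Suc (Suc n)))) < r"
proof -
  let ?\<rho> = "r * (1 - inverse (real (Suc (Suc n))))"
  have "inverse (real (Suc (Suc n))) \<le> 1" by (simp add: field_simps)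
  then have "0 \<le> ?\<rho>" using \<open>0 < r\<close> by simp
  have "0 < real (Suc n) * (?\<rho>\<^sup>2 - (norm (x - c))\<^sup>2)"
    using assms(2) unfolding ball_cutoff_def flat_exp_def by (meson)
  then have "(norm (x - c))\<^sup>2 < ?\<rho>\<^sup>2" by (simp only: zero_less_mult_iff) simp
  then have "norm (x - c) < ?\<rho>" using \<open>0 \<le> ?\<rho>\<close> by (rule power2_less_imp_less)
  then show "dist c x \<le> ?\<rho>" by (simp add: dist_norm norm_minus_commute)
  show "?\<rho> < r" using \<open>0 < r\<close> by (simp add: field_simps)
qed

lemma ball_cutoff_bump_space:
  "0 < r \<Longrightarrow> ball_cutoff c r n \<in> bump_space c (r * (1 - inverse (real (Suc (Suc n)))))"
  using ball_cutoff_support(1) flat_algebra_smooth[OF cutoff_flat_algebra(1)] by (auto simp: bump_space_def)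

lemma ball_cutoff_limit:
  assumes "0 < r" shows "(\<lambda>n. ball_cutoff c r n x) \<longlonglongrightarrow> indicator (ball c r) x"
proof (cases "x \<in> ball c r")
  case True
  then have "(norm (x - c))\<^sup>2 < r\<^sup>2" by (intro power_strict_mono) (auto simp: dist_norm norm_minus_commute)
  moreover have "(\<lambda>n. (r * (1 - inverse (real (Suc (Suc n)))))\<^sup>2 - (norm (x - c))\<^sup>2) \<longlonglongrightarrow> (r * (1 - 0))\<^sup>2 - (norm (x - c))\<^sup>2"
    by (intro tendsto_intros LIMSEQ_Suc[OF LIMSEQ_inverse_real_of_nat])
  ultimately have "(\<lambda>n. ball_cutoff c r n x) \<longlonglongrightarrow> 1"
    unfolding ball_cutoff_def by (intro flat_exp_limit) auto
  then show ?thesis using True by simp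
next
  case False
  then have "ball_cutoff c r n x = 0" for n using ball_cutoff_support[OF assms, of c n x] by force
  then show ?thesis using False by simp
qed

lemma box_cutoff_limit: "(\<lambda>n. box_cutoff a b n x) \<longlonglongrightarrow> indicator (box a b) x"
proof (cases "x \<in> box a b")
  case True
  have "(\<lambda>n. box_cutoff a b n x) \<longlonglongrightarrow> (\<Prod>i\<in>(Basis::'a set). 1 * 1)"
    unfolding box_cutoff_def
    by (intro tendsto_prod tendsto_mult flat_exp_limit[OF tendsto_const]) (use True in \<open>auto simp: mem_box\<close>)
  then show ?thesis using True by simp
next
  case False
  then obtain i where i: "i \<in> Basis" "x \<bullet> i - a \<bullet> i \<le> 0 \<or> b \<bullet> i - x \<bullet> i \<le> 0" by (auto simp: mem_box not_less)
  have "box_cutoff a b n x = 0" for n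
  proof -
    have "\<not> 0 < real (Suc n) * (x \<bullet> i - a \<bullet> i) \<or> \<not> 0 < real (Suc n) * (b \<bullet> i - x \<bullet> i)"
      using i(2) by (simp only: zero_less_mult_iff) auto
    then have "\<exists>i\<in>Basis. flat_exp 0 (real (Suc n) * (x \<bullet> i - a \<bullet> i)) * flat_exp 0 (real (Suc n) * (b \<bullet> i - x \<bullet> i)) = 0"
      using i(1) by (intro bexI[of _ i]) (auto simp: flat_exp_def)
    then show ?thesis unfolding box_cutoff_def by (simp only: prod_zero_iff finite_Basis)
  qed
  then show ?thesis using False by simp
qed

section \<open>Dominated limits and approximation by smooth functions\<close>

lemma L2_dominated_convergence:
  fixes g :: "'a::euclidean_space \<Rightarrow> real"
  assumes f: "\<And>n. f n \<in> borel_measurable lebesgue" and g: "g \<in> borel_measurable lebesgue"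
    and lim: "\<And>x. (\<lambda>n. f n x) \<longlonglongrightarrow> g x"
    and w: "w \<in> L2 UNIV" and bound: "\<And>n x. \<bar>f n x\<bar> \<le> w x"
  shows "f n \<in> L2 UNIV" "g \<in> L2 UNIV" "(\<lambda>n. L2_norm UNIV (\<lambda>x. g x - f n x)) \<longlonglongrightarrow> 0"
proof -
  note [measurable] = f g
  have wi: "integrable lebesgue (\<lambda>x. (w x)\<^sup>2)" using L2_D(2)[OF w] by (simp add: lebesgue_on_UNIV_eq)
  have [measurable]: "w \<in> borel_measurable lebesgue" using L2_D(1)[OF w] by (simp add: lebesgue_on_UNIV_eq)
  have w0: "0 \<le> w x" for x using bound[of 0 x] by linarith
  have gb: "\<bar>g x\<bar> \<le> w x" for x
    by (rule LIMSEQ_le_const2[OF tendsto_rabs[OF lim[of x]]]) (use bound in auto)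
  have sq: "h \<in> L2 UNIV" if "h \<in> borel_measurable lebesgue" "\<And>x. \<bar>h x\<bar> \<le> w x" for h
  proof -
    have "(h x)\<^sup>2 \<le> (w x)\<^sup>2" for x using power_mono[OF that(2)[of x], of 2] by simp
    then have "integrable lebesgue (\<lambda>x. (h x)\<^sup>2)"
      using that(1) by (intro Bochner_Integration.integrable_bound[OF wi]) auto
    then show ?thesis using that(1) by (simp add: L2_def lebesgue_on_UNIV_eq)
  qed
  show "f n \<in> L2 UNIV" for n by (rule sq[OF f bound])
  show "g \<in> L2 UNIV" by (rule sq[OF g gb])
  have "(\<lambda>n. LINT x|lebesgue. (g x - f n x)\<^sup>2) \<longlonglongrightarrow> (LINT x|(lebesgue :: 'a measure). (0::real))"
  proof (rule integral_dominated_convergence)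
    show "integrable lebesgue (\<lambda>x. 4 * (w x)\<^sup>2)" using wi by simp
    show "AE x in lebesgue. (\<lambda>n. (g x - f n x)\<^sup>2) \<longlonglongrightarrow> 0"
    proof (rule AE_I2)
      fix x
      have "(\<lambda>n. (g x - f n x)\<^sup>2) \<longlonglongrightarrow> (g x - g x)\<^sup>2" by (intro tendsto_intros lim)
      then show "(\<lambda>n. (g x - f n x)\<^sup>2) \<longlonglongrightarrow> 0" by simp
    qed
    show "AE x in lebesgue. norm ((g x - f n x)\<^sup>2) \<le> 4 * (w x)\<^sup>2" for n
    proof (rule AE_I2)
      fix x
      have "\<bar>g x - f n x\<bar> \<le> 2 * w x" using gb[of x] bound[of n x] by linarith
      from power_mono[OF this, of 2] show "norm ((g x - f n x)\<^sup>2) \<le> 4 * (w x)\<^sup>2" by (simp add: power_mult_distrib)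
    qed
  qed auto
  then have "(\<lambda>n. sqrt (LINT x|lebesgue. (g x - f n x)\<^sup>2)) \<longlonglongrightarrow> sqrt 0" by (intro tendsto_real_sqrt) simp
  then show "(\<lambda>n. L2_norm UNIV (\<lambda>x. g x - f n x)) \<longlonglongrightarrow> 0" by (simp add: L2_norm_def lebesgue_on_UNIV_eq)
qed

text \<open>The radius of the approximants is strictly below r, which keeps their supports inside
  the open ball. This set is a linear space closed under dominated pointwise limits, which is what
  the density argument uses.\<close>

definition bump_closure :: "'a::euclidean_space \<Rightarrow> real \<Rightarrow> ('a \<Rightarrow> real) set" where
  "bump_closure c r = {g \<in> L2 UNIV. \<forall>e>0. \<exists>f \<rho>. \<rho> < r \<and> f \<in> bump_space c \<rho> \<and> L2_norm UNIV (\<lambda>x. g x - f x) < e}"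

lemma bump_closure_I:
  assumes "f \<in> bump_space c \<rho>" "\<rho> < r" shows "f \<in> bump_closure c r"
  unfolding bump_closure_def
proof (safe intro!: bump_space_L2[OF assms(1)])
  fix e :: real assume "0 < e"
  then show "\<exists>h \<rho>. \<rho> < r \<and> h \<in> bump_space c \<rho> \<and> L2_norm UNIV (\<lambda>x. f x - h x) < e"
    using assms by (intro exI[of _ f] exI[of _ \<rho>]) (simp add: L2_norm_def)
qed

lemma bump_closure_E:
  assumes "g \<in> bump_closure c r" "0 < e"
  obtains f \<rho> where "\<rho> < r" "f \<in> bump_space c \<rho>" "L2_norm UNIV (\<lambda>x. g x - f x) < e"
  using assms unfolding bump_closure_def by auto

lemma bump_closure_L2: "f \<in> bump_closure c r \<Longrightarrow> f \<in> L2 UNIV"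
  by (simp add: bump_closure_def)

lemma bump_closure_zero: "0 < r \<Longrightarrow> (\<lambda>x. 0) \<in> bump_closure c r"
  by (rule bump_closure_I[OF bump_space_zero])

lemma bump_closure_add:
  assumes "f \<in> bump_closure c r" "g \<in> bump_closure c r"
  shows "(\<lambda>x. f x + g x) \<in> bump_closure c r"
  unfolding bump_closure_def
proof (safe intro!: L2_add bump_closure_L2[OF assms(1)] bump_closure_L2[OF assms(2)])
  fix e :: real assume "0 < e"
  then obtain f' \<rho> where f': "\<rho> < r" "f' \<in> bump_space c \<rho>" "L2_norm UNIV (\<lambda>x. f x - f' x) < e / 2"
    by (metis bump_closure_E[OF assms(1)] half_gt_zero)
  from \<open>0 < e\<close> obtain g' \<rho>' where g': "\<rho>' < r" "g' \<in> bump_space c \<rho>'" "L2_norm UNIV (\<lambda>x. g x - g' x) < e / 2"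
    by (metis bump_closure_E[OF assms(2)] half_gt_zero)
  have "L2_norm UNIV (\<lambda>x. (f x - f' x) + (g x - g' x)) \<le> L2_norm UNIV (\<lambda>x. f x - f' x) + L2_norm UNIV (\<lambda>x. g x - g' x)"
    by (intro L2_norm_triangle L2_diff bump_closure_L2[OF assms(1)] bump_closure_L2[OF assms(2)] bump_space_L2[OF f'(2)] bump_space_L2[OF g'(2)])
  then have "L2_norm UNIV (\<lambda>x. f x + g x - (f' x + g' x)) < e" using f'(3) g'(3) by (simp add: algebra_simps)
  moreover have "(\<lambda>x. f' x + g' x) \<in> bump_space c (max \<rho> \<rho>')"
    by (intro bump_space_add bump_space_mono[OF f'(2)] bump_space_mono[OF g'(2)]) auto
  ultimately show "\<exists>h \<rho>. \<rho> < r \<and> h \<in> bump_space c \<rho> \<and> L2_norm UNIV (\<lambda>x. f x + g x - h x) < e"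
    using f'(1) g'(1) by (intro exI[of _ "\<lambda>x. f' x + g' x"] exI[of _ "max \<rho> \<rho>'"]) auto
qed

lemma bump_closure_cmult:
  assumes "f \<in> bump_closure c r" shows "(\<lambda>x. a * f x) \<in> bump_closure c r"
  unfolding bump_closure_def
proof (safe intro!: L2_cmult bump_closure_L2[OF assms])
  fix e :: real assume "0 < e"
  then have "0 < e / (\<bar>a\<bar> + 1)" by simp
  then obtain f' \<rho> where f': "\<rho> < r" "f' \<in> bump_space c \<rho>" "L2_norm UNIV (\<lambda>x. f x - f' x) < e / (\<bar>a\<bar> + 1)"
    by (metis bump_closure_E[OF assms])
  have "L2_norm UNIV (\<lambda>x. a * f x - a * f' x) = \<bar>a\<bar> * L2_norm UNIV (\<lambda>x. f x - f' x)"
    unfolding right_diff_distrib[symmetric] by (rule L2_norm_cmult)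
  also have "\<dots> \<le> (\<bar>a\<bar> + 1) * L2_norm UNIV (\<lambda>x. f x - f' x)" by (intro mult_right_mono) auto
  also have "\<dots> < e" using f'(3) by (simp add: pos_less_divide_eq mult.commute)
  finally show "\<exists>h \<rho>. \<rho> < r \<and> h \<in> bump_space c \<rho> \<and> L2_norm UNIV (\<lambda>x. a * f x - h x) < e"
    using f' by (intro exI[of _ "\<lambda>x. a * f' x"] exI[of _ \<rho>]) (auto intro: bump_space_cmult)
qed

lemma bump_closure_diff:
  "f \<in> bump_closure c r \<Longrightarrow> g \<in> bump_closure c r \<Longrightarrow> (\<lambda>x. f x - g x) \<in> bump_closure c r"
  using bump_closure_add[of f c r "\<lambda>x. -1 * g x"] bump_closure_cmult[of g c r "-1"] by simp

lemma bump_closure_sum: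
  "0 < r \<Longrightarrow> (\<And>i. i \<in> I \<Longrightarrow> f i \<in> bump_closure c r) \<Longrightarrow> (\<lambda>x. \<Sum>i\<in>I. f i x) \<in> bump_closure c r"
  by (induction I rule: infinite_finite_induct) (simp_all add: bump_closure_add bump_closure_zero)

lemma bump_closure_limit:
  assumes f: "\<And>n. f n \<in> bump_closure c r" and g: "g \<in> borel_measurable lebesgue"
    and lim: "\<And>x. (\<lambda>n. f n x) \<longlonglongrightarrow> g x"
    and w: "w \<in> L2 UNIV" and bound: "\<And>n x. \<bar>f n x\<bar> \<le> w x"
  shows "g \<in> bump_closure c r"
proof -
  have fm: "f n \<in> borel_measurable lebesgue" for n
    using L2_D(1)[OF bump_closure_L2[OF f]] by (simp add: lebesgue_on_UNIV_eq)
  note dc = L2_dominated_convergence[OF fm g lim w bound]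
  show ?thesis unfolding bump_closure_def
  proof (safe intro!: dc(2))
    fix e :: real assume "0 < e"
    then have "eventually (\<lambda>n. L2_norm UNIV (\<lambda>x. g x - f n x) < e / 2) sequentially"
      by (intro order_tendstoD(2)[OF dc(3)]) simp
    then obtain n where n: "L2_norm UNIV (\<lambda>x. g x - f n x) < e / 2" by (auto simp: eventually_sequentially)
    from \<open>0 < e\<close> obtain f' \<rho> where f': "\<rho> < r" "f' \<in> bump_space c \<rho>" "L2_norm UNIV (\<lambda>x. f n x - f' x) < e / 2"
      by (metis bump_closure_E[OF f] half_gt_zero)
    have "L2_norm UNIV (\<lambda>x. (g x - f n x) + (f n x - f' x)) \<le> L2_norm UNIV (\<lambda>x. g x - f n x) + L2_norm UNIV (\<lambda>x. f n x - f' x)"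
      by (intro L2_norm_triangle L2_diff dc bump_space_L2[OF f'(2)])
    then have "L2_norm UNIV (\<lambda>x. g x - f' x) < e" using n f'(3) by simp
    then show "\<exists>h \<rho>. \<rho> < r \<and> h \<in> bump_space c \<rho> \<and> L2_norm UNIV (\<lambda>x. g x - h x) < e" using f' by blast
  qed
qed

lemma indicator_ball_L2: "indicator (ball c r) \<in> L2 UNIV"
proof -
  have "integrable lebesgue (indicat_real (ball c r))"
    by (intro integrable_real_indicator) (auto intro: emeasure_bounded_finite[unfolded infinity_ennreal_def])
  moreover have "(indicat_real (ball c r) x)\<^sup>2 = indicat_real (ball c r) x" for x by (simp add: indicator_def)
  ultimately show ?thesis by (simp add: L2_def lebesgue_on_UNIV_eq)
qed

lemma indicator_ball_closure:
  assumes r: "0 < r" shows "indicator (ball c r \<inter> box a b) \<in> bump_closure c r"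
proof (rule bump_closure_limit[OF _ _ _ indicator_ball_L2[of c r]])
  fix n x
  let ?f = "\<lambda>n x. ball_cutoff c r n x * box_cutoff a b n x"
  have supp: "dist c x \<le> r * (1 - inverse (real (Suc (Suc n))))" if "?f n x \<noteq> 0" for x n
    using that by (intro ball_cutoff_support[OF r]) auto
  show "?f n \<in> bump_closure c r"
  proof (rule bump_closure_I)
    have "smooth_on UNIV (?f n)" by (intro flat_algebra_smooth flat_algebra.mult cutoff_flat_algebra)
    then show "?f n \<in> bump_space c (r * (1 - inverse (real (Suc (Suc n)))))"
      using supp by (auto simp: bump_space_def)
    show "r * (1 - inverse (real (Suc (Suc n)))) < r" using r by (simp add: field_simps)
  qed
  show "(\<lambda>n. ?f n x) \<longlonglongrightarrow> indicator (ball c r \<inter> box a b) x"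
    unfolding indicator_inter_arith by (intro tendsto_mult ball_cutoff_limit[OF r] box_cutoff_limit)
  show "\<bar>?f n x\<bar> \<le> indicator (ball c r) x"
  proof (cases "x \<in> ball c r")
    case True
    then show ?thesis using cutoff_bounds(1,2)[of c r n x] cutoff_bounds(3,4)[of a b n x] by (simp add: abs_mult mult_le_one)
  next
    case False
    then have "ball_cutoff c r n x = 0" using ball_cutoff_support[OF r, of c n x] by force
    then show ?thesis by simp
  qed
  show "indicat_real (ball c r \<inter> box a b) \<in> borel_measurable lebesgue"
    by (intro borel_measurable_indicator) auto
qed

text \<open>Dynkin's argument: open boxes form an intersection-stable generator of the Borel sets.
  Complements are differences from the indicator of the ball, and countable disjoint unions are
  limits of partial sums.\<close>

lemma indicator_borel_closure:
  fixes c :: "'a::euclidean_space"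
  assumes r: "0 < r" and A: "A \<in> sets borel"
  shows "indicator (ball c r \<inter> A) \<in> bump_closure c r"
proof -
  let ?G = "range (\<lambda>(a, b). box a b :: 'a set)"
  have "Int_stable ?G"
  proof (rule Int_stableI)
    fix X Y assume "X \<in> ?G" "Y \<in> ?G"
    then obtain a b c d where "X = box a b" "Y = box c d" by auto
    then show "X \<inter> Y \<in> ?G" by (auto simp: box_Int_box)
  qed
  moreover have "?G \<subseteq> Pow UNIV" by simp
  moreover have "A \<in> sigma_sets UNIV ?G"
    using A unfolding borel_eq_box by (simp add: sets_measure_of)
  ultimately show ?thesis
  proof (induction rule: sigma_sets_induct_disjoint)
    case (basic X)
    then show ?case using indicator_ball_closure[OF r] by auto
  next
    case empty
    then show ?case using bump_closure_zero[OF r] by (simp add: indicator_def[abs_def])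
  next
    case (compl X)
    have ball: "indicator (ball c r) \<in> bump_closure c r"
    proof (rule bump_closure_limit[OF _ _ _ indicator_ball_L2[of c r]])
      fix n x
      show "ball_cutoff c r n \<in> bump_closure c r"
        by (rule bump_closure_I[OF ball_cutoff_bump_space[OF r]]) (use r in \<open>simp add: field_simps\<close>)
      show "(\<lambda>n. ball_cutoff c r n x) \<longlonglongrightarrow> indicator (ball c r) x" by (rule ball_cutoff_limit[OF r])
      show "\<bar>ball_cutoff c r n x\<bar> \<le> indicator (ball c r) x"
        using cutoff_bounds(1,2)[of c r n x] ball_cutoff_support[OF r, of c n x]
        by (cases "x \<in> ball c r") force+
      show "indicat_real (ball c r) \<in> borel_measurable lebesgue" by (intro borel_measurable_indicator) auto
    qed
    have "indicator (ball c r \<inter> (UNIV - X)) = (\<lambda>x. indicator (ball c r) x - indicat_real (ball c r \<inter> X) x)"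
      by (auto simp: indicator_def fun_eq_iff)
    then show ?case using bump_closure_diff[OF ball compl.IH] by simp
  next
    case (union X)
    show ?case
    proof (rule bump_closure_limit[OF _ _ _ indicator_ball_L2[of c r]])
      fix n x
      have Xb: "X i \<in> sets borel" for i
        using union.hyps(2) unfolding borel_eq_box by (auto simp: sets_measure_of)
      show "(\<lambda>x. \<Sum>i<n. indicator (ball c r \<inter> X i) x) \<in> bump_closure c r"
        by (rule bump_closure_sum[OF r union.IH])
      \<comment> \<open>Disjointness makes the partial sum an indicator again, hence dominated by
        the indicator of the ball.\<close>
      have part: "(\<Sum>i<n. indicat_real (ball c r \<inter> X i) x) = indicator (ball c r \<inter> (\<Union>i<n. X i)) x" for n x
      proof -
        have "indicat_real (\<Union>i<n. X i) x = (\<Sum>i<n. indicator (X i) x)"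
          using union.hyps(1) by (intro indicator_UN_disjoint) (auto simp: disjoint_family_on_def)
        then show ?thesis by (simp add: indicator_inter_arith sum_distrib_left)
      qed
      show "(\<lambda>n. \<Sum>i<n. indicat_real (ball c r \<inter> X i) x) \<longlonglongrightarrow> indicator (ball c r \<inter> (\<Union>i. X i)) x"
        unfolding part
      proof (cases "x \<in> (\<Union>i. X i)")
        case True
        then obtain j where j: "x \<in> X j" by blast
        show "(\<lambda>n. indicat_real (ball c r \<inter> (\<Union>i<n. X i)) x) \<longlonglongrightarrow> indicator (ball c r \<inter> (\<Union>i. X i)) x"
          by (rule tendsto_eventually, rule eventually_mono[OF eventually_gt_at_top[of j]]) (use j in \<open>auto simp: indicator_def\<close>)
      qed (auto simp: indicator_def)
      show "\<bar>\<Sum>i<n. indicat_real (ball c r \<inter> X i) x\<bar> \<le> indicator (ball c r) x"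
        unfolding part by (auto simp: indicator_def)
      show "indicat_real (ball c r \<inter> (\<Union>i. X i)) \<in> borel_measurable lebesgue"
        using Xb by (intro borel_measurable_indicator) (auto intro!: sets.Int sets.countable_UN)
    qed
  qed
qed

lemma L2_abs: "f \<in> L2 S \<Longrightarrow> (\<lambda>x. \<bar>f x\<bar>) \<in> L2 S"
  by (auto simp: L2_def)

text \<open>After passing to a Borel representative that vanishes off the ball, simple functions
  dominated by twice that representative converge to it. The domination forces them to vanish off
  the ball too, so they are combinations of the indicators already treated.\<close>

lemma bump_dense:
  fixes c :: "'a::euclidean_space"
  assumes r: "0 < r" and w: "w \<in> L2 UNIV" and supp: "\<And>x. x \<notin> ball c r \<Longrightarrow> w x = 0"
  shows "w \<in> bump_closure c r"
proof -
  have wm: "w \<in> borel_measurable lebesgue" using L2_D(1)[OF w] by (simp add: lebesgue_on_UNIV_eq)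
  obtain w' where w'm: "w' \<in> borel_measurable lborel" and ae: "AE x in lborel. w x = w' x"
    using completion_ex_borel_measurable_real[OF wm] by blast
  let ?v = "\<lambda>x. indicator (ball c r) x * w' x"
  have vm: "?v \<in> borel_measurable borel" using w'm by (intro borel_measurable_times borel_measurable_indicator) auto
  have ae': "AE x in lebesgue. w x = ?v x"
    using AE_completion[OF ae] by eventually_elim (use supp in \<open>auto simp: indicator_def\<close>)
  have vm': "?v \<in> borel_measurable lebesgue" using vm by (intro measurable_completion) simp
  have vL2: "?v \<in> L2 UNIV"
  proof -
    have "integrable lebesgue (\<lambda>x. (?v x)\<^sup>2) \<longleftrightarrow> integrable lebesgue (\<lambda>x. (w x)\<^sup>2)"
      using ae' vm' wm by (intro integrable_cong_AE) auto
    then show ?thesis using vm' L2_D(2)[OF w] by (simp add: L2_def lebesgue_on_UNIV_eq)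
  qed
  obtain F where F: "\<And>i. simple_function borel (F i)" "\<And>x. (\<lambda>i. F i x) \<longlonglongrightarrow> ?v x" "\<And>i x. dist (F i x) 0 \<le> 2 * dist (?v x) 0"
    using borel_measurable_implies_sequence_metric[OF vm, of 0] by auto
  have Fcl: "F i \<in> bump_closure c r" for i
  proof -
    have rep: "F i x = (\<Sum>y\<in>F i ` UNIV. y * indicator (ball c r \<inter> (F i -` {y})) x)" for x
    proof (cases "x \<in> ball c r")
      case True
      have "F i x = (\<Sum>y\<in>F i ` space borel. indicator (F i -` {y} \<inter> space borel) x *\<^sub>R y)"
        by (rule simple_function_indicator_representation_banach[OF F(1)]) simp
      also have "\<dots> = (\<Sum>y\<in>F i ` UNIV. y * indicator (ball c r \<inter> (F i -` {y})) x)"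
        by (rule sum.cong) (use True in \<open>auto simp: indicator_def\<close>)
      finally show ?thesis .
    next
      case False
      then show ?thesis using F(3)[of i x] by (simp add: indicator_inter_arith)
    qed
    have "(\<lambda>x. \<Sum>y\<in>F i ` UNIV. y * indicator (ball c r \<inter> (F i -` {y})) x) \<in> bump_closure c r"
    proof (intro bump_closure_sum[OF r] bump_closure_cmult indicator_borel_closure[OF r])
      fix y assume "y \<in> F i ` UNIV"
      show "F i -` {y} \<in> sets borel" using simple_functionD(2)[OF F(1)] by (metis Int_UNIV_right space_borel)
    qed
    then show ?thesis unfolding rep[symmetric] .
  qed
  have v_cl: "?v \<in> bump_closure c r"
  proof (rule bump_closure_limit[OF Fcl vm' F(2)])
    show "(\<lambda>x. 2 * \<bar>?v x\<bar>) \<in> L2 UNIV"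
      by (intro L2_cmult L2_abs vL2)
    show "\<bar>F n x\<bar> \<le> 2 * \<bar>?v x\<bar>" for n x using F(3)[of n x] by simp
  qed
  show ?thesis unfolding bump_closure_def
  proof (safe intro!: w)
    fix e :: real assume "0 < e"
    then obtain f \<rho> where f: "\<rho> < r" "f \<in> bump_space c \<rho>" "L2_norm UNIV (\<lambda>x. ?v x - f x) < e"
      by (metis bump_closure_E[OF v_cl])
    have [measurable]: "f \<in> borel_measurable lebesgue" by (rule bump_space_lebesgue_measurable[OF f(2)])
    have "L2_norm UNIV (\<lambda>x. w x - f x) = L2_norm UNIV (\<lambda>x. ?v x - f x)"
      unfolding L2_norm_def lebesgue_on_UNIV_eq
      by (intro arg_cong[where f=sqrt] integral_cong_AE) (use wm vm' ae' in auto)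
    then show "\<exists>h \<rho>. \<rho> < r \<and> h \<in> bump_space c \<rho> \<and> L2_norm UNIV (\<lambda>x. w x - h x) < e" using f by force
  qed
qed

text \<open>The extremal test function would be \<open>w\<close> itself cut off to the ball; it is
  replaced by a smooth approximant f, so that the squared norm is, up to a small error, the pairing
  of \<open>w\<close> with f, at most C |f|.\<close>

lemma L2_norm_ball_duality:
  fixes w :: "'a::euclidean_space \<Rightarrow> real"
  assumes r: "0 < r" and w: "w \<in> L2 UNIV" and "0 \<le> C"
    and dual: "\<And>f \<rho>. \<rho> < r \<Longrightarrow> f \<in> bump_space c \<rho> \<Longrightarrow> \<bar>LINT x|lebesgue. w x * f x\<bar> \<le> C * L2_norm UNIV f"
  shows "L2_norm (ball c r) w \<le> C"
proof -
  let ?w = "\<lambda>x. if x \<in> ball c r then w x else 0"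
  let ?n = "L2_norm UNIV ?w"
  have w0: "?w \<in> L2 UNIV" using L2_norm_mono(1)[OF w, of "ball c r"] L2_restrict[of "ball c r" w] by simp
  have cl: "?w \<in> bump_closure c r" by (rule bump_dense[OF r w0]) auto
  have "?n\<^sup>2 \<le> C * ?n + e" if "0 < e" for e
  proof -
    \<comment> \<open>The accuracy d produces the error d (|w| + C), which is at most e; the summand
      1 keeps the denominator positive.\<close>
    define d where "d = e / (?n + C + 1)"
    have "0 < ?n + C + 1" using L2_norm_nonneg[of UNIV ?w] \<open>0 \<le> C\<close> by linarith
    then have "0 < d" "d * (?n + C + 1) = e" using that by (auto simp: d_def)
    obtain f \<rho> where f: "\<rho> < r" "f \<in> bump_space c \<rho>" "L2_norm UNIV (\<lambda>x. ?w x - f x) < d"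
      using bump_closure_E[OF cl \<open>0 < d\<close>] by blast
    have fL: "f \<in> L2 UNIV" by (rule bump_space_L2[OF f(2)])
    have dL: "(\<lambda>x. ?w x - f x) \<in> L2 UNIV" by (rule L2_diff[OF w0 fL])
    have "?n\<^sup>2 = (LINT x|lebesgue. ?w x * (?w x - f x) + ?w x * f x)"
      unfolding L2_norm_power2 lebesgue_on_UNIV_eq
      by (rule Bochner_Integration.integral_cong) (auto simp: power2_eq_square algebra_simps)
    also have "\<dots> = (LINT x|lebesgue. ?w x * (?w x - f x)) + (LINT x|lebesgue. ?w x * f x)"
      by (rule Bochner_Integration.integral_add)
         (use L2_mult_integrable[OF w0 dL] L2_mult_integrable[OF w0 fL] in \<open>simp_all only: lebesgue_on_UNIV_eq\<close>)
    also have "(LINT x|lebesgue. ?w x * f x) = (LINT x|lebesgue. w x * f x)"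
      by (rule Bochner_Integration.integral_cong) (use f(1,2) in \<open>auto simp: bump_space_def\<close>)
    also have "(LINT x|lebesgue. ?w x * (?w x - f x)) + (LINT x|lebesgue. w x * f x) \<le> ?n * L2_norm UNIV (\<lambda>x. ?w x - f x) + C * L2_norm UNIV f"
      using L2_Cauchy_Schwarz[OF w0 dL] dual[OF f(1,2)] unfolding lebesgue_on_UNIV_eq by linarith
    also have "\<dots> \<le> ?n * d + C * (?n + d)"
    proof (intro add_mono mult_left_mono)
      have "L2_norm UNIV (\<lambda>x. ?w x - (?w x - f x)) \<le> ?n + L2_norm UNIV (\<lambda>x. ?w x - f x)" by (rule L2_norm_diff[OF w0 dL])
      then show "L2_norm UNIV f \<le> ?n + d" using f(3) by simp
    qed (use f(3) \<open>0 \<le> C\<close> in auto)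
    also have "\<dots> = C * ?n + d * (?n + C)" by (simp add: algebra_simps)
    also have "\<dots> \<le> C * ?n + e"
    proof -
      have "d * (?n + C) \<le> d * (?n + C + 1)" using \<open>0 < d\<close> by (intro mult_left_mono) auto
      then show ?thesis using \<open>d * (?n + C + 1) = e\<close> by linarith
    qed
    finally show ?thesis .
  qed
  then have "?n * ?n \<le> C * ?n" unfolding power2_eq_square[symmetric] by (rule field_le_epsilon)
  then have "?n \<le> C" using L2_norm_nonneg[of UNIV ?w] \<open>0 \<le> C\<close> by (cases "?n = 0") (auto simp: mult_le_cancel_right)
  then show ?thesis using L2_norm_restrict[of "ball c r" w] by simp
qed

section \<open>Weak derivatives and the dual norm\<close>

lemma test_functions_bump_space:
  assumes "\<phi> \<in> test_functions \<Omega>" obtains r where "\<phi> \<in> bump_space 0 r"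
proof -
  have "bounded (supp_in UNIV \<phi>)" using assms by (auto simp: test_functions_def intro: compact_imp_bounded)
  then obtain r where r: "\<And>x. x \<in> supp_in UNIV \<phi> \<Longrightarrow> norm x \<le> r" by (auto simp: bounded_iff)
  have "x \<in> supp_in UNIV \<phi>" if "\<phi> x \<noteq> 0" for x
    using that closure_subset[of "{x. \<phi> x \<noteq> 0}"] by (auto simp: supp_in_def)
  then show thesis using that[of r] r assms by (auto simp: bump_space_def test_functions_def)
qed

lemma bump_space_supp:
  assumes "f \<in> bump_space c r" shows "supp_in A f \<subseteq> cball c r"
  unfolding supp_in_def by (rule closure_minimal) (use assms in \<open>auto simp: bump_space_def\<close>)

lemma bump_space_test_functions:
  assumes "f \<in> bump_space c r" "cball c r \<subseteq> \<Omega>" shows "f \<in> test_functions \<Omega>"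
proof -
  have "compact (cball c r \<inter> supp_in UNIV f)" by (rule compact_Int_closed) (auto simp: supp_in_def)
  then have "compact (supp_in UNIV f)" using bump_space_supp[OF assms(1), of UNIV] by (simp add: Int_absorb1)
  then show ?thesis
    using assms bump_space_supp[OF assms(1), of UNIV] by (auto simp: test_functions_def bump_space_def)
qed

lemma test_functions_partials:
  assumes "\<phi> \<in> test_functions \<Omega>" "set bs \<subseteq> Basis" shows "partials bs \<phi> \<in> test_functions \<Omega>"
  using assms(2)
proof (induction bs)
  case (Cons b bs)
  let ?f = "partials bs \<phi>"
  have f: "?f \<in> test_functions \<Omega>" using Cons by simp
  let ?K = "supp_in UNIV ?f"
  have zero: "partials (b # bs) \<phi> x = 0" if "x \<notin> ?K" for x
  proof -
    have "(?f has_derivative (\<lambda>_. 0)) (at x)"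
    proof (rule has_derivative_transform_within_open[of "\<lambda>_. 0" "\<lambda>_. 0" x UNIV "- ?K"])
      show "open (- ?K)" unfolding supp_in_def by (rule open_Compl[OF closed_closure])
      show "0 = ?f y" if "y \<in> - ?K" for y
        using that closure_subset[of "{x. ?f x \<noteq> 0}"] by (auto simp: supp_in_def)
    qed (use that in auto)
    from frechet_derivative_at[OF this] show ?thesis by (simp add: partials.simps(2) fun_eq_iff)
  qed
  have sub: "supp_in UNIV (partials (b # bs) \<phi>) \<subseteq> ?K"
    unfolding supp_in_def[of UNIV "partials (b # bs) \<phi>"] by (rule closure_minimal) (use zero in \<open>auto simp: supp_in_def\<close>)
  have "compact (?K \<inter> supp_in UNIV (partials (b # bs) \<phi>))"
    using f by (intro compact_Int_closed) (auto simp: supp_in_def test_functions_def)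
  then have "compact (supp_in UNIV (partials (b # bs) \<phi>))" using sub by (simp add: Int_absorb1)
  moreover have "smooth_on UNIV (partials (b # bs) \<phi>)"
    using assms(1) Cons.prems by (intro smooth_on_partials) (auto simp: test_functions_def)
  ultimately show ?case using sub f by (auto simp: test_functions_def)
qed (use assms in simp)

lemma test_functions_zero: "\<phi> \<in> test_functions \<Omega> \<Longrightarrow> x \<notin> supp_in UNIV \<phi> \<Longrightarrow> \<phi> x = 0"
  using closure_subset[of "{x. \<phi> x \<noteq> 0}"] by (auto simp: supp_in_def)

lemma zero_extension_continuous:
  fixes g :: "'a::euclidean_space \<Rightarrow> real"
  assumes "continuous_on \<Omega> g" "open \<Omega>" "closed K" "K \<subseteq> \<Omega>" "\<And>x. x \<in> \<Omega> - K \<Longrightarrow> g x = 0"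
  shows "continuous_on UNIV (\<lambda>x. if x \<in> \<Omega> then g x else 0)"
proof -
  let ?f = "\<lambda>x. if x \<in> \<Omega> then g x else 0"
  have "continuous_on \<Omega> ?f" using assms(1) by (simp cong: continuous_on_cong_simp)
  moreover have "continuous_on (- K) ?f"
    by (rule continuous_on_eq[of _ "\<lambda>_. 0"]) (use assms in auto)
  ultimately have "continuous_on (\<Omega> \<union> - K) ?f" using assms by (intro continuous_on_open_Un) auto
  moreover have "\<Omega> \<union> - K = UNIV" using assms by auto
  ultimately show ?thesis by simp
qed

lemma lebesgue_on_integral_zero_extension:
  assumes "open \<Omega>"
  shows "(LINT x|lebesgue_on \<Omega>. h x) = (LINT x|lebesgue. (if x \<in> \<Omega> then h x else (0::real)))"
  using Lebesgue_Measure.integral_restrict_UNIV[of \<Omega> h] assms by simp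

context
  fixes \<Omega> :: "'a::euclidean_space set" and u \<phi> :: "'a \<Rightarrow> real"
  assumes \<Omega>: "open \<Omega>" and u: "continuous_on \<Omega> u" and \<phi>: "\<phi> \<in> test_functions \<Omega>"
begin

lemma test_product_continuous: "continuous_on UNIV (\<lambda>x. if x \<in> \<Omega> then u x * \<phi> x else 0)"
proof (rule zero_extension_continuous[OF _ \<Omega>])
  obtain r where "\<phi> \<in> bump_space 0 r" using test_functions_bump_space[OF \<phi>] .
  then show "continuous_on \<Omega> (\<lambda>x. u x * \<phi> x)" by (intro continuous_intros u bump_space_continuous)
  show "closed (supp_in UNIV \<phi>)" by (simp add: supp_in_def)
  show "supp_in UNIV \<phi> \<subseteq> \<Omega>" using \<phi> by (simp add: test_functions_def)
qed (use test_functions_zero[OF \<phi>] in auto)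

lemma test_product_integrable: "integrable lborel (\<lambda>x. if x \<in> \<Omega> then u x * \<phi> x else 0)"
proof -
  obtain r where "\<phi> \<in> bump_space 0 r" using test_functions_bump_space[OF \<phi>] .
  then show ?thesis
    by (intro compact_support_integrable[OF test_product_continuous, of 0 r]) (auto simp: bump_space_def split: if_splits)
qed

lemma test_product_lebesgue:
  "integrable (lebesgue_on \<Omega>) (\<lambda>x. u x * \<phi> x)"
  "(LINT x|lebesgue_on \<Omega>. u x * \<phi> x) = (LINT x|lborel. (if x \<in> \<Omega> then u x * \<phi> x else 0))"
proof -
  have m: "(\<lambda>x. if x \<in> \<Omega> then u x * \<phi> x else 0) \<in> borel_measurable lborel"
    using borel_measurable_continuous_onI[OF test_product_continuous] by simp
  have "integrable lebesgue (\<lambda>x. if x \<in> \<Omega> then u x * \<phi> x else 0)"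
    using test_product_integrable integrable_completion[OF m] by simp
  then show "integrable (lebesgue_on \<Omega>) (\<lambda>x. u x * \<phi> x)"
    using Lebesgue_Measure.integrable_restrict_UNIV[of \<Omega> "\<lambda>x. u x * \<phi> x"] \<Omega> by simp
  show "(LINT x|lebesgue_on \<Omega>. u x * \<phi> x) = (LINT x|lborel. (if x \<in> \<Omega> then u x * \<phi> x else 0))"
    unfolding lebesgue_on_integral_zero_extension[OF \<Omega>] by (rule integral_completion[OF m])
qed

end

text \<open>\<open>u\<close> is controlled only inside \<Omega>, but its product with a test
  function, extended by zero, is differentiable everywhere with compact support, so its directional
  derivative integrates to zero.\<close>

lemma test_integral_by_parts:
  fixes u :: "'a::euclidean_space \<Rightarrow> real"
  assumes \<Omega>: "open \<Omega>" and u: "smooth_on \<Omega> u" and \<phi>: "\<phi> \<in> test_functions \<Omega>" and b: "b \<in> Basis"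
  shows "(LINT x|lebesgue_on \<Omega>. u x * partials [b] \<phi> x) = - (LINT x|lebesgue_on \<Omega>. partials [b] u x * \<phi> x)"
proof -
  obtain r where r: "\<phi> \<in> bump_space 0 r" using test_functions_bump_space[OF \<phi>] .
  have uc: "continuous_on \<Omega> u" using smooth_on_continuous[OF u, of "[]"] by simp
  have ubc: "continuous_on \<Omega> (partials [b] u)" using smooth_on_continuous[OF u, of "[b]"] b by simp
  have \<phi>b: "partials [b] \<phi> \<in> test_functions \<Omega>" using test_functions_partials[OF \<phi>, of "[b]"] b by simp
  let ?f = "\<lambda>x. if x \<in> \<Omega> then u x * \<phi> x else 0"
  let ?E = "\<lambda>x h. u x * (\<Sum>b\<in>Basis. (h \<bullet> b) * partials [b] \<phi> x) + (\<Sum>b\<in>Basis. (h \<bullet> b) * partials [b] u x) * \<phi> x"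
  let ?D = "\<lambda>x h. if x \<in> \<Omega> then ?E x h else 0"
  let ?g1 = "\<lambda>x. if x \<in> \<Omega> then u x * partials [b] \<phi> x else 0" and ?g2 = "\<lambda>x. if x \<in> \<Omega> then partials [b] u x * \<phi> x else 0"
  have Db: "?D x b = ?g1 x + ?g2 x" for x
    unfolding sum_Basis_delta[OF b] by simp
  have D: "(?f has_derivative ?D x) (at x)" for x
  proof (cases "x \<in> \<Omega>")
    case True
    have "((\<lambda>x. u x * \<phi> x) has_derivative ?E x) (at x)"
      by (rule has_derivative_mult[OF smooth_on_has_derivative[OF u \<Omega> True] bump_space_has_derivative[OF r]])
    then have "(?f has_derivative ?E x) (at x)"
      by (rule has_derivative_transform_within_open[OF _ \<Omega> True]) simp
    then show ?thesis using True by simp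
  next
    case False
    let ?K = "supp_in UNIV \<phi>"
    have "(?f has_derivative (\<lambda>_. 0)) (at x)"
    proof (rule has_derivative_transform_within_open[of "\<lambda>_. 0" "\<lambda>_. 0" x UNIV "- ?K"])
      show "open (- ?K)" unfolding supp_in_def by (rule open_Compl[OF closed_closure])
      show "x \<in> - ?K" using False \<phi> by (auto simp: test_functions_def)
    qed (use test_functions_zero[OF \<phi>] in auto)
    then show ?thesis using False by simp
  qed
  have "(LINT x|lborel. ?D x b) = 0"
  proof (rule integral_directional_derivative_zero[OF D, of b 0 r])
    show "continuous_on UNIV (\<lambda>x. ?D x b)"
      unfolding Db by (intro continuous_on_add test_product_continuous[OF \<Omega> uc \<phi>b] test_product_continuous[OF \<Omega> ubc \<phi>])
  qed (use r in \<open>auto simp: bump_space_def split: if_splits\<close>)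
  then have "(LINT x|lborel. ?g1 x) + (LINT x|lborel. ?g2 x) = 0"
    unfolding Db using test_product_integrable[OF \<Omega> uc \<phi>b] test_product_integrable[OF \<Omega> ubc \<phi>] by simp
  then show ?thesis
    using test_product_lebesgue(2)[OF \<Omega> uc \<phi>b] test_product_lebesgue(2)[OF \<Omega> ubc \<phi>] by linarith
qed

text \<open>The order of differentiation is reversed, so that no symmetry of higher derivatives is needed.\<close>

lemma smooth_is_weak_deriv:
  fixes u :: "'a::euclidean_space \<Rightarrow> real"
  assumes \<Omega>: "open \<Omega>" and "smooth_on \<Omega> u" and "set bs \<subseteq> Basis"
  shows "is_weak_deriv \<Omega> bs u (partials (rev bs) u)"
  using assms(2,3)
proof (induction bs arbitrary: u)
  case Nil
  then show ?case by (simp add: is_weak_deriv_def)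
next
  case (Cons b bs)
  have b: "b \<in> Basis" and bs: "set bs \<subseteq> Basis" using Cons.prems by auto
  have ub: "smooth_on \<Omega> (partials [b] u)" using Cons.prems b by (intro smooth_on_partials) auto
  show ?case unfolding is_weak_deriv_def
  proof
    fix \<phi> assume \<phi>: "\<phi> \<in> test_functions \<Omega>"
    have "(LINT x|lebesgue_on \<Omega>. u x * partials (b # bs) \<phi> x) = - (LINT x|lebesgue_on \<Omega>. partials [b] u x * partials bs \<phi> x)"
      using test_integral_by_parts[OF \<Omega> Cons.prems(1) test_functions_partials[OF \<phi> bs] b] partials_append[of "[b]" bs \<phi>] by simp
    also have "(LINT x|lebesgue_on \<Omega>. partials [b] u x * partials bs \<phi> x) =
        (- 1) ^ length bs * (LINT x|lebesgue_on \<Omega>. partials (rev bs) (partials [b] u) x * \<phi> x)"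
      using Cons.IH[OF ub bs] \<phi> by (simp add: is_weak_deriv_def)
    finally show "(LINT x|lebesgue_on \<Omega>. u x * partials (b # bs) \<phi> x) =
        (- 1) ^ length (b # bs) * (LINT x|lebesgue_on \<Omega>. partials (rev (b # bs)) u x * \<phi> x)"
      by (simp add: partials_append)
  qed
qed

text \<open>Duality with constant 0 on each closed ball inside \<Omega>, then a countable subcover
  by Lindelof. Square integrability is required only locally, because a classical derivative is at
  first merely continuous in \<Omega>.\<close>

lemma weakly_zero_imp_AE_zero:
  fixes g :: "'a::euclidean_space \<Rightarrow> real"
  assumes \<Omega>: "open \<Omega>" and g: "\<And>c r. cball c r \<subseteq> \<Omega> \<Longrightarrow> g \<in> L2 (ball c r)"
    and zero: "\<And>\<phi>. \<phi> \<in> test_functions \<Omega> \<Longrightarrow> (LINT x|lebesgue_on \<Omega>. g x * \<phi> x) = 0"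
  shows "AE x in lebesgue. x \<in> \<Omega> \<longrightarrow> g x = 0"
proof -
  have ball: "AE x in lebesgue. x \<in> ball c r \<longrightarrow> g x = 0" if r: "0 < r" and sub: "cball c r \<subseteq> \<Omega>" for c r
  proof -
    let ?w = "\<lambda>x. if x \<in> ball c r then g x else 0"
    have w: "?w \<in> L2 UNIV" using g[OF sub] L2_restrict[of "ball c r" g] by simp
    have "L2_norm (ball c r) ?w \<le> 0"
    proof (rule L2_norm_ball_duality[OF r w])
      fix f \<rho> assume \<rho>: "\<rho> < r" and f: "f \<in> bump_space c \<rho>"
      have "f \<in> test_functions \<Omega>"
        by (rule bump_space_test_functions[OF f]) (use \<rho> sub in auto)
      from zero[OF this] have "(LINT x|lebesgue. (if x \<in> \<Omega> then g x * f x else 0)) = 0"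
        unfolding lebesgue_on_integral_zero_extension[OF \<Omega>] .
      moreover have "(if x \<in> \<Omega> then g x * f x else 0) = ?w x * f x" for x
      proof (cases "f x = 0")
        case False
        then have "dist c x < r" using f \<rho> by (force simp: bump_space_def)
        moreover from this have "x \<in> \<Omega>" using sub by (intro subsetD[OF sub]) simp
        ultimately show ?thesis by simp
      qed simp
      ultimately show "\<bar>LINT x|lebesgue. ?w x * f x\<bar> \<le> 0 * L2_norm UNIV f" by simp
    qed simp
    then have "L2_norm (ball c r) ?w = 0" using L2_norm_nonneg[of "ball c r" ?w] by linarith
    moreover have "L2_norm (ball c r) ?w = L2_norm UNIV ?w"
      using L2_norm_restrict[of "ball c r" ?w] L2_norm_restrict[of "ball c r" g] by (simp add: if_distrib cong: if_cong)
    ultimately have "(LINT x|lebesgue. (?w x)\<^sup>2) = 0" by (simp add: L2_norm_def lebesgue_on_UNIV_eq)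
    moreover have "integrable lebesgue (\<lambda>x. (?w x)\<^sup>2)" using L2_D(2)[OF w] by (simp add: lebesgue_on_UNIV_eq)
    ultimately have "AE x in lebesgue. (?w x)\<^sup>2 = 0" by (subst (asm) integral_nonneg_eq_0_iff_AE) auto
    then show ?thesis by eventually_elim (auto split: if_splits)
  qed
  let ?F = "{ball c r | c r. 0 < r \<and> cball c r \<subseteq> \<Omega>}"
  have "\<Union>?F = \<Omega>"
  proof
    show "\<Union>?F \<subseteq> \<Omega>" using ball_subset_cball by fastforce
    show "\<Omega> \<subseteq> \<Union>?F"
    proof
      fix x assume "x \<in> \<Omega>"
      then obtain r where "0 < r" "cball x r \<subseteq> \<Omega>" using \<Omega> open_contains_cball by blast
      then show "x \<in> \<Union>?F" by (intro UnionI[of "ball x r"]) auto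
    qed
  qed
  moreover obtain F' where F': "F' \<subseteq> ?F" "countable F'" "\<Union>F' = \<Union>?F"
    by (rule Lindelof[of ?F]) auto
  ultimately have cover: "\<Union>F' = \<Omega>" by simp
  have "AE x in lebesgue. \<forall>S\<in>F'. x \<in> S \<longrightarrow> g x = 0"
    using F'(1) ball by (subst AE_ball_countable[OF F'(2)]) auto
  then show ?thesis by eventually_elim (use cover in blast)
qed

lemma continuous_on_L2_ball:
  fixes g :: "'a::euclidean_space \<Rightarrow> real"
  assumes "continuous_on (cball c r) g" shows "g \<in> L2 (ball c r)"
proof -
  obtain K where K: "\<And>x. x \<in> cball c r \<Longrightarrow> \<bar>g x\<bar> \<le> K"
    using compact_imp_bounded[OF compact_continuous_image[OF assms compact_cball]]
    unfolding bounded_iff by (metis imageI real_norm_def)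
  have m: "g \<in> borel_measurable (lebesgue_on (ball c r))"
    by (rule continuous_imp_measurable_on_sets_lebesgue[OF continuous_on_subset[OF assms]]) auto
  have fin: "finite_measure (lebesgue_on (ball c r))"
    by (rule finite_measure_lebesgue_on) (auto intro: lmeasurable_ball)
  have "integrable (lebesgue_on (ball c r)) (\<lambda>x. (g x)\<^sup>2)"
  proof (rule finite_measure.integrable_const_bound[OF fin, of _ "K\<^sup>2"])
    have "(g x)\<^sup>2 \<le> K\<^sup>2" if "x \<in> ball c r" for x
      using power_mono[OF K[of x], of 2] that by simp
    then show "AE x in lebesgue_on (ball c r). norm ((g x)\<^sup>2) \<le> K\<^sup>2" by (intro AE_I2) (simp add: space_restrict_space)
  qed (use m in auto)
  then show ?thesis using m by (simp add: L2_def)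
qed

lemma weak_deriv_spec:
  assumes "v \<in> H2 \<Omega>" "bs \<in> dirs2"
  shows "weak_deriv \<Omega> bs v \<in> L2 \<Omega>" "is_weak_deriv \<Omega> bs v (weak_deriv \<Omega> bs v)"
proof -
  have "\<exists>g. g \<in> L2 \<Omega> \<and> is_weak_deriv \<Omega> bs v g" using assms by (auto simp: H2_def)
  from someI_ex[OF this] show "weak_deriv \<Omega> bs v \<in> L2 \<Omega>" "is_weak_deriv \<Omega> bs v (weak_deriv \<Omega> bs v)"
    by (auto simp: weak_deriv_def)
qed

text \<open>\<open>weak_deriv\<close> is an arbitrary choice; here it is identified almost
  everywhere with a classical derivative, so that norms can be computed. The reversal is inherited
  from \<open>smooth_is_weak_deriv\<close>.\<close>

lemma weak_deriv_smooth:
  fixes v :: "'a::euclidean_space \<Rightarrow> real"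
  assumes \<Omega>: "open \<Omega>" and v: "smooth_on \<Omega> v" "v \<in> H2 \<Omega>" and bs: "bs \<in> dirs2"
  shows "partials (rev bs) v \<in> L2 \<Omega>" "L2_norm \<Omega> (weak_deriv \<Omega> bs v) = L2_norm \<Omega> (partials (rev bs) v)"
proof -
  let ?d = "weak_deriv \<Omega> bs v" and ?p = "partials (rev bs) v"
  have set: "set bs \<subseteq> Basis" using bs by (simp add: dirs2_def)
  have pc: "continuous_on \<Omega> ?p" using smooth_on_continuous[OF v(1)] set by simp
  have d: "?d \<in> L2 \<Omega>" by (rule weak_deriv_spec(1)[OF v(2) bs])
  have "AE x in lebesgue. x \<in> \<Omega> \<longrightarrow> ?d x - ?p x = 0"
  proof (rule weakly_zero_imp_AE_zero[OF \<Omega>])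
    fix c r assume sub: "cball c r \<subseteq> \<Omega>"
    have "?d \<in> L2 (ball c r)"
      by (rule L2_norm_mono(1)[OF d]) (use \<Omega> sub ball_subset_cball in auto)
    then show "(\<lambda>x. ?d x - ?p x) \<in> L2 (ball c r)"
      by (rule L2_diff[OF _ continuous_on_L2_ball[OF continuous_on_subset[OF pc sub]]])
  next
    fix \<phi> assume \<phi>: "\<phi> \<in> test_functions \<Omega>"
    obtain r where r: "\<phi> \<in> bump_space 0 r" using test_functions_bump_space[OF \<phi>] .
    have "\<phi> \<in> L2 \<Omega>" by (rule L2_norm_mono(1)[OF bump_space_L2[OF r]]) (use \<Omega> in auto)
    then have i1: "integrable (lebesgue_on \<Omega>) (\<lambda>x. ?d x * \<phi> x)" by (rule L2_mult_integrable[OF d])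
    have i2: "integrable (lebesgue_on \<Omega>) (\<lambda>x. ?p x * \<phi> x)" by (rule test_product_lebesgue(1)[OF \<Omega> pc \<phi>])
    have "(- 1) ^ length bs * (LINT x|lebesgue_on \<Omega>. ?d x * \<phi> x) = (- 1) ^ length bs * (LINT x|lebesgue_on \<Omega>. ?p x * \<phi> x)"
      using weak_deriv_spec(2)[OF v(2) bs] smooth_is_weak_deriv[OF \<Omega> v(1) set] \<phi> unfolding is_weak_deriv_def by metis
    then have "(LINT x|lebesgue_on \<Omega>. ?d x * \<phi> x) = (LINT x|lebesgue_on \<Omega>. ?p x * \<phi> x)" by simp
    then show "(LINT x|lebesgue_on \<Omega>. (?d x - ?p x) * \<phi> x) = 0"
      unfolding left_diff_distrib using i1 i2 by simp
  qed
  then have ae: "AE x in lebesgue_on \<Omega>. ?d x = ?p x"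
    using \<Omega> by (subst AE_restrict_space_iff) auto
  have pm: "?p \<in> borel_measurable (lebesgue_on \<Omega>)"
    by (rule continuous_imp_measurable_on_sets_lebesgue[OF pc]) (use \<Omega> in auto)
  have dm: "?d \<in> borel_measurable (lebesgue_on \<Omega>)" by (rule L2_D(1)[OF d])
  have ae2: "AE x in lebesgue_on \<Omega>. (?d x)\<^sup>2 = (?p x)\<^sup>2" using ae by eventually_elim simp
  have "integrable (lebesgue_on \<Omega>) (\<lambda>x. (?p x)\<^sup>2)"
    by (rule integrable_cong_AE_imp[OF L2_D(2)[OF d]]) (use pm ae2 in auto)
  then show "?p \<in> L2 \<Omega>" using pm by (simp add: L2_def)
  show "L2_norm \<Omega> ?d = L2_norm \<Omega> ?p"
    unfolding L2_norm_def by (intro arg_cong[where f=sqrt] integral_cong_AE) (use pm dm ae2 in auto)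
qed

section \<open>The dual norm as a bound for the functional\<close>

lemma finite_dirs2: "finite (dirs2 :: 'a::euclidean_space list set)"
  unfolding dirs2_def by (rule finite_lists_length_le) simp

lemma L2_norm_weak_deriv_le: "bs \<in> dirs2 \<Longrightarrow> L2_norm \<Omega> (weak_deriv \<Omega> bs v) \<le> H2_norm \<Omega> v"
  unfolding H2_norm_def
  by (intro real_le_rsqrt) (rule member_le_sum[of bs dirs2 "\<lambda>bs. (L2_norm \<Omega> (weak_deriv \<Omega> bs v))\<^sup>2"], auto simp: finite_dirs2)

text \<open>Gives the boundedness without which the real supremum in \<open>dual_norm\<close> would
  say nothing, and settles test functions of zero norm.\<close>

lemma B_op_bound:
  fixes v :: "'a::euclidean_space \<Rightarrow> real"
  assumes \<Omega>: "open \<Omega>" and z: "z \<in> L2 \<Omega>" and v: "v \<in> H2_0 \<Omega> T"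
  shows "\<bar>B_op \<Omega> z v\<bar> \<le> DIM('a) * L2_norm \<Omega> z * H2_norm \<Omega> v"
proof -
  have v': "smooth_on \<Omega> v" "v \<in> H2 \<Omega>" using v by (auto simp: H2_0_def)
  have bb: "[b, b] \<in> dirs2" if "b \<in> Basis" for b :: 'a using that by (simp add: dirs2_def)
  have p: "partials [b, b] v \<in> L2 \<Omega>" "L2_norm \<Omega> (partials [b, b] v) \<le> H2_norm \<Omega> v" if "b \<in> Basis" for b
    using weak_deriv_smooth[OF \<Omega> v' bb[OF that]] L2_norm_weak_deriv_le[OF bb[OF that], of \<Omega> v] by auto
  have "\<bar>B_op \<Omega> z v\<bar> = \<bar>\<Sum>b\<in>Basis. LINT x|lebesgue_on \<Omega>. z x * partials [b, b] v x\<bar>"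
    unfolding B_op_def laplacian_def sum_distrib_left
    by (subst Bochner_Integration.integral_sum) (auto intro: L2_mult_integrable[OF z p(1)])
  also have "\<dots> \<le> (\<Sum>b\<in>Basis. \<bar>LINT x|lebesgue_on \<Omega>. z x * partials [b, b] v x\<bar>)" by (rule sum_abs)
  also have "\<dots> \<le> (\<Sum>b\<in>(Basis::'a set). L2_norm \<Omega> z * H2_norm \<Omega> v)"
    by (intro sum_mono order_trans[OF L2_Cauchy_Schwarz[OF z p(1)]] mult_left_mono p(2)) auto
  finally show ?thesis by simp
qed

lemma H2_norm_nonneg: "0 \<le> H2_norm \<Omega> v"
  by (simp add: H2_norm_def sum_nonneg)

lemma dual_norm_upper:
  fixes v :: "'a::euclidean_space \<Rightarrow> real"
  assumes \<Omega>: "open \<Omega>" and z: "z \<in> L2 \<Omega>" and v: "v \<in> H2_0 \<Omega> T" "\<exists>x\<in>\<Omega>. v x \<noteq> 0"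
  shows "\<bar>B_op \<Omega> z v\<bar> / H2_norm \<Omega> v \<le> dual_norm \<Omega> T (B_op \<Omega> z)"
proof -
  have bdd: "bdd_above ((\<lambda>v. \<bar>B_op \<Omega> z v\<bar> / H2_norm \<Omega> v) ` {v \<in> H2_0 \<Omega> T. \<exists>x\<in>\<Omega>. v x \<noteq> 0})"
  proof (rule bdd_aboveI2)
    fix u assume "u \<in> {v \<in> H2_0 \<Omega> T. \<exists>x\<in>\<Omega>. v x \<noteq> 0}"
    then have "\<bar>B_op \<Omega> z u\<bar> \<le> DIM('a) * L2_norm \<Omega> z * H2_norm \<Omega> u" using B_op_bound[OF \<Omega> z] by blast
    then show "\<bar>B_op \<Omega> z u\<bar> / H2_norm \<Omega> u \<le> DIM('a) * L2_norm \<Omega> z"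
      using H2_norm_nonneg[of \<Omega> u] by (cases "H2_norm \<Omega> u = 0") (simp_all add: divide_le_eq)
  qed
  show ?thesis
    unfolding dual_norm_def by (rule cSUP_upper[OF _ bdd]) (use v in simp)
qed

text \<open>The supremum skips functions that vanish on \<Omega>. All their derivatives vanish
  there, so their norm is zero, and \<open>B_op_bound\<close> covers that case.\<close>

lemma dual_norm_B_op:
  fixes v :: "'a::euclidean_space \<Rightarrow> real"
  assumes \<Omega>: "open \<Omega>" and z: "z \<in> L2 \<Omega>" and v: "v \<in> H2_0 \<Omega> T"
  shows "\<bar>B_op \<Omega> z v\<bar> \<le> dual_norm \<Omega> T (B_op \<Omega> z) * H2_norm \<Omega> v"
proof (cases "H2_norm \<Omega> v = 0")
  case True
  then show ?thesis using B_op_bound[OF assms] by simp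
next
  case False
  then have pos: "0 < H2_norm \<Omega> v" using H2_norm_nonneg[of \<Omega> v] by linarith
  have "\<exists>x\<in>\<Omega>. v x \<noteq> 0"
  proof (rule ccontr)
    assume "\<not> ?thesis"
    then have v0: "v x = 0" if "x \<in> \<Omega>" for x using that by blast
    have "L2_norm \<Omega> (weak_deriv \<Omega> bs v) = 0" if bs: "bs \<in> dirs2" for bs
    proof -
      have "partials cs v x = 0" if "x \<in> \<Omega>" for cs x
        using that
      proof (induction cs arbitrary: x)
        case (Cons c cs)
        have "(partials cs v has_derivative (\<lambda>_. 0)) (at x)"
          by (rule has_derivative_transform_within_open[of "\<lambda>_. 0" "\<lambda>_. 0" x UNIV \<Omega>]) (use Cons \<Omega> in auto)
        from frechet_derivative_at[OF this] show ?case by (simp add: partials.simps(2) fun_eq_iff)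
      qed (simp add: v0)
      then have "(LINT x|lebesgue_on \<Omega>. (partials (rev bs) v x)\<^sup>2) = (LINT x|lebesgue_on \<Omega>. 0)"
        by (intro Bochner_Integration.integral_cong) (auto simp: space_restrict_space)
      then show ?thesis
        using weak_deriv_smooth(2)[OF \<Omega> _ _ bs, of v] v by (simp add: H2_0_def L2_norm_def)
    qed
    then show False using pos by (simp add: H2_norm_def)
  qed
  then have "\<bar>B_op \<Omega> z v\<bar> / H2_norm \<Omega> v \<le> dual_norm \<Omega> T (B_op \<Omega> z)" by (rule dual_norm_upper[OF assms])
  then show ?thesis using pos by (simp add: divide_le_eq)
qed

text \<open>The ball only has to avoid T and may stick out of \<Omega>. Such functions carry
  information across \<Sigma>.\<close>

lemma bump_space_H2_0:
  fixes v :: "'a::euclidean_space \<Rightarrow> real"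
  assumes \<Omega>: "open \<Omega>" and v: "v \<in> bump_space c r" and T: "cball c r \<inter> T = {}"
  shows "v \<in> H2_0 \<Omega> T"
proof -
  have "smooth_on UNIV v" using v by (simp add: bump_space_def)
  then have s: "smooth_on \<Omega> v" by (rule smooth_on_subset) simp
  have L: "partials bs v \<in> L2 \<Omega>" if "set bs \<subseteq> Basis" for bs
    by (rule L2_norm_mono(1)[OF bump_space_L2[OF bump_space_partials[OF v that]]]) (use \<Omega> in auto)
  have "v \<in> H2 \<Omega>"
    unfolding H2_def
  proof (safe)
    show "v \<in> L2 \<Omega>" using L[of "[]"] by simp
    fix bs :: "'a list" assume "bs \<in> dirs2"
    then have "set bs \<subseteq> Basis" by (simp add: dirs2_def)
    then show "\<exists>g\<in>L2 \<Omega>. is_weak_deriv \<Omega> bs v g"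
      using smooth_is_weak_deriv[OF \<Omega> s] L[of "rev bs"] by auto
  qed
  then show ?thesis using s T bump_space_supp[OF v, of \<Omega>] by (auto simp: H2_0_def)
qed

lemma bump_space_H2_norm:
  fixes v :: "'a::euclidean_space \<Rightarrow> real"
  assumes \<Omega>: "open \<Omega>" and v: "v \<in> bump_space c r" and "0 \<le> C"
    and C: "\<And>bs. bs \<in> dirs2 \<Longrightarrow> L2_norm UNIV (partials bs v) \<le> C"
  shows "H2_norm \<Omega> v \<le> sqrt (card (dirs2 :: 'a list set)) * C"
proof -
  \<comment> \<open>With an empty T this just records smoothness and membership in
    \<open>H2\<close>, for a ball in any position.\<close>
  have v0: "v \<in> H2_0 \<Omega> {}" by (rule bump_space_H2_0[OF \<Omega> v]) simp
  then have v': "smooth_on \<Omega> v" "v \<in> H2 \<Omega>" by (auto simp: H2_0_def)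
  have "(L2_norm \<Omega> (weak_deriv \<Omega> bs v))\<^sup>2 \<le> C\<^sup>2" if bs: "bs \<in> dirs2" for bs
  proof -
    have set: "set (rev bs) \<subseteq> Basis" and rev: "rev bs \<in> dirs2" using bs by (auto simp: dirs2_def)
    have "L2_norm \<Omega> (weak_deriv \<Omega> bs v) = L2_norm \<Omega> (partials (rev bs) v)" by (rule weak_deriv_smooth(2)[OF \<Omega> v' bs])
    also have "\<dots> \<le> L2_norm UNIV (partials (rev bs) v)"
      by (rule L2_norm_mono(2)[OF bump_space_L2[OF bump_space_partials[OF v set]]]) (use \<Omega> in auto)
    also have "\<dots> \<le> C" by (rule C[OF rev])
    finally show ?thesis by (intro power_mono) auto
  qed
  then have "(\<Sum>bs\<in>dirs2. (L2_norm \<Omega> (weak_deriv \<Omega> bs v))\<^sup>2) \<le> (\<Sum>bs\<in>(dirs2 :: 'a list set). C\<^sup>2)" by (rule sum_mono)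
  then have "H2_norm \<Omega> v \<le> sqrt (card (dirs2 :: 'a list set) * C\<^sup>2)"
    unfolding H2_norm_def by (intro real_sqrt_le_mono) simp
  then show ?thesis using \<open>0 \<le> C\<close> by (simp add: real_sqrt_mult)
qed

text \<open>A supremum over an empty set would be an unspecified real; a cutoff in a small ball
  inside \<Omega> is an admissible function and provides a nonnegative quotient.\<close>

lemma dual_norm_B_op_nonneg:
  fixes \<Omega> :: "'a::euclidean_space set"
  assumes \<Omega>: "open \<Omega>" "\<Omega> \<noteq> {}" and z: "z \<in> L2 \<Omega>" and T: "\<Omega> \<inter> T = {}"
  shows "0 \<le> dual_norm \<Omega> T (B_op \<Omega> z)"
proof -
  obtain c r where r: "0 < r" "cball c r \<subseteq> \<Omega>" using \<Omega> open_contains_cball by blast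
  let ?v = "ball_cutoff c r 0"
  have v: "?v \<in> bump_space c r"
    by (rule bump_space_mono[OF ball_cutoff_bump_space[OF r(1)]]) (use r(1) in simp)
  have v0: "?v \<in> H2_0 \<Omega> T" by (rule bump_space_H2_0[OF \<Omega>(1) v]) (use r T in auto)
  have nz: "?v c \<noteq> 0" using r(1) by (simp add: ball_cutoff_def flat_exp_def)
  have "c \<in> \<Omega>" using r by auto
  have "0 \<le> \<bar>B_op \<Omega> z ?v\<bar> / H2_norm \<Omega> ?v" using H2_norm_nonneg[of \<Omega> ?v] by simp
  also have "\<dots> \<le> dual_norm \<Omega> T (B_op \<Omega> z)"
    by (rule dual_norm_upper[OF \<Omega>(1) z v0]) (use nz \<open>c \<in> \<Omega>\<close> in blast)
  finally show ?thesis .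
qed

section \<open>Extrapolation by finite differences\<close>

definition seq_diff :: "(nat \<Rightarrow> real) \<Rightarrow> nat \<Rightarrow> real" where
  "seq_diff a j = a (Suc j) - a j"

lemma sum_binomial_Suc:
  fixes x :: "nat \<Rightarrow> real"
  shows "(\<Sum>i\<le>Suc m. of_nat (Suc m choose i) * x i) =
    (\<Sum>i\<le>m. of_nat (m choose i) * x i) + (\<Sum>i\<le>m. of_nat (m choose i) * x (Suc i))"
proof -
  have "(\<Sum>i\<le>Suc m. of_nat (Suc m choose i) * x i) = x 0 + (\<Sum>i\<le>m. of_nat (Suc m choose Suc i) * x (Suc i))"
    by (subst sum.atMost_Suc_shift) simp
  also have "\<dots> = x 0 + (\<Sum>i\<le>m. of_nat (m choose Suc i) * x (Suc i)) + (\<Sum>i\<le>m. of_nat (m choose i) * x (Suc i))"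
    by (simp add: sum.distrib distrib_right)
  also have "x 0 + (\<Sum>i\<le>m. of_nat (m choose Suc i) * x (Suc i)) = (\<Sum>i\<le>Suc m. of_nat (m choose i) * x i)"
    by (subst sum.atMost_Suc_shift) simp
  also have "\<dots> = (\<Sum>i\<le>m. of_nat (m choose i) * x i)" by simp
  finally show ?thesis .
qed

text \<open>Newton's forward difference formula, that is, the binomial expansion of the m-th power
  of identity plus difference.\<close>

lemma seq_diff_binomial: "a (j + m) = (\<Sum>i\<le>m. of_nat (m choose i) * (seq_diff ^^ i) a j)"
proof (induction m arbitrary: j)
  case (Suc m)
  have "a (j + Suc m) = (\<Sum>i\<le>m. of_nat (m choose i) * (seq_diff ^^ i) a (Suc j))" using Suc.IH[of "Suc j"] by simp
  also have "\<dots> = (\<Sum>i\<le>m. of_nat (m choose i) * ((seq_diff ^^ i) a j + (seq_diff ^^ Suc i) a j))"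
    by (simp add: seq_diff_def)
  also have "\<dots> = (\<Sum>i\<le>Suc m. of_nat (Suc m choose i) * (seq_diff ^^ i) a j)"
    unfolding sum_binomial_Suc by (simp add: distrib_left sum.distrib)
  finally show ?case .
qed simp

lemma seq_diff_bound:
  assumes "\<And>l. j \<le> l \<Longrightarrow> l \<le> j + i \<Longrightarrow> \<bar>a l\<bar> \<le> b"
  shows "\<bar>(seq_diff ^^ i) a j\<bar> \<le> 2 ^ i * b"
  using assms
proof (induction i arbitrary: j)
  case (Suc i)
  have "\<bar>(seq_diff ^^ i) a j\<bar> \<le> 2 ^ i * b" "\<bar>(seq_diff ^^ i) a (Suc j)\<bar> \<le> 2 ^ i * b"
    using Suc.prems by (auto intro!: Suc.IH)
  then show ?case by (simp add: seq_diff_def[of "(seq_diff ^^ i) a"])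
qed simp

text \<open>With this sign, pairing a fixed function with differences of f gives the forward
  differences of the sequence of its pairings with the translates of f by j h.\<close>

definition diff_op :: "'a::euclidean_space \<Rightarrow> ('a \<Rightarrow> real) \<Rightarrow> 'a \<Rightarrow> real" where
  "diff_op h f x = f (x - h) - f x"

lemma L2_norm_translate:
  assumes "f \<in> bump_space c r" shows "L2_norm UNIV (\<lambda>x. f (x - h)) = L2_norm UNIV f"
proof -
  have "(L2_norm UNIV (\<lambda>x. f (x - h)))\<^sup>2 = (LINT x|lborel. (f (x + (- h)))\<^sup>2)"
    using bump_space_L2_norm[OF bump_space_translate[OF assms, of h]] by simp
  also have "\<dots> = (L2_norm UNIV f)\<^sup>2"
    using lborel_integral_translation[of "\<lambda>x. (f x)\<^sup>2" "- h"] bump_space_measurable[OF assms] bump_space_L2_norm[OF assms] by simp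
  finally show ?thesis by (simp add: power2_eq_iff_nonneg)
qed

lemma diff_op_bump_space:
  assumes f: "f \<in> bump_space c r" shows "diff_op h f \<in> bump_space c (r + norm h)"
proof -
  have "(\<lambda>x. f (x - h)) \<in> bump_space c (r + norm h)"
    by (rule bump_space_mono[OF bump_space_translate[OF f]]) (simp add: dist_norm)
  moreover have "f \<in> bump_space c (r + norm h)" by (rule bump_space_mono[OF f]) simp
  ultimately show ?thesis unfolding diff_op_def[abs_def] by (rule bump_space_diff)
qed

lemma diff_op_L2_norm:
  assumes f: "f \<in> bump_space c r" shows "L2_norm UNIV (diff_op h f) \<le> 2 * L2_norm UNIV f"
  unfolding diff_op_def[abs_def]
  using L2_norm_diff[OF bump_space_L2[OF bump_space_translate[OF f, of h]] bump_space_L2[OF f]] L2_norm_translate[OF f, of h] by simp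

lemma diff_op_power:
  assumes f: "f \<in> bump_space c r"
  shows "(diff_op h ^^ i) f \<in> bump_space c (r + i * norm h)" "L2_norm UNIV ((diff_op h ^^ i) f) \<le> 2 ^ i * L2_norm UNIV f"
proof (induction i)
  case (Suc i)
  { case 1
    show ?case using diff_op_bump_space[OF Suc.IH(1), of h] by (simp add: algebra_simps) }
  { case 2
    show ?case using diff_op_L2_norm[OF Suc.IH(1), of h] Suc.IH(2) by simp }
qed (use f in auto)

lemma smoothing_power:
  assumes f: "f \<in> bump_space c r" and s: "0 \<le> s"
  shows "(smoothing s ^^ k) f \<in> bump_space c (r + k * s)" "L2_norm UNIV ((smoothing s ^^ k) f) \<le> L2_norm UNIV f"
proof (induction k)
  case (Suc k)
  { case 1
    show ?case using smoothing_bump_space[OF Suc.IH(1) s] by (simp add: algebra_simps) }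
  { case 2
    show ?case using smoothing_L2_norm[OF Suc.IH(1) s] Suc.IH(2) by simp }
qed (use f in auto)

lemma smoothing_diff_op:
  assumes f: "f \<in> bump_space c r" and s: "0 \<le> s"
  shows "smoothing s (diff_op h f) = diff_op h (smoothing s f)"
proof
  fix x
  have tr: "smoothing s (\<lambda>x. f (x - h)) x = smoothing s f (x - h)"
    using s by (simp add: smoothing_eq algebra_simps)
  have "smoothing s (diff_op h f) x = smoothing s (\<lambda>x. f (x - h)) x - smoothing s f x"
    unfolding diff_op_def[abs_def] smoothing_def
    by (rule averaging.average_diff[OF averaging_smoothing[OF s] bump_space_translate[OF f] f])
  then show "smoothing s (diff_op h f) x = diff_op h (smoothing s f) x" using tr by (simp add: diff_op_def)
qed

lemma smoothing_diff_op_power: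
  assumes f: "f \<in> bump_space c r" and s: "0 \<le> s"
  shows "smoothing s ((diff_op h ^^ i) f) = (diff_op h ^^ i) (smoothing s f)"
proof (induction i)
  case (Suc i)
  show ?case using smoothing_diff_op[OF diff_op_power(1)[OF f] s] Suc by simp
qed simp

definition kernel_const :: "'a::euclidean_space itself \<Rightarrow> real" where
  "kernel_const _ = 2 * measure lborel (cball (0::'a) 2) / tent_mass TYPE('a)"

lemma kernel_const_nonneg: "0 \<le> kernel_const TYPE('a::euclidean_space)"
  using tent_mass_pos[where 'a='a] by (simp add: kernel_const_def)

text \<open>Smoothing commutes with differences, so each of the k smoothings can be matched with one
  of the k differences, and every match contributes one factor of
  \<open>smoothing_translation\<close>.\<close>

lemma smoothing_diff_power_bound:
  fixes f :: "'a::euclidean_space \<Rightarrow> real"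
  assumes f: "f \<in> bump_space c r" and s: "0 < s" and h: "norm h \<le> s"
  shows "L2_norm UNIV ((smoothing s ^^ k) ((diff_op h ^^ k) f)) \<le> (kernel_const TYPE('a) * (norm h / s)) ^ k * L2_norm UNIV f"
  using f
proof (induction k arbitrary: f c r)
  case (Suc k)
  let ?\<theta> = "kernel_const TYPE('a) * (norm h / s)"
  have Df: "diff_op h f \<in> bump_space c (r + norm h)" by (rule diff_op_bump_space[OF Suc.prems])
  have NDf: "smoothing s (diff_op h f) \<in> bump_space c (r + norm h + s)" by (rule smoothing_bump_space[OF Df]) (use s in simp)
  have "(smoothing s ^^ Suc k) ((diff_op h ^^ Suc k) f) = (smoothing s ^^ k) (smoothing s ((diff_op h ^^ k) (diff_op h f)))"
    by (simp only: funpow_Suc_right comp_apply)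
  also have "smoothing s ((diff_op h ^^ k) (diff_op h f)) = (diff_op h ^^ k) (smoothing s (diff_op h f))"
    by (rule smoothing_diff_op_power[OF Df]) (use s in simp)
  finally have 1: "L2_norm UNIV ((smoothing s ^^ Suc k) ((diff_op h ^^ Suc k) f)) \<le> ?\<theta> ^ k * L2_norm UNIV (smoothing s (diff_op h f))"
    using Suc.IH[OF NDf] by simp
  have 2: "L2_norm UNIV (smoothing s (diff_op h f)) \<le> ?\<theta> * L2_norm UNIV f"
    unfolding smoothing_diff_op[OF Suc.prems less_imp_le[OF s]] kernel_const_def
    unfolding diff_op_def by (rule smoothing_translation[OF Suc.prems s h])
  have "0 \<le> ?\<theta> ^ k" using kernel_const_nonneg[where 'a='a] s by simp
  from order_trans[OF 1 mult_left_mono[OF 2 this]] show ?case by (simp only: power_Suc mult_ac)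
qed simp

text \<open>The differences beyond the k-th are estimated crudely by a factor 2 each.\<close>

lemma smoothing_diff_power_bound':
  fixes f :: "'a::euclidean_space \<Rightarrow> real"
  assumes f: "f \<in> bump_space c r" and s: "0 < s" and h: "norm h \<le> s" and "k \<le> i"
  shows "L2_norm UNIV ((smoothing s ^^ k) ((diff_op h ^^ i) f)) \<le> 2 ^ i * (kernel_const TYPE('a) * (norm h / s)) ^ k * L2_norm UNIV f"
proof -
  let ?\<theta> = "kernel_const TYPE('a) * (norm h / s)"
  have \<theta>: "0 \<le> ?\<theta> ^ k" using kernel_const_nonneg[where 'a='a] s by simp
  have "(diff_op h ^^ i) f = (diff_op h ^^ k) ((diff_op h ^^ (i - k)) f)"
    using \<open>k \<le> i\<close> funpow_add[of k "i - k" "diff_op h"] by simp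
  then have "L2_norm UNIV ((smoothing s ^^ k) ((diff_op h ^^ i) f)) \<le> ?\<theta> ^ k * L2_norm UNIV ((diff_op h ^^ (i - k)) f)"
    using smoothing_diff_power_bound[OF diff_op_power(1)[OF f] s h] by metis
  also have "\<dots> \<le> ?\<theta> ^ k * (2 ^ (i - k) * L2_norm UNIV f)"
    by (rule mult_left_mono[OF diff_op_power(2)[OF f] \<theta>])
  also have "\<dots> \<le> ?\<theta> ^ k * (2 ^ i * L2_norm UNIV f)"
    by (intro mult_left_mono mult_right_mono power_increasing \<theta>) auto
  finally show ?thesis by (simp add: algebra_simps)
qed

section \<open>Pairings with an almost harmonic function\<close>

lemma bump_pairing:
  assumes z: "z \<in> L2 UNIV" and f: "f \<in> bump_space c r"
  shows "integrable lebesgue (\<lambda>x. z x * f x)" "\<bar>LINT x|lebesgue. z x * f x\<bar> \<le> L2_norm UNIV z * L2_norm UNIV f"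
  using L2_mult_integrable[OF z bump_space_L2[OF f]] L2_Cauchy_Schwarz[OF z bump_space_L2[OF f]]
  by (simp_all add: lebesgue_on_UNIV_eq)

lemma bump_pairing_local:
  assumes z: "z \<in> L2 UNIV" and f: "f \<in> bump_space c r" and "r < R"
  shows "\<bar>LINT x|lebesgue. z x * f x\<bar> \<le> L2_norm (ball c R) z * L2_norm UNIV f"
proof -
  let ?z = "\<lambda>x. if x \<in> ball c R then z x else 0"
  have z0: "?z \<in> L2 UNIV" using L2_norm_mono(1)[OF z, of "ball c R"] L2_restrict[of "ball c R" z] by simp
  have "(LINT x|lebesgue. z x * f x) = (LINT x|lebesgue. ?z x * f x)"
    by (rule Bochner_Integration.integral_cong) (use f \<open>r < R\<close> in \<open>auto simp: bump_space_def\<close>)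
  then show ?thesis
    using bump_pairing(2)[OF z0 f] L2_norm_restrict[of "ball c R" z] by simp
qed

text \<open>A mean value property in weak form with error \<open>\<epsilon>\<close>. Exactly this
  part of the information from the dual norm is used later; the error bound is uniform over all
  widths up to 1.\<close>

definition near_harmonic :: "'a::euclidean_space set \<Rightarrow> real \<Rightarrow> ('a \<Rightarrow> real) \<Rightarrow> bool" where
  "near_harmonic U \<epsilon> z \<longleftrightarrow> z \<in> L2 UNIV \<and>
     (\<forall>f c r s. f \<in> bump_space c r \<longrightarrow> 0 \<le> s \<longrightarrow> s \<le> 1 \<longrightarrow> cball c (r + s) \<subseteq> U \<longrightarrow>
        \<bar>LINT x|lebesgue. z x * (f x - smoothing s f x)\<bar> \<le> \<epsilon> * L2_norm UNIV f)"

text \<open>Telescoping: since smoothing is a contraction, each of the k steps costs the same, and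
  the loss is linear in k.\<close>

lemma near_harmonic_power:
  assumes z: "near_harmonic U \<epsilon> z" and "0 \<le> \<epsilon>" and f: "f \<in> bump_space c r" and s: "0 \<le> s" "s \<le> 1"
    and "cball c (r + k * s) \<subseteq> U"
  shows "\<bar>LINT x|lebesgue. z x * (f x - (smoothing s ^^ k) f x)\<bar> \<le> k * \<epsilon> * L2_norm UNIV f"
  using assms(6)
proof (induction k)
  case (Suc k)
  have zL: "z \<in> L2 UNIV" using z by (simp add: near_harmonic_def)
  let ?g = "(smoothing s ^^ k) f"
  have g: "?g \<in> bump_space c (r + k * s)" "L2_norm UNIV ?g \<le> L2_norm UNIV f" using smoothing_power[OF f s(1)] by auto
  have Ng: "smoothing s ?g \<in> bump_space c (r + k * s + s)" by (rule smoothing_bump_space[OF g(1) s(1)])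
  have "cball c (r + k * s) \<subseteq> U" using s(1) by (intro subset_trans[OF _ Suc.prems] cball_subset_cball_iff[THEN iffD2]) (auto simp: algebra_simps)
  then have 1: "\<bar>LINT x|lebesgue. z x * (f x - ?g x)\<bar> \<le> k * \<epsilon> * L2_norm UNIV f" by (rule Suc.IH)
  have 2: "\<bar>LINT x|lebesgue. z x * (?g x - smoothing s ?g x)\<bar> \<le> \<epsilon> * L2_norm UNIV ?g"
  proof -
    have "cball c (r + k * s + s) \<subseteq> U" using Suc.prems by (simp add: algebra_simps)
    then show ?thesis using z g(1) s unfolding near_harmonic_def by blast
  qed
  have "(LINT x|lebesgue. z x * (f x - (smoothing s ^^ Suc k) f x)) = (LINT x|lebesgue. z x * f x) - (LINT x|lebesgue. z x * smoothing s ?g x)"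
    using bump_pairing(1)[OF zL f] bump_pairing(1)[OF zL Ng] by (simp add: right_diff_distrib)
  also have "\<dots> = (LINT x|lebesgue. z x * (f x - ?g x)) + (LINT x|lebesgue. z x * (?g x - smoothing s ?g x))"
    using bump_pairing(1)[OF zL f] bump_pairing(1)[OF zL Ng] bump_pairing(1)[OF zL g(1)] by (simp add: right_diff_distrib)
  finally have "\<bar>LINT x|lebesgue. z x * (f x - (smoothing s ^^ Suc k) f x)\<bar> \<le> k * \<epsilon> * L2_norm UNIV f + \<epsilon> * L2_norm UNIV ?g"
    using 1 2 by linarith
  also have "\<dots> \<le> k * \<epsilon> * L2_norm UNIV f + \<epsilon> * L2_norm UNIV f"
    using mult_left_mono[OF g(2) \<open>0 \<le> \<epsilon>\<close>] by simp
  finally show ?case by (simp add: algebra_simps)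
qed simp

text \<open>Expand the translation by \<open>4 * k\<close> steps in finite differences: those of order below \<open>k\<close> only
  see \<open>z\<close> near the start, and those of order at least \<open>k\<close> are small because \<open>k\<close> smoothings of
  width \<open>R / k\<close>, which change the pairing with \<open>z\<close> by little, turn each difference into a small factor.\<close>

lemma extrapolation:
  fixes z :: "'a::euclidean_space \<Rightarrow> real"
  assumes z: "near_harmonic U \<epsilon> z" and "0 \<le> \<epsilon>" and \<sigma>: "0 < \<sigma>" "\<sigma> \<le> R" "R \<le> 1"
    and U: "cball x (5 * \<sigma> + R) \<subseteq> U" and u: "norm u \<le> 4 * \<sigma>" and k: "0 < k"
  shows "L2_norm (ball (x + u) \<sigma>) z \<le>
    81 ^ k * (L2_norm (ball x (2 * \<sigma>)) z + k * \<epsilon> + (kernel_const TYPE('a) * (\<sigma> / R)) ^ k * L2_norm UNIV z)"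
proof -
  have zL: "z \<in> L2 UNIV" using z by (simp add: near_harmonic_def)
  \<comment> \<open>As u is at most 4 \<sigma> long, m = 4 k steps have length at most \<sigma> / k
    each; k smoothings of width s together widen the support by R.\<close>
  define m h s where "m = 4 * k" and "h = u /\<^sub>R real m" and "s = R / k"
  have R: "0 < R" using \<sigma> by simp
  have s: "0 < s" "s \<le> 1" "k * s = R" using k R \<sigma> by (auto simp: s_def field_simps)
  have hn: "real m * norm h = norm u" using k by (simp add: h_def m_def)
  have hk: "k * norm h \<le> \<sigma>" using hn u by (simp add: m_def)
  have hs: "norm h \<le> s" using hk \<sigma> k by (simp add: s_def field_simps)
  have mh: "real m *\<^sub>R h = u" using k by (simp add: h_def m_def)
  let ?\<theta> = "kernel_const TYPE('a) * (norm h / s)" and ?\<Theta> = "kernel_const TYPE('a) * (\<sigma> / R)"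
  have "norm h / s \<le> \<sigma> / R" using hk k R by (simp add: s_def field_simps)
  then have \<theta>: "0 \<le> ?\<theta>" "?\<theta> \<le> ?\<Theta>"
    using kernel_const_nonneg[where 'a='a] s(1) by (simp, intro mult_left_mono)
  let ?\<delta> = "L2_norm (ball x (2 * \<sigma>)) z" and ?M = "L2_norm UNIV z"
  let ?E = "?\<delta> + k * \<epsilon> + ?\<Theta> ^ k * ?M"
  have pos: "0 \<le> ?\<Theta> ^ k * ?M" "0 \<le> k * \<epsilon>" "0 \<le> ?\<delta>" using \<theta> \<open>0 \<le> \<epsilon>\<close> by auto
  show ?thesis
  proof (rule L2_norm_ball_duality[OF \<sigma>(1) zL])
    show "0 \<le> 81 ^ k * ?E" using pos by simp
    fix g \<rho> assume \<rho>: "\<rho> < \<sigma>" and g: "g \<in> bump_space (x + u) \<rho>"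
    \<comment> \<open>Moving the test function back to \<open>x\<close> makes its m-th translate
      equal to \<open>g\<close>.\<close>
    define f where "f y = g (y + u)" for y
    have f: "f \<in> bump_space x \<rho>"
      using bump_space_translate[OF g, of "- u"] by (simp add: f_def[abs_def])
    let ?n = "L2_norm UNIV f"
    have n: "?n = L2_norm UNIV g" using L2_norm_translate[OF g, of "- u"] by (simp add: f_def[abs_def])
    define A where "A f j = (LINT y|lebesgue. z y * f (y - real j *\<^sub>R h))" for f :: "'a \<Rightarrow> real" and j
    have A_diff: "A (diff_op h f) j = seq_diff (A f) j" if "f \<in> bump_space x r" for f r j
    proof -
      have "A (diff_op h f) j = (LINT y|lebesgue. z y * f (y - real (Suc j) *\<^sub>R h) - z y * f (y - real j *\<^sub>R h))"
        unfolding A_def diff_op_def by (simp add: algebra_simps)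
      also have "\<dots> = A f (Suc j) - A f j"
        unfolding A_def by (rule Bochner_Integration.integral_diff) (rule bump_pairing(1)[OF zL bump_space_translate[OF that]])+
      finally show ?thesis by (simp add: seq_diff_def)
    qed
    have A_pow: "A ((diff_op h ^^ i) f) = (seq_diff ^^ i) (A f)" for i
    proof (induction i)
      case (Suc i)
      have "A ((diff_op h ^^ Suc i) f) j = seq_diff (A ((diff_op h ^^ i) f)) j" for j
        using A_diff[OF diff_op_power(1)[OF f, where h=h]] by simp
      then show ?case using Suc by (intro ext) simp
    qed simp
    have low: "\<bar>(seq_diff ^^ i) (A f) 0\<bar> \<le> 2 ^ i * (?\<delta> * ?n)" if "i < k" for i
    proof (rule seq_diff_bound)
      fix l assume "l \<le> 0 + i"
      \<comment> \<open>Fewer than k steps move the support by at most \<sigma>, so it stays in the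
        ball of radius 2 \<sigma> around \<open>x\<close>.\<close>
      then have "real l * norm h \<le> \<sigma>"
        using that hk by (intro order_trans[OF mult_right_mono hk]) auto
      then have "(\<lambda>y. f (y - real l *\<^sub>R h)) \<in> bump_space x (\<rho> + \<sigma>)"
        by (intro bump_space_mono[OF bump_space_translate[OF f]]) (simp add: dist_norm)
      from bump_pairing_local[OF zL this, of "2 * \<sigma>"] show "\<bar>A f l\<bar> \<le> ?\<delta> * ?n"
        using \<rho> L2_norm_translate[OF f] by (simp add: A_def)
    qed
    have high: "\<bar>(seq_diff ^^ i) (A f) 0\<bar> \<le> 2 ^ i * ((k * \<epsilon> + ?\<Theta> ^ k * ?M) * ?n)" if i: "k \<le> i" "i \<le> m" for i
    proof -
      let ?\<psi> = "(diff_op h ^^ i) f"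
      have \<psi>: "?\<psi> \<in> bump_space x (\<rho> + i * norm h)" "L2_norm UNIV ?\<psi> \<le> 2 ^ i * ?n"
        using diff_op_power[OF f] by auto
      have N\<psi>: "(smoothing s ^^ k) ?\<psi> \<in> bump_space x (\<rho> + i * norm h + k * s)"
        using smoothing_power(1)[OF \<psi>(1)] s(1) by simp
      have "real i * norm h \<le> 4 * \<sigma>"
        using mult_right_mono[of "real i" "real m" "norm h"] i(2) hn u by simp
      \<comment> \<open>The radius budget in \<open>U\<close>: less than \<sigma> for f, at most 4
        \<sigma> for the differences, and R for the smoothings.\<close>
      then have "cball x (\<rho> + i * norm h + k * s) \<subseteq> U"
        using \<rho> s(3) by (intro subset_trans[OF _ U] cball_subset_cball_iff[THEN iffD2]) (auto simp del: of_nat_mult)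
      then have 1: "\<bar>LINT y|lebesgue. z y * (?\<psi> y - (smoothing s ^^ k) ?\<psi> y)\<bar> \<le> k * \<epsilon> * L2_norm UNIV ?\<psi>"
        using s(1,2) by (intro near_harmonic_power[OF z \<open>0 \<le> \<epsilon>\<close> \<psi>(1)]) auto
      have 2: "\<bar>LINT y|lebesgue. z y * (smoothing s ^^ k) ?\<psi> y\<bar> \<le> ?M * L2_norm UNIV ((smoothing s ^^ k) ?\<psi>)"
        by (rule bump_pairing(2)[OF zL N\<psi>])
      have 3: "L2_norm UNIV ((smoothing s ^^ k) ?\<psi>) \<le> 2 ^ i * ?\<Theta> ^ k * ?n"
      proof -
        have "L2_norm UNIV ((smoothing s ^^ k) ?\<psi>) \<le> 2 ^ i * ?\<theta> ^ k * ?n"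
          by (rule smoothing_diff_power_bound'[OF f s(1) hs i(1)])
        also have "\<dots> \<le> 2 ^ i * ?\<Theta> ^ k * ?n"
          by (intro mult_right_mono mult_left_mono power_mono \<theta>) auto
        finally show ?thesis .
      qed
      have "(seq_diff ^^ i) (A f) 0 = (LINT y|lebesgue. z y * ?\<psi> y)"
        unfolding A_pow[symmetric] by (simp add: A_def)
      also have "\<dots> = (LINT y|lebesgue. z y * (?\<psi> y - (smoothing s ^^ k) ?\<psi> y)) + (LINT y|lebesgue. z y * (smoothing s ^^ k) ?\<psi> y)"
        using bump_pairing(1)[OF zL \<psi>(1)] bump_pairing(1)[OF zL N\<psi>] by (simp add: right_diff_distrib)
      finally have "\<bar>(seq_diff ^^ i) (A f) 0\<bar> \<le> k * \<epsilon> * L2_norm UNIV ?\<psi> + ?M * L2_norm UNIV ((smoothing s ^^ k) ?\<psi>)"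
        using 1 2 by linarith
      also have "\<dots> \<le> k * \<epsilon> * (2 ^ i * ?n) + ?M * (2 ^ i * ?\<Theta> ^ k * ?n)"
        using \<open>0 \<le> \<epsilon>\<close> by (intro add_mono mult_left_mono \<psi>(2) 3) auto
      finally show ?thesis by (simp add: algebra_simps)
    qed
    have each: "\<bar>(seq_diff ^^ i) (A f) 0\<bar> \<le> 2 ^ i * (?E * ?n)" if "i \<le> m" for i
    proof (cases "i < k")
      case True
      have "?\<delta> * ?n \<le> ?E * ?n" using pos by (intro mult_right_mono) auto
      then show ?thesis using order_trans[OF low[OF True]] by (simp add: mult_left_mono)
    next
      case False
      have "(k * \<epsilon> + ?\<Theta> ^ k * ?M) * ?n \<le> ?E * ?n" using pos by (intro mult_right_mono) auto
      then show ?thesis using order_trans[OF high[of i]] False that by (simp add: mult_left_mono)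
    qed
    have "(LINT y|lebesgue. z y * g y) = A f (0 + m)"
      by (simp add: A_def f_def mh)
    then have expand: "(LINT y|lebesgue. z y * g y) = (\<Sum>i\<le>m. of_nat (m choose i) * (seq_diff ^^ i) (A f) 0)"
      by (simp only: seq_diff_binomial)
    \<comment> \<open>Each difference of order i costs 2^i, so the binomial weights add up to 3^m =
      81^k.\<close>
    have "(\<Sum>i\<le>m. of_nat (m choose i) * 2 ^ i * 1 ^ (m - i)) = (3::real) ^ m"
      using binomial_ring[of "2::real" 1 m] by simp
    then have three: "(\<Sum>i\<le>m. of_nat (m choose i) * 2 ^ i) = (81::real) ^ k" by (simp add: m_def power_mult)
    have "\<bar>LINT y|lebesgue. z y * g y\<bar> \<le> (\<Sum>i\<le>m. \<bar>of_nat (m choose i) * (seq_diff ^^ i) (A f) 0\<bar>)"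
      unfolding expand by (rule sum_abs)
    also have "\<dots> \<le> (\<Sum>i\<le>m. of_nat (m choose i) * (2 ^ i * (?E * ?n)))"
      unfolding abs_mult abs_of_nat by (intro sum_mono mult_left_mono each) auto
    also have "\<dots> = (\<Sum>i\<le>m. of_nat (m choose i) * 2 ^ i) * (?E * ?n)"
      by (simp only: sum_distrib_right mult.assoc)
    finally show "\<bar>LINT y|lebesgue. z y * g y\<bar> \<le> 81 ^ k * ?E * L2_norm UNIV g"
      unfolding three by (simp only: n mult.assoc)
  qed
qed

section \<open>Propagation of smallness\<close>

text \<open>The functional is tested with \<open>potential s f\<close>, whose Laplacian is
  \<open>f - smoothing s f\<close> and whose support lies in the enlarged ball, hence away from
  T.\<close>

lemma near_harmonic_zero_extension:
  fixes \<Omega> :: "'a::euclidean_space set"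
  assumes \<Omega>: "open \<Omega>" and z: "z \<in> L2 \<Omega>" and dual: "0 \<le> dual_norm \<Omega> T (B_op \<Omega> z)"
  shows "near_harmonic (- closure T)
    (sqrt (card (dirs2 :: 'a list set)) * potential_const TYPE('a) * dual_norm \<Omega> T (B_op \<Omega> z)) (\<lambda>x. if x \<in> \<Omega> then z x else 0)"
  unfolding near_harmonic_def
proof (intro conjI allI impI)
  show "(\<lambda>x. if x \<in> \<Omega> then z x else 0) \<in> L2 UNIV" using z \<Omega> L2_restrict[of \<Omega> z] by simp
next
  fix f :: "'a \<Rightarrow> real" and c r s
  assume f: "f \<in> bump_space c r" and s: "0 \<le> s" "s \<le> (1::real)" and U: "cball c (r + s) \<subseteq> - closure T"
  let ?v = "potential s f" and ?C = "potential_const TYPE('a)" and ?d = "dual_norm \<Omega> T (B_op \<Omega> z)"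
  have v: "?v \<in> bump_space c (r + s)" by (rule potential_bump_space[OF f])
  have "?v \<in> H2_0 \<Omega> T"
    by (rule bump_space_H2_0[OF \<Omega> v]) (use U closure_subset[of T] in blast)
  then have B: "\<bar>B_op \<Omega> z ?v\<bar> \<le> ?d * H2_norm \<Omega> ?v" by (rule dual_norm_B_op[OF \<Omega> z])
  have "H2_norm \<Omega> ?v \<le> sqrt (card (dirs2 :: 'a list set)) * (?C * L2_norm UNIV f)"
    by (rule bump_space_H2_norm[OF \<Omega> v])
       (use potential_partials_L2_norm[OF f s] potential_const_ge[where 'a='a] in auto)
  from order_trans[OF B mult_left_mono[OF this dual]]
  have B': "\<bar>B_op \<Omega> z ?v\<bar> \<le> sqrt (card (dirs2 :: 'a list set)) * ?C * ?d * L2_norm UNIV f" by (simp add: mult_ac)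
  have "B_op \<Omega> z ?v = - (LINT x|lebesgue. (if x \<in> \<Omega> then z x * (f x - smoothing s f x) else 0))"
    unfolding B_op_def laplacian_potential[OF f s(1)] lebesgue_on_integral_zero_extension[OF \<Omega>] ..
  also have "(LINT x|lebesgue. (if x \<in> \<Omega> then z x * (f x - smoothing s f x) else 0)) =
      (LINT x|lebesgue. (if x \<in> \<Omega> then z x else 0) * (f x - smoothing s f x))"
    by (rule Bochner_Integration.integral_cong) auto
  finally show "\<bar>LINT x|lebesgue. (if x \<in> \<Omega> then z x else 0) * (f x - smoothing s f x)\<bar>
      \<le> sqrt (card (dirs2 :: 'a list set)) * ?C * ?d * L2_norm UNIV f" using B' by simp
qed

text \<open>A Hoelder estimate on \<open>S\<close>, uniform over the pairs in \<open>P\<close>, in the equivalent form that is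
  obtained by interpolating between an exponential loss in \<open>\<epsilon>\<close> and an exponential gain in the norm.\<close>

definition controlled :: "(real \<times> ('a::euclidean_space \<Rightarrow> real)) set \<Rightarrow> 'a set \<Rightarrow> bool" where
  "controlled P S \<longleftrightarrow> (\<exists>B\<ge>1. \<forall>(\<epsilon>, z)\<in>P. \<forall>k. L2_norm S z \<le> B ^ k * \<epsilon> + L2_norm UNIV z / 2 ^ k)"

locale near_harmonic_family =
  fixes P :: "(real \<times> ('a::euclidean_space \<Rightarrow> real)) set" and U :: "'a set"
  assumes family: "\<And>\<epsilon> z. (\<epsilon>, z) \<in> P \<Longrightarrow> 0 \<le> \<epsilon> \<and> near_harmonic U \<epsilon> z"
begin

lemma family_L2: "(\<epsilon>, z) \<in> P \<Longrightarrow> z \<in> L2 UNIV"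
  using family by (simp add: near_harmonic_def)

lemma family_local_norm: "(\<epsilon>, z) \<in> P \<Longrightarrow> S \<in> sets lebesgue \<Longrightarrow> L2_norm S z \<le> L2_norm UNIV z"
  by (rule L2_norm_mono(2)[OF family_L2]) auto

text \<open>Allows one surplus power of \<open>B\<close>. For positive k it is absorbed by squaring
  \<open>B\<close>; for k = 0 the local norm is at most the global one.\<close>

lemma controlledI:
  assumes S: "S \<in> sets lebesgue" and B: "1 \<le> B"
    and bound: "\<And>\<epsilon> z k. (\<epsilon>, z) \<in> P \<Longrightarrow> L2_norm S z \<le> B ^ Suc k * \<epsilon> + L2_norm UNIV z / 2 ^ k"
  shows "controlled P S"
proof -
  have "L2_norm S z \<le> (B\<^sup>2) ^ k * \<epsilon> + L2_norm UNIV z / 2 ^ k" if z: "(\<epsilon>, z) \<in> P" for \<epsilon> z k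
  proof (cases "k = 0")
    case True
    then show ?thesis using family_local_norm[OF z S] family[OF z] by simp
  next
    case False
    have "B ^ Suc k \<le> (B\<^sup>2) ^ k"
      unfolding power_mult[symmetric] using False by (intro power_increasing B) auto
    then have "B ^ Suc k * \<epsilon> \<le> (B\<^sup>2) ^ k * \<epsilon>" using family[OF z] by (intro mult_right_mono) auto
    then show ?thesis using bound[OF z, of k] by linarith
  qed
  moreover have "1 \<le> B\<^sup>2" using B by (simp add: one_le_power)
  ultimately show ?thesis unfolding controlled_def by blast
qed

lemma controlled_mono:
  assumes "controlled P T" "S \<subseteq> T" "S \<in> sets lebesgue" "T \<in> sets lebesgue"
  shows "controlled P S"
proof -
  obtain B where "1 \<le> B" and B: "\<And>\<epsilon> z k. (\<epsilon>, z) \<in> P \<Longrightarrow> L2_norm T z \<le> B ^ k * \<epsilon> + L2_norm UNIV z / 2 ^ k"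
    using assms(1) unfolding controlled_def by blast
  have "L2_norm S z \<le> B ^ k * \<epsilon> + L2_norm UNIV z / 2 ^ k" if z: "(\<epsilon>, z) \<in> P" for \<epsilon> z k
  proof -
    have "z \<in> L2 T" by (rule L2_norm_mono(1)[OF family_L2[OF z] assms(4)]) auto
    then have "L2_norm S z \<le> L2_norm T z" by (rule L2_norm_mono(2)[OF _ assms(3,4,2)])
    also have "\<dots> \<le> B ^ k * \<epsilon> + L2_norm UNIV z / 2 ^ k" by (rule B[OF z])
    finally show ?thesis .
  qed
  then show ?thesis unfolding controlled_def using \<open>1 \<le> B\<close> by blast
qed

lemma L2_norm_Un:
  assumes z: "z \<in> L2 UNIV" and S: "S \<in> sets lebesgue" and T: "T \<in> sets lebesgue"
  shows "L2_norm (S \<union> T) z \<le> L2_norm S z + L2_norm T z"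
proof -
  have L: "(\<lambda>x. if x \<in> A then z x else 0) \<in> L2 UNIV" if "A \<in> sets lebesgue" for A
    using L2_norm_mono(1)[OF z that] L2_restrict[OF that] by simp
  have D: "T - S \<in> sets lebesgue" using S T by auto
  have "L2_norm (S \<union> T) z = L2_norm UNIV (\<lambda>x. if x \<in> S \<union> T then z x else 0)"
    using L2_norm_restrict[of "S \<union> T" z] S T by simp
  also have "(\<lambda>x. if x \<in> S \<union> T then z x else 0) = (\<lambda>x. (if x \<in> S then z x else 0) + (if x \<in> T - S then z x else 0))" by auto
  also have "L2_norm UNIV \<dots> \<le> L2_norm UNIV (\<lambda>x. if x \<in> S then z x else 0) + L2_norm UNIV (\<lambda>x. if x \<in> T - S then z x else 0)"
    by (rule L2_norm_triangle[OF L[OF S] L[OF D]])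
  also have "\<dots> = L2_norm S z + L2_norm (T - S) z"
    using L2_norm_restrict[OF S] L2_norm_restrict[OF D] by simp
  also have "L2_norm (T - S) z \<le> L2_norm T z"
    by (rule L2_norm_mono(2)[OF L2_norm_mono(1)[OF z T] D T]) auto
  finally show ?thesis by simp
qed

text \<open>Both bounds are used with exponent k + 1, so that the two tails of size 2^-(k+1) add up
  to 2^-k.\<close>

lemma controlled_Un:
  assumes "controlled P S" "controlled P T" and S: "S \<in> sets lebesgue" and T: "T \<in> sets lebesgue"
  shows "controlled P (S \<union> T)"
proof -
  obtain B where B: "1 \<le> B" "\<And>\<epsilon> z k. (\<epsilon>, z) \<in> P \<Longrightarrow> L2_norm S z \<le> B ^ k * \<epsilon> + L2_norm UNIV z / 2 ^ k"
    using assms(1) unfolding controlled_def by blast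
  obtain C where C: "1 \<le> C" "\<And>\<epsilon> z k. (\<epsilon>, z) \<in> P \<Longrightarrow> L2_norm T z \<le> C ^ k * \<epsilon> + L2_norm UNIV z / 2 ^ k"
    using assms(2) unfolding controlled_def by blast
  show ?thesis
  proof (rule controlledI[of _ "B + C"])
    fix \<epsilon> z k assume z: "(\<epsilon>, z) \<in> P"
    have \<epsilon>: "0 \<le> \<epsilon>" using family[OF z] by simp
    have pow: "B ^ Suc k + C ^ Suc k \<le> (B + C) ^ Suc k"
    proof -
      have "B * B ^ k \<le> B * (B + C) ^ k" "C * C ^ k \<le> C * (B + C) ^ k"
        using B(1) C(1) by (auto intro!: mult_left_mono power_mono)
      then show ?thesis by (simp add: distrib_right)
    qed
    have "L2_norm (S \<union> T) z \<le> L2_norm S z + L2_norm T z" by (rule L2_norm_Un[OF family_L2[OF z] S T])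
    also have "\<dots> \<le> (B ^ Suc k * \<epsilon> + L2_norm UNIV z / 2 ^ Suc k) + (C ^ Suc k * \<epsilon> + L2_norm UNIV z / 2 ^ Suc k)"
      by (intro add_mono B(2)[OF z] C(2)[OF z])
    also have "\<dots> = (B ^ Suc k + C ^ Suc k) * \<epsilon> + L2_norm UNIV z / 2 ^ k" by (simp add: field_simps)
    also have "\<dots> \<le> (B + C) ^ Suc k * \<epsilon> + L2_norm UNIV z / 2 ^ k"
      by (intro add_right_mono mult_right_mono pow \<epsilon>)
    finally show "L2_norm (S \<union> T) z \<le> (B + C) ^ Suc k * \<epsilon> + L2_norm UNIV z / 2 ^ k" .
  qed (use B C S T in auto)
qed

lemma controlled_empty: "controlled P {}"
  by (rule controlledI[of _ 1]) (auto simp: L2_norm_def lebesgue_on_UNIV_eq dest: family intro!: add_nonneg_nonneg)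

lemma controlled_UN:
  assumes "finite I" "\<And>i. i \<in> I \<Longrightarrow> controlled P (S i)" "\<And>i. i \<in> I \<Longrightarrow> S i \<in> sets lebesgue"
  shows "controlled P (\<Union>i\<in>I. S i)"
  using assms
proof (induction I rule: finite_induct)
  case (insert i I)
  then show ?case by (simp, intro controlled_Un sets.finite_UN) auto
qed (simp add: controlled_empty)

text \<open>\<open>extrapolation\<close> is applied with j = k + 1 and the bound on the given ball
  with exponent 8 j. The loss 81^j is then compensated twice: 81 / 2^8 is below 1/2 (8 is the least
  such exponent), and 81 / 162 is 1/2. The two remainders of size 2^-j together give 2^-k.\<close>

lemma controlled_step:
  assumes ctrl: "controlled P (ball x (2 * \<sigma>))" and \<sigma>: "0 < \<sigma>" "\<sigma> \<le> R" "R \<le> 1"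
    and small: "kernel_const TYPE('a) * (\<sigma> / R) \<le> 1 / 162"
    and U: "cball x (5 * \<sigma> + R) \<subseteq> U" and u: "norm u \<le> 4 * \<sigma>"
  shows "controlled P (ball (x + u) \<sigma>)"
proof -
  obtain B where B: "1 \<le> B" "\<And>\<epsilon> z k. (\<epsilon>, z) \<in> P \<Longrightarrow> L2_norm (ball x (2 * \<sigma>)) z \<le> B ^ k * \<epsilon> + L2_norm UNIV z / 2 ^ k"
    using ctrl unfolding controlled_def by blast
  show ?thesis
  proof (rule controlledI[of _ "324 * B ^ 8"])
    show "1 \<le> 324 * B ^ 8" using one_le_power[OF B(1), of 8] by simp
    fix \<epsilon> z k assume z: "(\<epsilon>, z) \<in> P"
    have \<epsilon>: "0 \<le> \<epsilon>" and nh: "near_harmonic U \<epsilon> z" using family[OF z] by auto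
    let ?j = "Suc k" and ?M = "L2_norm UNIV z" and ?\<Theta> = "kernel_const TYPE('a) * (\<sigma> / R)"
    have \<Theta>: "0 \<le> ?\<Theta>" using kernel_const_nonneg[where 'a='a] \<sigma> by simp
    have "81 ^ ?j * ?\<Theta> ^ ?j = (81 * ?\<Theta>) ^ ?j" by (simp only: power_mult_distrib)
    also have "\<dots> \<le> (1 / 2) ^ ?j"
    proof (rule power_mono)
      show "81 * ?\<Theta> \<le> 1 / 2" using small by linarith
      show "0 \<le> 81 * ?\<Theta>" using \<Theta> by linarith
    qed
    finally have t1: "81 ^ ?j * (?\<Theta> ^ ?j * ?M) \<le> ?M / 2 ^ ?j"
      using mult_right_mono[of "81 ^ ?j * ?\<Theta> ^ ?j" "(1 / 2) ^ ?j" ?M] by (simp only: mult.assoc) (simp add: power_one_over)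
    have "81 ^ ?j / 2 ^ (8 * ?j) = (81 / 256 :: real) ^ ?j" by (simp only: power_mult power_divide) simp
    also have "\<dots> \<le> (1 / 2) ^ ?j" by (intro power_mono) auto
    finally have "81 ^ ?j / 2 ^ (8 * ?j) \<le> 1 / (2::real) ^ ?j" by (simp only: power_one_over)
    from mult_right_mono[OF this L2_norm_nonneg[of UNIV z]]
    have t2: "81 ^ ?j * (?M / 2 ^ (8 * ?j)) \<le> ?M / 2 ^ ?j" by simp
    \<comment> \<open>The term linear in j is below 2^j and costs a factor 4 in the base; together
      with 81 this gives 324.\<close>
    have "B ^ (8 * ?j) + ?j \<le> (4 * B ^ 8) ^ ?j"
    proof -
      have j: "real ?j \<le> 2 ^ ?j" by (rule less_imp_le[OF of_nat_less_two_power])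
      have "1 \<le> (B ^ 8) ^ ?j" using B(1) by (intro one_le_power)
      then have "(B ^ 8) ^ ?j + 2 ^ ?j \<le> 2 ^ ?j * (B ^ 8) ^ ?j + 2 ^ ?j * (B ^ 8) ^ ?j"
        by (intro add_mono) (auto simp del: power_Suc simp: mult_le_cancel_right1 mult_le_cancel_left1)
      also have "\<dots> = 2 * (2 ^ ?j * (B ^ 8) ^ ?j)" by simp
      also have "\<dots> \<le> 2 ^ ?j * (2 ^ ?j * (B ^ 8) ^ ?j)"
        using B(1) by (intro mult_right_mono) (auto simp: mult_le_cancel_left1)
      also have "\<dots> = (4 * B ^ 8) ^ ?j"
        unfolding power_mult_distrib[symmetric] mult.assoc[symmetric] by simp
      finally show ?thesis using j unfolding power_mult by linarith
    qed
    then have "81 ^ ?j * (B ^ (8 * ?j) + ?j) \<le> 81 ^ ?j * (4 * B ^ 8) ^ ?j" by (rule mult_left_mono) simp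
    also have "\<dots> = (324 * B ^ 8) ^ ?j" unfolding power_mult_distrib[symmetric] by simp
    finally have t3: "81 ^ ?j * (B ^ (8 * ?j) + ?j) * \<epsilon> \<le> (324 * B ^ 8) ^ ?j * \<epsilon>" by (rule mult_right_mono[OF _ \<epsilon>])
    have "L2_norm (ball (x + u) \<sigma>) z \<le> 81 ^ ?j * (L2_norm (ball x (2 * \<sigma>)) z + ?j * \<epsilon> + ?\<Theta> ^ ?j * ?M)"
      by (rule extrapolation[OF nh \<epsilon> \<sigma> U u]) simp
    also have "\<dots> \<le> 81 ^ ?j * ((B ^ (8 * ?j) * \<epsilon> + ?M / 2 ^ (8 * ?j)) + ?j * \<epsilon> + ?\<Theta> ^ ?j * ?M)"
      by (intro mult_left_mono add_right_mono B(2)[OF z]) simp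
    also have "\<dots> = 81 ^ ?j * (B ^ (8 * ?j) + ?j) * \<epsilon> + 81 ^ ?j * (?M / 2 ^ (8 * ?j)) + 81 ^ ?j * (?\<Theta> ^ ?j * ?M)"
      by (simp only: distrib_left distrib_right mult.assoc add_ac)
    also have "\<dots> \<le> (324 * B ^ 8) ^ ?j * \<epsilon> + ?M / 2 ^ ?j + ?M / 2 ^ ?j" using t1 t2 t3 by linarith
    also have "\<dots> = (324 * B ^ 8) ^ ?j * \<epsilon> + ?M / 2 ^ k" by simp
    finally show "L2_norm (ball (x + u) \<sigma>) z \<le> (324 * B ^ 8) ^ Suc k * \<epsilon> + ?M / 2 ^ k" .
  qed auto
qed

text \<open>A translation by up to 4 \<sigma> reaches every ball of radius \<sigma> centred in the
  large one; compactness selects finitely many of them.\<close>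

lemma controlled_double:
  assumes ctrl: "controlled P (ball x (2 * \<sigma>))" and \<sigma>: "0 < \<sigma>" "\<sigma> \<le> R" "R \<le> 1"
    and small: "kernel_const TYPE('a) * (\<sigma> / R) \<le> 1 / 162"
    and U: "cball x (5 * \<sigma> + R) \<subseteq> U"
  shows "controlled P (ball x (4 * \<sigma>))"
proof -
  have cover: "cball x (4 * \<sigma>) \<subseteq> (\<Union>y\<in>cball x (4 * \<sigma>). ball y \<sigma>)" using \<sigma>(1) by auto
  obtain F where F: "F \<subseteq> cball x (4 * \<sigma>)" "finite F" "cball x (4 * \<sigma>) \<subseteq> (\<Union>y\<in>F. ball y \<sigma>)"
    by (rule compactE_image[OF compact_cball _ cover]) auto
  have "controlled P (ball y \<sigma>)" if "y \<in> F" for y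
    using controlled_step[OF assms, of "y - x"] F(1) that by (auto simp: dist_norm norm_minus_commute)
  then have "controlled P (\<Union>y\<in>F. ball y \<sigma>)" by (intro controlled_UN F(2)) auto
  then show ?thesis
    by (rule controlled_mono) (use F(3) ball_subset_cball in \<open>auto intro!: sets.finite_UN F(2)\<close>)
qed

text \<open>One radius serves all of K, because K has a positive distance to the complement of
  \<open>U\<close>. Two points of K in a common ball of radius \<sigma> are less than 2 \<sigma>
  apart, so doubling the controlled ball at one covers the ball of radius 2 \<sigma> at the other;
  connectedness of K does the rest.\<close>

lemma controlled_propagate:
  assumes U: "open U" and K: "compact K" "connected K" "K \<subseteq> U" and p: "p \<in> K" "0 < r" "controlled P (ball p r)"
    and x: "x \<in> K"
  obtains \<rho> where "0 < \<rho>" "controlled P (ball x \<rho>)"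
proof -
  let ?\<kappa> = "kernel_const TYPE('a)"
  have \<kappa>: "0 \<le> ?\<kappa>" by (rule kernel_const_nonneg)
  obtain d where d: "0 < d" "(\<Union>x\<in>K. ball x d) \<subseteq> U"
    using compact_subset_open_imp_ball_epsilon_subset[OF K(1) U K(3)] by blast
  \<comment> \<open>With \<sigma> at most R, the required radius 5 \<sigma> + R is at most 6 R,
    strictly less than d.\<close>
  define R where "R = min 1 (d / 7)"
  \<comment> \<open>The first bound makes the kernel constant times \<sigma> / R at most 1/162, with
    the summand 1 keeping the denominator positive; the second fits the ball of radius 2 \<sigma>
    into the given one.\<close>
  define \<sigma> where "\<sigma> = min (R / (162 * ?\<kappa> + 1)) (r / 2)"
  have R: "0 < R" "R \<le> 1" "7 * R \<le> d" using d(1) by (auto simp: R_def)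
  have "R / (162 * ?\<kappa> + 1) \<le> R" using R \<kappa> by (simp add: field_simps)
  then have \<sigma>: "0 < \<sigma>" "\<sigma> \<le> R" "2 * \<sigma> \<le> r" using R \<kappa> p(2) by (auto simp: \<sigma>_def)
  have small: "?\<kappa> * (\<sigma> / R) \<le> 1 / 162"
  proof -
    have "\<sigma> \<le> R / (162 * ?\<kappa> + 1)" by (simp add: \<sigma>_def)
    from divide_right_mono[OF this, of R] have "\<sigma> / R \<le> 1 / (162 * ?\<kappa> + 1)" using R by simp
    then have "?\<kappa> * (\<sigma> / R) \<le> ?\<kappa> * (1 / (162 * ?\<kappa> + 1))" by (rule mult_left_mono[OF _ \<kappa>])
    also have "\<dots> \<le> 1 / 162" using \<kappa> by (simp add: field_simps)
    finally show ?thesis .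
  qed
  have sub: "cball y (5 * \<sigma> + R) \<subseteq> U" if "y \<in> K" for y
  proof -
    have "cball y (5 * \<sigma> + R) \<subseteq> ball y d" using \<sigma>(2) R by (simp add: cball_subset_ball_iff)
    then show ?thesis using d(2) that by blast
  qed
  have "controlled P (ball x (2 * \<sigma>))"
  proof (rule connected_induction_simple[OF K(2) p(1) x, of "\<lambda>y. controlled P (ball y (2 * \<sigma>))"])
    show "controlled P (ball p (2 * \<sigma>))" by (rule controlled_mono[OF p(3)]) (use \<sigma> in auto)
    fix a assume a: "a \<in> K"
    have "controlled P (ball y (2 * \<sigma>))"
      if y: "y \<in> K \<inter> ball a \<sigma>" and y': "y' \<in> K \<inter> ball a \<sigma>" and c: "controlled P (ball y' (2 * \<sigma>))" for y y'
    proof -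
      have "controlled P (ball y' (4 * \<sigma>))"
        by (rule controlled_double[OF c \<sigma>(1,2) R(2) small sub]) (use y' in simp)
      moreover have "dist y y' \<le> 2 * \<sigma>"
        using y y' dist_triangle2[of y y' a] by (simp add: dist_commute)
      then have "ball y (2 * \<sigma>) \<subseteq> ball y' (4 * \<sigma>)" by (simp add: ball_subset_ball_iff)
      ultimately show ?thesis by (rule controlled_mono) auto
    qed
    then show "\<exists>T. openin (top_of_set K) T \<and> a \<in> T \<and> (\<forall>x\<in>T. \<forall>y\<in>T. controlled P (ball x (2 * \<sigma>)) \<longrightarrow> controlled P (ball y (2 * \<sigma>)))"
    proof (intro exI[of _ "K \<inter> ball a \<sigma>"] conjI ballI impI)
      show "openin (top_of_set K) (K \<inter> ball a \<sigma>)" by (rule openin_open_Int) simp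
      show "a \<in> K \<inter> ball a \<sigma>" using a \<sigma>(1) by simp
    qed
  qed
  then show thesis using that[of "2 * \<sigma>"] \<sigma>(1) by simp
qed

end

text \<open>With q = e / (M + e), a real exponent y is chosen for which B^y equals q^(-1/2) and 2^-y
  equals q^\<alpha>; rounding y down costs a factor 2 in the second term. For e = 0 the bound
  follows by letting k tend to infinity.\<close>

lemma holder_of_exponential_bounds:
  fixes B C :: real
  assumes B: "2 \<le> B" and C: "0 \<le> C" and e: "0 \<le> e" and M: "0 \<le> M"
    and bound: "\<And>k. X \<le> B ^ k * (C * e) + M / 2 ^ k"
  defines "\<alpha> \<equiv> ln 2 / (2 * ln B)"
  shows "X \<le> (C + 2) * e powr \<alpha> * (M + e) powr (1 - \<alpha>)"
proof (cases "e = 0")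
  case True
  have "X \<le> 0"
  proof (rule LIMSEQ_le_const)
    have "(\<lambda>k. M * (1 / 2) ^ k) \<longlonglongrightarrow> M * 0" by (intro tendsto_intros LIMSEQ_power_zero) simp
    then show "(\<lambda>k. M / 2 ^ k) \<longlonglongrightarrow> 0" by (simp add: power_one_over)
    show "\<exists>N. \<forall>n\<ge>N. X \<le> M / 2 ^ n" using bound True by auto
  qed
  then show ?thesis using True by simp
next
  case False
  define T q where "T = M + e" and "q = e / T"
  have e0: "0 < e" using e False by simp
  have T: "0 < T" "e \<le> T" "M \<le> T" using e0 M by (auto simp: T_def)
  have q: "0 < q" "q \<le> 1" using e0 T by (auto simp: q_def)
  have lnB: "0 < ln B" using B by simp
  have \<alpha>: "0 < \<alpha>" "\<alpha> \<le> 1 / 2" using B lnB by (auto simp: \<alpha>_def divide_le_eq)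
  define y where "y = - ln q / (2 * ln B)"
  have y: "0 \<le> y" using q lnB by (simp add: y_def divide_nonpos_pos)
  define k where "k = nat \<lfloor>y\<rfloor>"
  have k: "real k \<le> y" "y < real k + 1" using y by (auto simp: k_def)
  have "B ^ k = exp (real k * ln B)" using B by (simp add: exp_of_nat_mult)
  also have "\<dots> \<le> exp (y * ln B)" using k(1) lnB by simp
  also have "y * ln B = - (1 / 2) * ln q" using lnB by (simp add: y_def)
  also have "exp (- (1 / 2) * ln q) = q powr (- (1 / 2))" using q by (simp add: powr_def)
  finally have "B ^ k * q \<le> q powr (- (1 / 2)) * q" using q by (intro mult_right_mono) auto
  also have "\<dots> = q powr (1 / 2)" using q powr_add[of q "- (1 / 2)" 1] by simp
  \<comment> \<open>Since q is at most 1, the smaller exponent gives the larger power;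
    \<open>B \<ge> 2\<close> ensures that \<alpha> is at most 1/2.\<close>
  also have "\<dots> \<le> q powr \<alpha>" using q \<alpha> by (intro powr_mono') auto
  finally have 1: "B ^ k * q \<le> q powr \<alpha>" .
  have "1 / 2 ^ k = 2 * (1 / 2 ^ Suc k :: real)" by simp
  also have "1 / 2 ^ Suc k = exp (- (real (Suc k) * ln 2))" by (simp only: exp_minus exp_of_nat_mult inverse_eq_divide) simp
  also have "\<dots> \<le> exp (- (y * ln 2))" using k(2) by simp
  also have "- (y * ln 2) = \<alpha> * ln q" by (simp add: y_def \<alpha>_def)
  also have "exp (\<alpha> * ln q) = q powr \<alpha>" using q by (simp add: powr_def)
  finally have 2: "1 / 2 ^ k \<le> 2 * q powr \<alpha>" by simp
  have "X \<le> C * T * (B ^ k * q) + M * (1 / 2 ^ k)" using bound[of k] T by (simp add: q_def mult_ac)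
  also have "\<dots> \<le> C * T * q powr \<alpha> + T * (2 * q powr \<alpha>)"
    using C T M by (intro add_mono mult_left_mono mult_mono 1 2) auto
  also have "\<dots> = (C + 2) * (q powr \<alpha> * T)" by (simp add: algebra_simps)
  also have "q powr \<alpha> * T = e powr \<alpha> * T powr (1 - \<alpha>)"
    using e0 T by (simp add: q_def powr_divide powr_diff)
  finally show ?thesis by (simp add: T_def)
qed

text \<open>A Lipschitz graph leaves a cone free on its lower side; a point slightly below
  \<open>p\<close> along the axis is the centre of a ball in that cone.\<close>

lemma lipschitz_exterior_ball:
  fixes \<Omega> :: "'a::euclidean_space set"
  assumes lip: "lipschitz_portion \<Omega> S" and p: "p \<in> S" and "0 < d"
  obtains q \<rho> where "0 < \<rho>" "ball q \<rho> \<subseteq> ball p d" "ball q \<rho> \<inter> \<Omega> = {}"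
proof -
  obtain e r L \<psi> where e: "norm e = 1" and r: "0 < r" and L: "L-lipschitz_on {y. y \<bullet> e = 0 \<and> norm y < r} \<psi>" and \<psi>: "\<psi> 0 = 0"
    and graph: "\<And>x. x \<in> ball p r \<Longrightarrow> x \<in> \<Omega> \<longleftrightarrow> (x - p) \<bullet> e > \<psi> (x - p - ((x - p) \<bullet> e) *\<^sub>R e)"
    using lip p unfolding lipschitz_portion_def by blast
  have L0: "0 \<le> L" using L by (rule lipschitz_on_nonneg)
  have ee: "e \<bullet> e = 1" using e by (simp add: norm_eq_1)
  \<comment> \<open>In the ball the height is below \<rho> - t, whereas the graph lies above -2 L
    \<rho>, as projections have norm at most 2 \<rho>. The choice t = 2 (\<rho> + 2 L \<rho>)
    separates the two; t is at most half of r and of d to stay in both balls around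
    \<open>p\<close>.\<close>
  define t \<rho> q where "t = min r d / 2" and "\<rho> = t / (2 * (1 + 2 * L))" and "q = p - t *\<^sub>R e"
  have t: "0 < t" "2 * t \<le> r" "2 * t \<le> d" using r \<open>0 < d\<close> by (auto simp: t_def)
  have \<rho>: "0 < \<rho>" using t L0 by (simp add: \<rho>_def)
  have "\<rho> * (2 * (1 + 2 * L)) = t" using L0 by (simp add: \<rho>_def)
  then have \<rho>t: "2 * (\<rho> + 2 * L * \<rho>) = t" by (simp add: algebra_simps)
  have \<rho>2: "2 * \<rho> \<le> t" using \<rho>t L0 \<rho> by (smt (verit) mult_nonneg_nonneg)
  have near: "dist p x < 2 * t" if "x \<in> ball q \<rho>" for x
  proof -
    have "dist p x \<le> dist p q + dist q x" by (rule dist_triangle)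
    also have "dist p q = t" using t e by (simp add: q_def dist_norm)
    finally show ?thesis using that \<rho>2 \<rho> by simp
  qed
  show thesis
  proof (rule that[OF \<rho>])
    show "ball q \<rho> \<subseteq> ball p d" using near t by force
    show "ball q \<rho> \<inter> \<Omega> = {}"
    proof (safe)
      fix x assume x: "x \<in> ball q \<rho>" and "x \<in> \<Omega>"
      define w where "w = x - q"
      have w: "norm w < \<rho>" using x by (simp add: w_def dist_norm norm_minus_commute)
      have xp: "x - p = w - t *\<^sub>R e" by (simp add: w_def q_def)
      define y where "y = w - (w \<bullet> e) *\<^sub>R e"
      have y: "x - p - ((x - p) \<bullet> e) *\<^sub>R e = y"
        unfolding xp y_def by (simp add: inner_diff_left ee algebra_simps)
      have we: "\<bar>w \<bullet> e\<bar> \<le> norm w" using Cauchy_Schwarz_ineq2[of w e] e by simp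
      have "norm y \<le> norm w + norm ((w \<bullet> e) *\<^sub>R e)" unfolding y_def by (rule norm_triangle_ineq4)
      then have ny: "norm y \<le> 2 * \<rho>" using we w e by simp
      have ye: "y \<bullet> e = 0" by (simp add: y_def inner_diff_left ee)
      have "norm y < r" using ny \<rho>2 t by linarith
      then have "dist (\<psi> y) (\<psi> 0) \<le> L * dist y 0" using ye r by (intro lipschitz_onD[OF L]) auto
      then have "- (L * norm y) \<le> \<psi> y" using \<psi> by (simp add: dist_norm)
      moreover have "L * norm y \<le> L * (2 * \<rho>)" by (rule mult_left_mono[OF ny L0])
      moreover have "(x - p) \<bullet> e > \<psi> y"
        using graph[of x] \<open>x \<in> \<Omega>\<close> near[OF x] t y by simp
      moreover have "(x - p) \<bullet> e = w \<bullet> e - t" unfolding xp by (simp add: inner_diff_left ee)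
      moreover have "0 \<le> L * \<rho>" using L0 \<rho> by simp
      ultimately have False using we w \<rho>t \<rho> by (simp add: algebra_simps)
      then show "x \<in> {}" ..
    qed
  qed
qed

theorem theorem2p4:
  fixes \<Omega> \<Sigma> \<Sigma>c G :: "(real ^ 'n) set"
  assumes "domain \<Omega>" and "bounded \<Omega>"
    and "\<Sigma> \<noteq> {}" and "openin (top_of_set (frontier \<Omega>)) \<Sigma>" and "connected \<Sigma>"
    and "lipschitz_portion \<Omega> \<Sigma>"
    and "\<Sigma>c = frontier \<Omega> - closure \<Sigma>"
    and "domain G" and "G \<subseteq> \<Omega>"
    and "\<exists>\<delta>>0. \<forall>x\<in>G. \<forall>y\<in>\<Sigma>c. dist x y \<ge> \<delta>"
  shows "\<exists>\<alpha>\<in>{0<..<1}. \<exists>K. \<forall>z\<in>L2 \<Omega>.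
           L2_norm G z \<le> K * dual_norm \<Omega> \<Sigma>c (B_op \<Omega> z) powr \<alpha> *
             (L2_norm \<Omega> z + dual_norm \<Omega> \<Sigma>c (B_op \<Omega> z)) powr (1 - \<alpha>)"
proof -
  have \<Omega>: "open \<Omega>" "connected \<Omega>" "\<Omega> \<noteq> {}" and G: "open G"
    using assms(1,8) by (auto simp: domain_def)
  define U where "U = - closure \<Sigma>c"
  define C where "C = sqrt (card (dirs2 :: (real ^ 'n) list set)) * potential_const TYPE(real ^ 'n)"
  have C: "0 \<le> C" using potential_const_ge[where 'a="real ^ 'n"] by (simp add: C_def)
  let ?d = "\<lambda>z. dual_norm \<Omega> \<Sigma>c (B_op \<Omega> z)" and ?ext = "\<lambda>z x. if x \<in> \<Omega> then z x else (0::real)"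
  \<comment> \<open>All \<open>z\<close> enter as one family, so that the constant from
    \<open>controlled\<close> is uniform in \<open>z\<close>.\<close>
  define P where "P = {(C * ?d z, ?ext z) | z. z \<in> L2 \<Omega>}"
  have disj: "\<Omega> \<inter> \<Sigma>c = {}"
    using \<Omega>(1) assms(7) by (auto simp: frontier_def interior_open)
  have d: "0 \<le> ?d z" if "z \<in> L2 \<Omega>" for z
    by (rule dual_norm_B_op_nonneg[OF \<Omega>(1,3) that disj])
  interpret near_harmonic_family P U
  proof
    fix \<epsilon> w assume "(\<epsilon>, w) \<in> P"
    then obtain z where z: "z \<in> L2 \<Omega>" "\<epsilon> = C * ?d z" "w = ?ext z" by (auto simp: P_def)
    show "0 \<le> \<epsilon> \<and> near_harmonic U \<epsilon> w"
      unfolding z(2,3) U_def C_def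
      using near_harmonic_zero_extension[OF \<Omega>(1) z(1) d[OF z(1)]] C d[OF z(1)] by (simp add: C_def)
  qed
  have disjoint_closure: "W \<subseteq> U" if "open W" "W \<inter> \<Sigma>c = {}" for W
    using that open_Int_closure_eq_empty[of W \<Sigma>c] unfolding U_def by auto
  have U: "open U" by (simp add: U_def open_Compl)
  obtain p where p: "p \<in> \<Sigma>" using assms(3) by blast
  obtain V where V: "open V" "\<Sigma> = frontier \<Omega> \<inter> V" using assms(4) by (auto simp: openin_open)
  then have "p \<in> V" using p by blast
  then obtain d0 where d0: "0 < d0" "ball p d0 \<subseteq> V" using V(1) open_contains_ball by blast
  \<comment> \<open>Inside V the boundary of \<Omega> consists of \<Sigma> only, so this ball may be
    entered from both sides.\<close>
  have "ball p d0 \<inter> \<Sigma>c = {}" using d0(2) V(2) closure_subset[of \<Sigma>] unfolding assms(7) by blast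
  then have ball_U: "ball p d0 \<subseteq> U" by (intro disjoint_closure) auto
  have \<Omega>_U: "\<Omega> \<subseteq> U" by (rule disjoint_closure[OF \<Omega>(1) disj])
  obtain q \<rho> where q: "0 < \<rho>" "ball q \<rho> \<subseteq> ball p d0" "ball q \<rho> \<inter> \<Omega> = {}"
    using lipschitz_exterior_ball[OF assms(6) p d0(1)] .
  have start: "controlled P (ball q \<rho>)"
  proof (rule controlledI[of _ 1])
    fix \<epsilon> w k assume w: "(\<epsilon>, w) \<in> P"
    have "w x = 0" if "x \<in> ball q \<rho>" for x
    proof -
      have "x \<notin> \<Omega>" using q(3) that by blast
      then show ?thesis using w by (auto simp: P_def)
    qed
    then have "(LINT x|lebesgue_on (ball q \<rho>). (w x)\<^sup>2) = (LINT x|lebesgue_on (ball q \<rho>). 0)"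
      by (intro Bochner_Integration.integral_cong) (auto simp: space_restrict_space)
    then have "L2_norm (ball q \<rho>) w = 0" by (simp add: L2_norm_def)
    then show "L2_norm (ball q \<rho>) w \<le> 1 ^ Suc k * \<epsilon> + L2_norm UNIV w / 2 ^ k" using family[OF w] by simp
  qed auto
  obtain \<delta> where \<delta>: "0 < \<delta>" "\<And>x y. x \<in> G \<Longrightarrow> y \<in> \<Sigma>c \<Longrightarrow> \<delta> \<le> dist x y" using assms(10) by blast
  have local: "\<exists>r>0. controlled P (ball x r)" if x: "x \<in> closure G" for x
  proof -
    have "ball x \<delta> \<inter> \<Sigma>c = {}"
    proof (rule ccontr)
      assume "ball x \<delta> \<inter> \<Sigma>c \<noteq> {}"
      then obtain y where y: "dist x y < \<delta>" "y \<in> \<Sigma>c" by auto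
      obtain g where g: "g \<in> G" "dist g x < \<delta> - dist x y"
        using x y(1) closure_approachable[of x G] by (metis diff_gt_0_iff_gt)
      show False using \<delta>(2)[OF g(1) y(2)] g(2) dist_triangle[of g y x] by linarith
    qed
    then have ball_x: "ball x \<delta> \<subseteq> U" by (intro disjoint_closure) auto
    \<comment> \<open>A point of the closure of G may lie on the boundary of \<Omega>, and the
      starting ball lies outside \<Omega>. Therefore the path runs in \<Omega> enlarged at both ends
      by balls that avoid \<Sigma>c; consecutive pieces overlap.\<close>
    let ?W = "(ball p d0 \<union> \<Omega>) \<union> ball x \<delta>"
    have "ball p d0 \<inter> \<Omega> \<noteq> {}"
    proof -
      have "p \<in> closure \<Omega>" using p V(2) by (auto simp: frontier_def)
      then obtain y where "y \<in> \<Omega>" "dist y p < d0" using d0(1) closure_approachable[of p \<Omega>] by blast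
      then have "y \<in> ball p d0 \<inter> \<Omega>" by (simp add: dist_commute)
      then show ?thesis by blast
    qed
    then have c1: "connected (ball p d0 \<union> \<Omega>)" by (intro connected_Un \<Omega>) auto
    have "(ball p d0 \<union> \<Omega>) \<inter> ball x \<delta> \<noteq> {}"
    proof -
      obtain y where "y \<in> G" "dist y x < \<delta>" using \<delta>(1) x closure_approachable[of x G] by blast
      then have "y \<in> \<Omega> \<inter> ball x \<delta>" using assms(9) by (auto simp: dist_commute)
      then show ?thesis by blast
    qed
    then have "connected ?W" by (intro connected_Un c1) auto
    then have "path_connected ?W" by (intro connected_open_path_connected) (auto intro: \<Omega>(1))
    moreover have "q \<in> ?W" using subsetD[OF q(2), of q] q(1) by simp
    moreover have "x \<in> ?W" using \<delta>(1) by simp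
    ultimately obtain g where g: "path g" "path_image g \<subseteq> ?W" "pathstart g = q" "pathfinish g = x"
      unfolding path_connected_def by metis
    have "path_image g \<subseteq> U" using g(2) ball_U \<Omega>_U ball_x by blast
    moreover have "q \<in> path_image g" "x \<in> path_image g"
      using pathstart_in_path_image[of g] pathfinish_in_path_image[of g] g by auto
    ultimately obtain r where "0 < r" "controlled P (ball x r)"
      using controlled_propagate[OF U compact_path_image[OF g(1)] connected_path_image[OF g(1)] _ _ q(1) start]
      by metis
    then show ?thesis by blast
  qed
  then obtain r where r: "\<And>x. x \<in> closure G \<Longrightarrow> 0 < r x \<and> controlled P (ball x (r x))" by metis
  have comp: "compact (closure G)"
    using bounded_subset[OF assms(2,9)] by (simp add: compact_closure)
  have cover: "closure G \<subseteq> (\<Union>x\<in>closure G. ball x (r x))" using r by auto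
  obtain F where F: "F \<subseteq> closure G" "finite F" "closure G \<subseteq> (\<Union>x\<in>F. ball x (r x))"
    by (rule compactE_image[OF comp _ cover]) auto
  have "controlled P (\<Union>x\<in>F. ball x (r x))" using F(1) r by (intro controlled_UN F(2)) auto
  then have "controlled P G"
    by (rule controlled_mono) (use F(3) closure_subset[of G] G in \<open>auto intro!: sets.finite_UN F(2)\<close>)
  then obtain B where B: "1 \<le> B" "\<And>\<epsilon> w k. (\<epsilon>, w) \<in> P \<Longrightarrow> L2_norm G w \<le> B ^ k * \<epsilon> + L2_norm UNIV w / 2 ^ k"
    unfolding controlled_def by blast
  \<comment> \<open>The base \<open>B + 1\<close> is at least 2, which keeps \<alpha> at most
    1/2.\<close>
  define \<alpha> where "\<alpha> = ln 2 / (2 * ln (B + 1))"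
  have ln: "0 < ln (2::real)" "ln 2 \<le> ln (B + 1)" using B(1) by auto
  then have "0 < 2 * ln (B + 1)" by linarith
  then have \<alpha>: "\<alpha> \<in> {0<..<1}"
    unfolding \<alpha>_def greaterThanLessThan_iff using ln by (intro conjI divide_pos_pos) (auto simp only: pos_divide_less_eq)
  have "L2_norm G z \<le> (C + 2) * ?d z powr \<alpha> * (L2_norm \<Omega> z + ?d z) powr (1 - \<alpha>)" if z: "z \<in> L2 \<Omega>" for z
    unfolding \<alpha>_def
  proof (rule holder_of_exponential_bounds[OF _ C d[OF z]])
    fix k
    have mem: "(C * ?d z, ?ext z) \<in> P" using z by (auto simp: P_def)
    have "(LINT x|lebesgue_on G. (?ext z x)\<^sup>2) = (LINT x|lebesgue_on G. (z x)\<^sup>2)"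
      by (rule Bochner_Integration.integral_cong) (use assms(9) in \<open>auto simp: space_restrict_space\<close>)
    then have "L2_norm G z = L2_norm G (?ext z)" by (simp add: L2_norm_def)
    also have "\<dots> \<le> B ^ k * (C * ?d z) + L2_norm \<Omega> z / 2 ^ k"
      using B(2)[OF mem, of k] L2_norm_restrict[of \<Omega> z] \<Omega>(1) by simp
    also have "\<dots> \<le> (B + 1) ^ k * (C * ?d z) + L2_norm \<Omega> z / 2 ^ k"
      using B(1) C d[OF z] by (intro add_right_mono mult_right_mono power_mono) auto
    finally show "L2_norm G z \<le> (B + 1) ^ k * (C * ?d z) + L2_norm \<Omega> z / 2 ^ k" .
  qed (use B(1) in auto)
  then show ?thesis using \<alpha> by blast
qed

end
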